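(* Let $A_1,A_0,A_{-1},B\in B(\mathfrak k)$ satisfy the unitarity conditions and let $U^t_s$, $s,t\in\mathbb R$, be the corresponding unitary operators on $\Gamma$. For any $k\in\{0,1,2,\dots\}$ there exists a polynomial $P$ of degree $\le k$ such that for all $g\in\Gamma_k$ and all $s,t\in\mathbb R$ $$\|U^t_sg\|_{\Gamma_k}^2\le P(|t-s|)\,\|g\|_{\Gamma_k}^2.$$
   Context: $\mathfrak k$ is a Hilbert space with countable base. $\mathfrak R=\{\emptyset\}+\mathbb R+\mathbb R^2+\cdots$ (disjoint union). For a finite index set $\alpha$, $t_\alpha=(t_c)_{c\in\alpha}$; for symmetric $f$ on $\mathfrak R$, $f(\alpha)$ abbreviates $f(t_\alpha)$; $+$ of index sets is disjoint union. $\int f(\alpha)\lambda_\alpha=f(\emptyset)+\sum_{n\ge1}\frac1{n!}\int_{\mathbb R^n}f(t_1,\dots,t_n)dt_1\cdots dt_n$. $\Gamma=L^2_s(\mathfrak R,\mathfrak k,\lambda)$ is the Fock space of symmetric square integrable functions. $(Nf)(w)=(\#w)f(w)$, and $\Gamma_k$ is the space of measurable symmetric $f:\mathfrak R\to\mathfrak k$ with $\|f\|_{\Gamma_k}^2=\int\langle f(\omega)|((N+1)^kf)(\omega)\rangle\lambda_\omega<\infty$. $\mathcal K$: symmetric norm-continuous functions $\mathfrak R\to\mathfrak k$ with compact support. Unitarity conditions: there is a unitary $\Upsilon$ on $\mathfrak k$ with $A_0=\Upsilon-1$, $A_1=-\Upsilon A_{-1}^+$, $B+B^+=-A_1^+A_1=-A_{-1}A_{-1}^+$.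 Kernel $u^t_s=u^t_s(A_1,A_0,A_{-1};B)$: for $s<t$ and $(t_\sigma,t_\tau,t_\upsilon)\in\mathfrak R^3$ such that $s,t$ and all coordinates are pairwise different, let $s_1<\dots<s_n$ be all coordinates in increasing order and $i_j=1,0,-1$ according to whether $s_j$ belongs to $t_\sigma,t_\tau,t_\upsilon$; then $$u^t_s(t_\sigma,t_\tau,t_\upsilon)=\mathbf 1\{s<s_1<\dots<s_n<t\}\,e^{(t-s_n)B}A_{i_n}e^{(s_n-s_{n-1})B}\cdots A_{i_2}e^{(s_2-s_1)B}A_{i_1}e^{(s_1-s)B},$$ with $u^t_s(\emptyset,\emptyset,\emptyset)=e^{(t-s)B}$. For $s<t$, $U^t_s$ is the unitary extension to $\Gamma$ of the map $\mathcal O(u^t_s):\mathcal K\to\Gamma$, $$(\mathcal O(u^t_s)g)(\omega)=\sum_{\alpha\subset\omega}\sum_{\beta\subset\omega\setminus\alpha}\int\lambda_\upsilon\,u^t_s(\alpha,\beta,\upsilon)\,g((\omega\setminus\alpha)+\upsilon);$$ $U^s_s=1$ and for $t<s$, $U^t_s=(U^s_t)^+$ (adjoint). *)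

theory Defs
  imports "HOL-Analysis.Analysis" "HOL-Computational_Algebra.Polynomial"
begin

section \<open>Complex Hilbert spaces and bounded operators\<close>

text \<open>The scalar product is antilinear in the first and linear in the second argument.
  Positive definiteness is contained in the last axiom, since \<open>norm\<close> is a norm.\<close>

class complex_hilbert = banach +
  fixes scaleC :: "complex \<Rightarrow> 'a \<Rightarrow> 'a"
    and cinner :: "'a \<Rightarrow> 'a \<Rightarrow> complex"
  assumes scaleR_scaleC: "scaleR r x = scaleC (complex_of_real r) x"
    and scaleC_add_right: "scaleC a (x + y) = scaleC a x + scaleC a y"
    and scaleC_add_left: "scaleC (a + b) x = scaleC a x + scaleC b x"
    and scaleC_scaleC: "scaleC a (scaleC b x) = scaleC (a * b) x"
    and cinner_commute: "cinner x y = cnj (cinner y x)"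
    and cinner_add_right: "cinner x (y + z) = cinner x y + cinner x z"
    and cinner_scaleC_right: "cinner x (scaleC a y) = a * cinner x y"
    and cinner_self: "cinner x x = complex_of_real ((norm x)\<^sup>2)"

text \<open>The type \<open>'k \<Rightarrow>\<^sub>L 'k\<close> consists of the bounded real-linear maps; \<open>B(\<kk>)\<close> is its
  subset of complex-linear maps.\<close>

definition bounded_ops :: "('k::complex_hilbert \<Rightarrow>\<^sub>L 'k) set" where
  "bounded_ops = {A. \<forall>c x. blinfun_apply A (scaleC c x) = scaleC c (blinfun_apply A x)}"

definition adj :: "('k::complex_hilbert \<Rightarrow>\<^sub>L 'k) \<Rightarrow> ('k \<Rightarrow>\<^sub>L 'k)" where
  "adj A = (THE A'. \<forall>x y. cinner (blinfun_apply A x) y = cinner x (blinfun_apply A' y))"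

definition unitary_op :: "('k::complex_hilbert \<Rightarrow>\<^sub>L 'k) \<Rightarrow> bool" where
  "unitary_op V \<longleftrightarrow> V \<in> bounded_ops \<and> adj V o\<^sub>L V = id_blinfun \<and> V o\<^sub>L adj V = id_blinfun"

definition op_exp :: "('k::complex_hilbert \<Rightarrow>\<^sub>L 'k) \<Rightarrow> ('k \<Rightarrow>\<^sub>L 'k)" where
  "op_exp T = (\<Sum>n. (((\<lambda>X. T o\<^sub>L X) ^^ n) id_blinfun) /\<^sub>R fact n)"

definition unitarity_conditions ::
  "('k::complex_hilbert \<Rightarrow>\<^sub>L 'k) \<Rightarrow> ('k \<Rightarrow>\<^sub>L 'k) \<Rightarrow> ('k \<Rightarrow>\<^sub>L 'k) \<Rightarrow> ('k \<Rightarrow>\<^sub>L 'k) \<Rightarrow> bool" where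
  "unitarity_conditions A1 A0 Am B \<longleftrightarrow>
     (\<exists>\<Upsilon>. unitary_op \<Upsilon> \<and> A0 = \<Upsilon> - id_blinfun \<and> A1 = - (\<Upsilon> o\<^sub>L adj Am) \<and>
        B + adj B = - (adj A1 o\<^sub>L A1) \<and> B + adj B = - (Am o\<^sub>L adj Am))"


section \<open>The configuration space and its Fock space\<close>

text \<open>A point of the disjoint union of the spaces \<open>\<real>\<^sup>n\<close> is a list of reals, the list \<open>[]\<close>
  being the point \<open>\<emptyset>\<close>. The space \<open>\<real>\<^sup>n\<close> with its usual topology and Lebesgue measure is
  represented by the products over the index set \<open>{..<n}\<close>.\<close>

definition conf :: "nat \<Rightarrow> (nat \<Rightarrow> real) \<Rightarrow> real list" where
  "conf n x = map x [0..<n]"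

definition conf_topology :: "real list topology" where
  "conf_topology = topology (\<lambda>U. \<forall>n.
     openin (product_topology (\<lambda>_. euclideanreal) {..<n})
       (conf n -` U \<inter> topspace (product_topology (\<lambda>_. euclideanreal) {..<n})))"

definition conf_measure :: "real list measure" where
  "conf_measure = measure_of UNIV
     {A. \<forall>n. conf n -` A \<inter> space (PiM {..<n} (\<lambda>_. lborel)) \<in> sets (PiM {..<n} (\<lambda>_. lborel))}
     (\<lambda>A. \<Sum>n. emeasure (PiM {..<n} (\<lambda>_. lborel))
                  (conf n -` A \<inter> space (PiM {..<n} (\<lambda>_. lborel))) / ennreal (fact n))"

text \<open>The next lemmas confirm that \<open>topology\<close> and \<open>measure_of\<close> are applied to a genuine
  topology and a genuine measure.\<close>

lemma openin_conf_topology: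
  "openin conf_topology U \<longleftrightarrow> (\<forall>n.
     openin (product_topology (\<lambda>_. euclideanreal) {..<n})
       (conf n -` U \<inter> topspace (product_topology (\<lambda>_. euclideanreal) {..<n})))"
proof -
  let ?T = "\<lambda>n::nat. product_topology (\<lambda>_. euclideanreal) {..<n}"
  have "istopology (\<lambda>U. \<forall>n. openin (?T n) (conf n -` U \<inter> topspace (?T n)))"
    unfolding istopology_def
  proof (intro conjI allI impI)
    fix S T n
    assume "\<forall>n. openin (?T n) (conf n -` S \<inter> topspace (?T n))"
      "\<forall>n. openin (?T n) (conf n -` T \<inter> topspace (?T n))"
    then have "openin (?T n) ((conf n -` S \<inter> topspace (?T n)) \<inter> (conf n -` T \<inter> topspace (?T n)))"
      by blast
    moreover have "(conf n -` S \<inter> topspace (?T n)) \<inter> (conf n -` T \<inter> topspace (?T n))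
        = conf n -` (S \<inter> T) \<inter> topspace (?T n)" by auto
    ultimately show "openin (?T n) (conf n -` (S \<inter> T) \<inter> topspace (?T n))" by metis
  next
    fix \<K> n
    assume "\<forall>K\<in>\<K>. \<forall>n. openin (?T n) (conf n -` K \<inter> topspace (?T n))"
    then have "openin (?T n) (\<Union>K\<in>\<K>. conf n -` K \<inter> topspace (?T n))"
      by blast
    moreover have "(\<Union>K\<in>\<K>. conf n -` K \<inter> topspace (?T n)) = conf n -` (\<Union>\<K>) \<inter> topspace (?T n)"
      by auto
    ultimately show "openin (?T n) (conf n -` (\<Union>\<K>) \<inter> topspace (?T n))" by metis
  qed
  then show ?thesis
    by (simp add: conf_topology_def topology_inverse')
qed

lemma conf_sigma_algebra:
  "sigma_algebra UNIV
     {A. \<forall>n. conf n -` A \<inter> space (PiM {..<n} (\<lambda>_. lborel)) \<in> sets (PiM {..<n} (\<lambda>_. lborel))}"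
proof -
  let ?M = "\<lambda>n::nat. PiM {..<n} (\<lambda>_. lborel :: real measure)"
  let ?v = "\<lambda>n A. conf n -` A \<inter> space (?M n)"
  have 1: "?v n (UNIV - A) = space (?M n) - ?v n A" for n A by auto
  have 2: "?v n (\<Union>(range A)) = (\<Union>i::nat. ?v n (A i))" for n and A :: "nat \<Rightarrow> real list set"
    by auto
  show ?thesis
    unfolding sigma_algebra_iff2
  proof (intro conjI ballI allI impI)
    fix A :: "nat \<Rightarrow> real list set"
    assume "range A \<subseteq> {A. \<forall>n. ?v n A \<in> sets (?M n)}"
    then have "?v n (A i) \<in> sets (?M n)" for n i by auto
    then show "\<Union> (range A) \<in> {A. \<forall>n. ?v n A \<in> sets (?M n)}"
      unfolding mem_Collect_eq 2 by blast
  next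
    fix A assume "A \<in> {A. \<forall>n. ?v n A \<in> sets (?M n)}"
    then show "UNIV - A \<in> {A. \<forall>n. ?v n A \<in> sets (?M n)}"
      unfolding mem_Collect_eq 1 by blast
  qed auto
qed

lemma space_conf_measure: "space conf_measure = UNIV"
  by (simp add: conf_measure_def space_measure_of_conv)

lemma sets_conf_measure:
  "sets conf_measure =
     {A. \<forall>n. conf n -` A \<inter> space (PiM {..<n} (\<lambda>_. lborel)) \<in> sets (PiM {..<n} (\<lambda>_. lborel))}"
  unfolding conf_measure_def
  by (rule sigma_algebra.sets_measure_of_eq[OF conf_sigma_algebra])

lemma emeasure_conf_measure:
  assumes "A \<in> sets conf_measure"
  shows "emeasure conf_measure A =
    (\<Sum>n. emeasure (PiM {..<n} (\<lambda>_. lborel))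
            (conf n -` A \<inter> space (PiM {..<n} (\<lambda>_. lborel))) / ennreal (fact n))"
proof (rule emeasure_measure_of[OF conf_measure_def])
  let ?M = "\<lambda>n::nat. PiM {..<n} (\<lambda>_. lborel :: real measure)"
  let ?v = "\<lambda>n A. conf n -` A \<inter> space (?M n)"
  show "positive (sets conf_measure) (\<lambda>A. \<Sum>n. emeasure (?M n) (?v n A) / ennreal (fact n))"
    by (simp add: positive_def)
  show "countably_additive (sets conf_measure)
      (\<lambda>A. \<Sum>n. emeasure (?M n) (?v n A) / ennreal (fact n))"
  proof (rule countably_additiveI)
    fix A :: "nat \<Rightarrow> real list set"
    assume A: "range A \<subseteq> sets conf_measure" "disjoint_family A"
    have add: "(\<Sum>i. emeasure (?M n) (?v n (A i)) / ennreal (fact n))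
        = emeasure (?M n) (?v n (\<Union>i. A i)) / ennreal (fact n)" for n
    proof -
      have "(\<Sum>i. emeasure (?M n) (?v n (A i))) = emeasure (?M n) (\<Union>i. ?v n (A i))"
      proof (rule suminf_emeasure)
        show "range (\<lambda>i. ?v n (A i)) \<subseteq> sets (?M n)"
          using A(1) by (auto simp: sets_conf_measure)
        have "A i \<inter> A j = {}" if "i \<noteq> j" for i j
          using A(2) that by (simp add: disjoint_family_on_def)
        then show "disjoint_family (\<lambda>i. ?v n (A i))"
          unfolding disjoint_family_on_def by blast
      qed
      moreover have "(\<Union>i. ?v n (A i)) = ?v n (\<Union>i. A i)" by auto
      ultimately show ?thesis
        by (simp add: ennreal_suminf_divide)
    qed
    have swap: "(\<Sum>i n. h i n) = (\<Sum>n i. h i n)" for h :: "nat \<Rightarrow> nat \<Rightarrow> ennreal"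
      using nn_integral_suminf[of "\<lambda>n i. h i n" "count_space UNIV"]
      by (simp add: nn_integral_count_space_nat)
    show "(\<Sum>i n. emeasure (?M n) (?v n (A i)) / ennreal (fact n))
        = (\<Sum>n. emeasure (?M n) (?v n (\<Union>i. A i)) / ennreal (fact n))"
      by (subst swap) (simp only: add)
  qed
qed (use assms in auto)

definition symmetric :: "(real list \<Rightarrow> 'k) \<Rightarrow> bool" where
  "symmetric f \<longleftrightarrow> (\<forall>v w. mset v = mset w \<longrightarrow> f v = f w)"

definition number_op :: "(real list \<Rightarrow> 'k::complex_hilbert) \<Rightarrow> real list \<Rightarrow> 'k" where
  "number_op f w = real (length w) *\<^sub>R f w"

definition number_succ_power :: "nat \<Rightarrow> (real list \<Rightarrow> 'k::complex_hilbert) \<Rightarrow> real list \<Rightarrow> 'k" where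
  "number_succ_power k = (\<lambda>f w. number_op f w + f w) ^^ k"

text \<open>Squared norms take values in \<open>[0,\<infinity>]\<close>.\<close>

definition Gamma_norm2 :: "nat \<Rightarrow> (real list \<Rightarrow> 'k::complex_hilbert) \<Rightarrow> ennreal" where
  "Gamma_norm2 k f =
     (\<integral>\<^sup>+ w. ennreal (Re (cinner (f w) (number_succ_power k f w))) \<partial>conf_measure)"

text \<open>Elements of the spaces \<open>\<Gamma>\<^sub>k\<close> are represented by functions; equality in \<open>\<Gamma>\<^sub>k\<close> is
  equality almost everywhere. The Fock space is \<open>\<Gamma> = \<Gamma>\<^sub>0\<close>.\<close>

definition Gamma_space :: "nat \<Rightarrow> (real list \<Rightarrow> 'k::complex_hilbert) set" where
  "Gamma_space k = {f. f \<in> borel_measurable conf_measure \<and> symmetric f \<and> Gamma_norm2 k f < \<infinity>}"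

abbreviation Fock :: "(real list \<Rightarrow> 'k::complex_hilbert) set" where
  "Fock \<equiv> Gamma_space 0"

definition Fock_inner ::
  "(real list \<Rightarrow> 'k::complex_hilbert) \<Rightarrow> (real list \<Rightarrow> 'k) \<Rightarrow> complex" where
  "Fock_inner f g = (LINT w|conf_measure. cinner (f w) (g w))"

definition test_functions :: "(real list \<Rightarrow> 'k::complex_hilbert) set" where
  "test_functions = {f. symmetric f \<and> continuous_map conf_topology euclidean f \<and>
     compactin conf_topology (conf_topology closure_of {w. f w \<noteq> 0})}"

text \<open>A unitary operator on \<open>\<Gamma>\<close>, given on representatives.\<close>

definition unitary_on_Fock ::
  "((real list \<Rightarrow> 'k::complex_hilbert) \<Rightarrow> (real list \<Rightarrow> 'k)) \<Rightarrow> bool" where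
  "unitary_on_Fock V \<longleftrightarrow>
     (\<forall>f\<in>Fock. V f \<in> Fock) \<and>
     (\<forall>f\<in>Fock. \<forall>g\<in>Fock. (AE w in conf_measure. f w = g w) \<longrightarrow>
        (AE w in conf_measure. V f w = V g w)) \<and>
     (\<forall>f\<in>Fock. \<forall>g\<in>Fock. AE w in conf_measure. V (\<lambda>w. f w + g w) w = V f w + V g w) \<and>
     (\<forall>c. \<forall>f\<in>Fock. AE w in conf_measure. V (\<lambda>w. scaleC c (f w)) w = scaleC c (V f w)) \<and>
     (\<forall>f\<in>Fock. \<forall>g\<in>Fock. Fock_inner (V f) (V g) = Fock_inner f g) \<and>
     (\<forall>g\<in>Fock. \<exists>f\<in>Fock. AE w in conf_measure. V f w = g w)"

definition adjoint_on_Fock ::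
  "((real list \<Rightarrow> 'k::complex_hilbert) \<Rightarrow> (real list \<Rightarrow> 'k)) \<Rightarrow>
   ((real list \<Rightarrow> 'k) \<Rightarrow> (real list \<Rightarrow> 'k)) \<Rightarrow> bool" where
  "adjoint_on_Fock V W \<longleftrightarrow>
     (\<forall>g\<in>Fock. W g \<in> Fock) \<and>
     (\<forall>f\<in>Fock. \<forall>g\<in>Fock. Fock_inner (V f) g = Fock_inner f (W g))"


section \<open>The kernel and the unitary evolution\<close>

text \<open>The operator product along a list \<open>(s\<^sub>1,C\<^sub>1), \<dots>, (s\<^sub>n,C\<^sub>n)\<close> of times and operators:
  \<open>e\<^bsup>(t-s\<^sub>n)B\<^esup> C\<^sub>n \<dots> C\<^sub>1 e\<^bsup>(s\<^sub>1-s)B\<^esup>\<close>.\<close>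

fun time_product ::
  "('k::complex_hilbert \<Rightarrow>\<^sub>L 'k) \<Rightarrow> real \<Rightarrow> real \<Rightarrow> (real \<times> ('k \<Rightarrow>\<^sub>L 'k)) list \<Rightarrow> ('k \<Rightarrow>\<^sub>L 'k)" where
  "time_product B s t [] = op_exp ((t - s) *\<^sub>R B)"
| "time_product B s t ((r, C) # xs) =
     time_product B r t xs o\<^sub>L (C o\<^sub>L op_exp ((r - s) *\<^sub>R B))"

text \<open>On the null set where \<open>s\<close>, \<open>t\<close> and the coordinates are not pairwise different the kernel
  gets the value \<open>0\<close>.\<close>

definition kernel ::
  "('k::complex_hilbert \<Rightarrow>\<^sub>L 'k) \<Rightarrow> ('k \<Rightarrow>\<^sub>L 'k) \<Rightarrow> ('k \<Rightarrow>\<^sub>L 'k) \<Rightarrow> ('k \<Rightarrow>\<^sub>L 'k) \<Rightarrow>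
   real \<Rightarrow> real \<Rightarrow> real list \<Rightarrow> real list \<Rightarrow> real list \<Rightarrow> ('k \<Rightarrow>\<^sub>L 'k)" where
  "kernel A1 A0 Am B s t \<sigma> \<tau> \<upsilon> =
     (if distinct (\<sigma> @ \<tau> @ \<upsilon>) \<and> (\<forall>r\<in>set (\<sigma> @ \<tau> @ \<upsilon>). s < r \<and> r < t)
      then time_product B s t (sort_key fst
             (map (\<lambda>r. (r, A1)) \<sigma> @ map (\<lambda>r. (r, A0)) \<tau> @ map (\<lambda>r. (r, Am)) \<upsilon>))
      else 0)"

text \<open>The subsets \<open>\<alpha>\<close>, \<open>\<beta>\<close> of \<open>\<omega>\<close> are sets of positions in the list \<open>w\<close>.\<close>

definition kernel_op ::
  "(real list \<Rightarrow> real list \<Rightarrow> real list \<Rightarrow> ('k::{complex_hilbert, second_countable_topology} \<Rightarrow>\<^sub>L 'k)) \<Rightarrow>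
   (real list \<Rightarrow> 'k) \<Rightarrow> (real list \<Rightarrow> 'k)" where
  "kernel_op u g w =
     (\<Sum>\<alpha>\<in>Pow {..<length w}. \<Sum>\<beta>\<in>Pow ({..<length w} - \<alpha>).
        LINT v|conf_measure.
          blinfun_apply (u (nths w \<alpha>) (nths w \<beta>) v) (g (nths w ({..<length w} - \<alpha>) @ v)))"

text \<open>\<open>U t s\<close> is the operator \<open>U\<^sup>t\<^sub>s\<close>. For each \<open>s\<close>, \<open>t\<close> the conditions determine it up to
  equality in \<open>\<Gamma>\<close>, because the test functions are dense.\<close>

definition unitary_evolution ::
  "('k::{complex_hilbert, second_countable_topology} \<Rightarrow>\<^sub>L 'k) \<Rightarrow>
   ('k \<Rightarrow>\<^sub>L 'k) \<Rightarrow> ('k \<Rightarrow>\<^sub>L 'k) \<Rightarrow> ('k \<Rightarrow>\<^sub>L 'k) \<Rightarrow>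
   (real \<Rightarrow> real \<Rightarrow> (real list \<Rightarrow> 'k) \<Rightarrow> (real list \<Rightarrow> 'k)) \<Rightarrow> bool" where
  "unitary_evolution A1 A0 Am B U \<longleftrightarrow>
     (\<forall>s t. s < t \<longrightarrow> unitary_on_Fock (U t s) \<and>
        (\<forall>g\<in>test_functions. AE w in conf_measure.
           U t s g w = kernel_op (kernel A1 A0 Am B s t) g w)) \<and>
     (\<forall>s. \<forall>g\<in>Fock. U s s g \<in> Fock \<and> (AE w in conf_measure. U s s g w = g w)) \<and>
     (\<forall>s t. t < s \<longrightarrow> adjoint_on_Fock (U s t) (U t s))"

end

theory Submission imports Defs
begin

text \<open>
  A point \<open>c \<in> (s, t)\<close> is added to the argument by the rule
  \<open>(U\<^sup>t\<^sub>s g)(\<omega> + c) = (U\<^sup>t\<^sub>c \<Upsilon> U\<^sup>c\<^sub>s g\<^sub>c)(\<omega>) + (U\<^sup>t\<^sub>c A\<^sub>1 U\<^sup>c\<^sub>s g)(\<omega>)\<close>, where \<open>g\<^sub>c(\<omega>) = g(\<omega> + c)\<close>; for \<open>c\<close>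
  outside of \<open>(s, t)\<close> it is \<open>(U\<^sup>t\<^sub>s g\<^sub>c)(\<omega>)\<close>. By Mecke's formula \<open>\<integral> (#\<omega>) \<parallel>f(\<omega>)\<parallel>\<^sup>2 \<lambda>\<^sub>\<omega>\<close> is the integral over \<open>c\<close>
  of the squared norms of the \<open>f\<^sub>c\<close>. Hence induction on \<open>k\<close> gives the bound, each step costing one
  factor \<open>1 + (t - s)\<close>, provided that it is proved for all evolutions with a given number of marks,
  i.e. of bounded operators inserted at given times. For \<open>k = 0\<close> the marks cut \<open>(s, t)\<close> into
  intervals on which \<open>U\<close> is a contraction, and \<open>\<lambda>\<close> factorises over disjoint sets.

  The adjoint of \<open>U\<^sup>t\<^sub>s\<close> is, after reflection of the time, the evolution with the coefficients
  \<open>A\<^sub>-\<^sub>1\<^sup>+, A\<^sub>0\<^sup>+, A\<^sub>1\<^sup>+, B\<^sup>+\<close>, for which the same argument works. All of this is computed on the bounded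
  functions with bounded support, where \<open>U\<close> is identified with the kernel operator by testing
  against \<open>\<K>\<close>.
\<close>

section \<open>Integration over the configuration space\<close>

text \<open>The factor \<open>t - s\<close> of an induction step comes from the summand with
  \<open>A1\<close>. It does not contain \<open>g\<^sub>c\<close>, so the integral over the time of
  the added point costs the length of the interval. The summands with \<open>g\<^sub>c\<close> cost
  nothing of this kind: by Mecke's formula, read backwards, they integrate to a norm of g of the
  next order.

  Two obstacles shape the rest. The rule for the added point holds only if its time differs from all
  other times, hence almost everywhere, and the marks must be avoided as well. And the kernel
  formula is given on test functions only, a class that the evolution does not preserve. It is
  carried over to the bounded functions by testing twice: the adjoint of U, tested against a test
  function, needs U only where the formula is given; and U, tested against a test function, then
  needs only the adjoint, which is known by now. Adjoints are taken for the real part of the scalar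
  product, which fits operators that are real-linear by their type.\<close>

interpretation lborel_family: product_sigma_finite "\<lambda>_::nat. lborel :: real measure"
  by standard

abbreviation (input) Rpow :: "nat \<Rightarrow> (nat \<Rightarrow> real) measure" where
  "Rpow n \<equiv> PiM {..<n} (\<lambda>_. lborel)"

section \<open>Measurability on the configuration space\<close>

lemma conf_Suc: "conf (Suc n) x = conf n x @ [x n]"
  by (simp add: conf_def)

lemma length_conf [simp]: "length (conf n x) = n"
  by (simp add: conf_def)

lemma conf_fun_upd [simp]: "conf n (x(n := r)) = conf n x"
  by (simp add: conf_def)

lemma measurable_conf : "conf n \<in> Rpow n \<rightarrow>\<^sub>M conf_measure"
  by (rule measurableI) (auto simp: space_conf_measure sets_conf_measure)

lemma measurable_conf' [measurable (raw)]:
  "f \<in> N \<rightarrow>\<^sub>M Rpow n \<Longrightarrow> (\<lambda>x. conf n (f x)) \<in> N \<rightarrow>\<^sub>M conf_measure"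
  by (rule measurable_compose[OF _ measurable_conf])

text \<open>\<open>sets conf_measure\<close> is the largest sigma-algebra for which all maps
  \<open>conf n\<close> are measurable, so measurability of a map on lists may be tested in
  coordinates.\<close>

lemma measurable_from_conf:
  assumes "\<And>n. (\<lambda>x. f (conf n x)) \<in> Rpow n \<rightarrow>\<^sub>M N"
  shows "f \<in> conf_measure \<rightarrow>\<^sub>M N"
proof (rule measurableI)
  fix w :: "real list"
  have "(\<lambda>i\<in>{..<length w}. w ! i) \<in> space (Rpow (length w))"
    by (simp add: space_PiM)
  then have "f (conf (length w) (\<lambda>i\<in>{..<length w}. w ! i)) \<in> space N"
    by (rule measurable_space[OF assms])
  moreover have "conf (length w) (\<lambda>i\<in>{..<length w}. w ! i) = w"
    by (rule nth_equalityI) (simp_all add: conf_def)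
  ultimately show "f w \<in> space N" by (simp only:)
next
  fix A assume A: "A \<in> sets N"
  show "f -` A \<inter> space conf_measure \<in> sets conf_measure"
    unfolding sets_conf_measure space_conf_measure
  proof (intro CollectI allI)
    fix n
    have "conf n -` (f -` A \<inter> UNIV) \<inter> space (Rpow n) = (\<lambda>x. f (conf n x)) -` A \<inter> space (Rpow n)"
      by auto
    then show "conf n -` (f -` A \<inter> UNIV) \<inter> space (Rpow n) \<in> sets (Rpow n)"
      using measurable_sets[OF assms A, of n] by (simp only:)
  qed
qed

lemma measurable_length_conf [measurable]: "length \<in> conf_measure \<rightarrow>\<^sub>M count_space UNIV"
  by (rule measurable_from_conf) simp

text \<open>A measurable inverse of \<open>conf n\<close> on the lists of length \<open>n\<close>.
  The zero vector on all other lists makes it a total map into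
  \<open>space (Rpow n)\<close>.\<close>

definition coords :: "nat \<Rightarrow> real list \<Rightarrow> nat \<Rightarrow> real" where
  "coords n w = (\<lambda>i\<in>{..<n}. if length w = n then w ! i else 0)"

lemma measurable_coords [measurable]: "coords n \<in> conf_measure \<rightarrow>\<^sub>M Rpow n"
proof (rule measurable_from_conf)
  fix m
  have "(\<lambda>x. coords n (conf m x)) = (\<lambda>x. \<lambda>i\<in>{..<n}. if m = n then x i else 0)"
    by (auto simp: coords_def conf_def fun_eq_iff)
  moreover have "\<dots> \<in> Rpow m \<rightarrow>\<^sub>M Rpow n"
    by (cases "m = n") (auto intro!: measurable_restrict)
  ultimately show "(\<lambda>x. coords n (conf m x)) \<in> Rpow m \<rightarrow>\<^sub>M Rpow n" by simp
qed

lemma conf_coords: "length w = n \<Longrightarrow> conf n (coords n w) = w"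
  by (rule nth_equalityI) (simp_all add: conf_def coords_def)

text \<open>The sigma-algebra of a product is not defined by the maps \<open>conf n\<close>, so
  \<open>measurable_from_conf\<close> does not apply directly. Instead the list is decoded by
  \<open>coords\<close>, and the countably many possible lengths are glued together.\<close>

lemma measurable_from_conf_pair:
  assumes "\<And>n. (\<lambda>(x, p). f (conf n x) p) \<in> Rpow n \<Otimes>\<^sub>M P \<rightarrow>\<^sub>M N"
  shows "(\<lambda>(w, p). f w p) \<in> conf_measure \<Otimes>\<^sub>M P \<rightarrow>\<^sub>M N"
proof -
  have "(\<lambda>z. (\<lambda>n z. (\<lambda>(x, p). f (conf n x) p) (coords n (fst z), snd z)) (length (fst z)) z)
      \<in> conf_measure \<Otimes>\<^sub>M P \<rightarrow>\<^sub>M N"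
  proof (rule measurable_compose_countable)
    show "(\<lambda>z. (\<lambda>(x, p). f (conf n x) p) (coords n (fst z), snd z)) \<in> conf_measure \<Otimes>\<^sub>M P \<rightarrow>\<^sub>M N" for n
      by (rule measurable_compose[OF _ assms]) measurable
    show "(\<lambda>z. length (fst z)) \<in> conf_measure \<Otimes>\<^sub>M P \<rightarrow>\<^sub>M count_space UNIV"
      by measurable
  qed
  then show ?thesis
    by (simp add: case_prod_beta conf_coords)
qed

lemma measurable_map_conf:
  assumes "\<And>f. f \<in> set fs \<Longrightarrow> f \<in> borel_measurable N"
  shows "(\<lambda>x. map (\<lambda>f. f x) fs) \<in> N \<rightarrow>\<^sub>M conf_measure"
proof -
  have "(\<lambda>x. map (\<lambda>f. f x) fs) = (\<lambda>x. conf (length fs) (\<lambda>i\<in>{..<length fs}. (fs ! i) x))"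
    by (intro ext nth_equalityI) (simp_all add: conf_def)
  moreover have "(\<lambda>x. \<lambda>i\<in>{..<length fs}. (fs ! i) x) \<in> N \<rightarrow>\<^sub>M Rpow (length fs)"
    using assms by (auto intro!: measurable_restrict)
  ultimately show ?thesis
    by (simp add: measurable_compose[OF _ measurable_conf])
qed

lemma measurable_append_conf:
  "(\<lambda>(v, w). v @ w) \<in> conf_measure \<Otimes>\<^sub>M conf_measure \<rightarrow>\<^sub>M conf_measure"
proof (rule measurable_from_conf_pair)
  fix n
  have "(\<lambda>(w, x). conf n x @ w) \<in> conf_measure \<Otimes>\<^sub>M Rpow n \<rightarrow>\<^sub>M conf_measure"
  proof (rule measurable_from_conf_pair)
    fix m
    let ?fs = "map (\<lambda>i (y, x). x i) [0..<n] @ map (\<lambda>i (y, x). y i) [0..<m]"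
    have "(\<lambda>z. map (\<lambda>f. f z) ?fs) \<in> Rpow m \<Otimes>\<^sub>M Rpow n \<rightarrow>\<^sub>M conf_measure"
      by (rule measurable_map_conf) auto
    also have "(\<lambda>z. map (\<lambda>f. f z) ?fs) = (\<lambda>(y, x). conf n x @ conf m y)"
      by (auto simp: conf_def fun_eq_iff)
    finally show "(\<lambda>(y, x). conf n x @ conf m y) \<in> Rpow m \<Otimes>\<^sub>M Rpow n \<rightarrow>\<^sub>M conf_measure" .
  qed
  from measurable_compose[OF measurable_pair_swap' this]
  show "(\<lambda>(x, p). conf n x @ p) \<in> Rpow n \<Otimes>\<^sub>M conf_measure \<rightarrow>\<^sub>M conf_measure"
    by (simp add: case_prod_beta)
qed

lemma measurable_append_conf' [measurable (raw)]:
  assumes "f \<in> N \<rightarrow>\<^sub>M conf_measure" "g \<in> N \<rightarrow>\<^sub>M conf_measure"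
  shows "(\<lambda>x. f x @ g x) \<in> N \<rightarrow>\<^sub>M conf_measure"
  using measurable_compose[OF measurable_Pair[OF assms] measurable_append_conf] by simp

lemma measurable_single_conf [measurable (raw)]:
  assumes "f \<in> borel_measurable N"
  shows "(\<lambda>x. [f x]) \<in> N \<rightarrow>\<^sub>M conf_measure"
  using measurable_map_conf[of "[f]" N] assms by simp

lemma measurable_nths_conf: "(\<lambda>w. nths w I) \<in> conf_measure \<rightarrow>\<^sub>M conf_measure"
proof (rule measurable_from_conf)
  fix n
  let ?fs = "map (\<lambda>i x. x i) (nths [0..<n] I)"
  have "(\<lambda>x. map (\<lambda>f. f x) ?fs) \<in> Rpow n \<rightarrow>\<^sub>M conf_measure"
    by (rule measurable_map_conf) (auto dest!: in_set_nthsD)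
  also have "(\<lambda>x. map (\<lambda>f. f x) ?fs) = (\<lambda>x. nths (conf n x) I)"
    by (auto simp: conf_def nths_map fun_eq_iff)
  finally show "(\<lambda>x. nths (conf n x) I) \<in> Rpow n \<rightarrow>\<^sub>M conf_measure" .
qed

lemma measurable_map_uminus_conf [measurable]:
  "map uminus \<in> conf_measure \<rightarrow>\<^sub>M conf_measure"
proof (rule measurable_from_conf)
  fix n
  let ?fs = "map (\<lambda>i x. - x i) [0..<n]"
  have "(\<lambda>x. map (\<lambda>f. f x) ?fs) \<in> Rpow n \<rightarrow>\<^sub>M conf_measure"
    by (rule measurable_map_conf) auto
  also have "(\<lambda>x. map (\<lambda>f. f x) ?fs) = (\<lambda>x. map uminus (conf n x))"
    by (auto simp: conf_def fun_eq_iff)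
  finally show "(\<lambda>x. map uminus (conf n x)) \<in> Rpow n \<rightarrow>\<^sub>M conf_measure" .
qed

lemma pred_all_conf [measurable]:
  assumes [measurable]: "A \<in> sets (borel :: real measure)"
  shows "Measurable.pred conf_measure (\<lambda>w. set w \<subseteq> A)"
proof (rule measurable_from_conf)
  fix n
  have "Measurable.pred (Rpow n) (\<lambda>x. \<forall>i\<in>{..<n}. x i \<in> A)" by measurable
  then show "Measurable.pred (Rpow n) (\<lambda>x. set (conf n x) \<subseteq> A)"
    by (simp add: conf_def image_subset_iff atLeast0LessThan)
qed

lemma pred_distinct_conf [measurable]: "Measurable.pred conf_measure (distinct :: real list \<Rightarrow> bool)"
proof (rule measurable_from_conf)
  fix n
  have "Measurable.pred (Rpow n) (\<lambda>x. x i \<noteq> x j)" if "i < n" "j < n" for i j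
  proof -
    have "(\<lambda>x. x i) \<in> borel_measurable (Rpow n)" "(\<lambda>x. x j) \<in> borel_measurable (Rpow n)"
      using that by auto
    from borel_measurable_neq[OF this] show ?thesis by (simp add: pred_def)
  qed
  then have "Measurable.pred (Rpow n) (\<lambda>x. \<forall>i\<in>{..<n}. \<forall>j\<in>{..<n} - {i}. x i \<noteq> x j)"
    by (intro pred_intros_finite) auto
  moreover have "distinct (conf n x) \<longleftrightarrow> (\<forall>i\<in>{..<n}. \<forall>j\<in>{..<n} - {i}. x i \<noteq> x j)" for x
    unfolding conf_def distinct_map inj_on_def set_upt atLeast0LessThan by (simp, blast)
  ultimately show "Measurable.pred (Rpow n) (\<lambda>x. distinct (conf n x))" by simp
qed

section \<open>Integrals over configurations with a fixed number of points\<close>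

lemma sigma_finite_Rpow: "sigma_finite_measure (Rpow n)"
  by (rule lborel_family.sigma_finite) simp

text \<open>On the lists of length \<open>n\<close> the measure is the image of Lebesgue measure
  under \<open>conf n\<close>, scaled by 1/n!. This identity of measures is proved first, and the
  integrals follow from it.\<close>

lemma nn_integral_conf_length:
  assumes [measurable]: "F \<in> borel_measurable conf_measure"
  shows "(\<integral>\<^sup>+w. F w * indicator {w. length w = n} w \<partial>conf_measure)
    = (\<integral>\<^sup>+x. F (conf n x) \<partial>Rpow n) / ennreal (fact n)"
proof -
  have len: "{w. length w = n} \<in> sets conf_measure"
    using measurable_sets[OF measurable_length_conf, of "{n}"]
    by (simp add: vimage_def space_conf_measure)
  have "density conf_measure (indicator {w. length w = n})
      = scale_measure (inverse (ennreal (fact n))) (distr (Rpow n) conf_measure (conf n))" (is "?L = ?R")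
  proof (rule measure_eqI)
    fix A assume "A \<in> sets ?L"
    then have A: "A \<in> sets conf_measure" by simp
    have "emeasure ?L A = emeasure conf_measure ({w. length w = n} \<inter> A)"
      using emeasure_density[of "indicator {w. length w = n}" conf_measure A] A len
      by (simp flip: indicator_inter_arith)
    also have "\<dots> = (\<Sum>m. emeasure (Rpow m) (conf m -` ({w. length w = n} \<inter> A) \<inter> space (Rpow m))
        / ennreal (fact m))"
      using A len by (subst emeasure_conf_measure) auto
    also have "\<dots> = (\<Sum>m\<in>{n}. emeasure (Rpow m) (conf m -` ({w. length w = n} \<inter> A) \<inter> space (Rpow m))
        / ennreal (fact m))"
      by (rule suminf_finite) (auto simp: vimage_def)
    also have "\<dots> = emeasure (Rpow n) (conf n -` A \<inter> space (Rpow n)) * inverse (ennreal (fact n))"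
      by (simp add: vimage_def divide_ennreal_def)
    also have "\<dots> = emeasure ?R A"
      using A by (simp add: emeasure_distr[OF measurable_conf] mult.commute)
    finally show "emeasure ?L A = emeasure ?R A" .
  qed simp
  then have "(\<integral>\<^sup>+w. F w \<partial>density conf_measure (indicator {w. length w = n}))
      = (\<integral>\<^sup>+w. F w \<partial>scale_measure (inverse (ennreal (fact n))) (distr (Rpow n) conf_measure (conf n)))" by simp
  moreover have "(\<integral>\<^sup>+w. F w \<partial>density conf_measure (indicator {w. length w = n}))
      = (\<integral>\<^sup>+w. F w * indicator {w. length w = n} w \<partial>conf_measure)"
    using len by (subst nn_integral_density) (auto simp: mult.commute)
  moreover have "(\<integral>\<^sup>+w. F w \<partial>scale_measure (inverse (ennreal (fact n))) (distr (Rpow n) conf_measure (conf n)))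
      = (\<integral>\<^sup>+x. F (conf n x) \<partial>Rpow n) / ennreal (fact n)"
    by (simp add: nn_integral_scale_measure nn_integral_distr[OF measurable_conf] divide_ennreal_def mult.commute)
  ultimately show ?thesis by simp
qed

lemma nn_integral_conf:
  assumes [measurable]: "F \<in> borel_measurable conf_measure"
  shows "(\<integral>\<^sup>+w. F w \<partial>conf_measure) = (\<Sum>n. (\<integral>\<^sup>+x. F (conf n x) \<partial>Rpow n) / ennreal (fact n))"
proof -
  have "F w = (\<Sum>n. F w * indicator {w. length w = n} w)" for w
  proof -
    have "(\<Sum>n. F w * indicator {w. length w = n} w) = (\<Sum>n\<in>{length w}. F w * indicator {w. length w = n} w)"
      by (rule suminf_finite) auto
    then show ?thesis by simp
  qed
  then have "(\<integral>\<^sup>+w. F w \<partial>conf_measure) = (\<integral>\<^sup>+w. (\<Sum>n. F w * indicator {w. length w = n} w) \<partial>conf_measure)"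
    by (rule nn_integral_cong)
  also have "\<dots> = (\<Sum>n. (\<integral>\<^sup>+w. F w * indicator {w. length w = n} w \<partial>conf_measure))"
    by (rule nn_integral_suminf) measurable
  finally show ?thesis by (simp add: nn_integral_conf_length)
qed

text \<open>Almost all facts on the configuration space below follow from the Mecke formula by induction on
  the number of points.\<close>

theorem nn_integral_conf_Mecke:
  assumes [measurable]: "F \<in> borel_measurable conf_measure"
  shows "(\<integral>\<^sup>+w. of_nat (length w) * F w \<partial>conf_measure)
    = (\<integral>\<^sup>+r. (\<integral>\<^sup>+w. F (w @ [r]) \<partial>conf_measure) \<partial>lborel)"
proof -
  \<comment> \<open>This cancellation is the reason for the formula: the factor n+1 for the number
    of points turns 1/(n+1)! into 1/n!, and the last coordinate becomes the integration variable on
    its own.\<close>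
  have fact: "of_nat (Suc n) * z / ennreal (fact (Suc n)) = z / ennreal (fact n)" for n z
  proof -
    have "ennreal (fact (Suc n)) = ennreal (fact n) * of_nat (Suc n)"
      unfolding ennreal_of_nat_eq_real_of_nat
      by (subst ennreal_mult'[symmetric]) (simp_all add: mult.commute)
    then show ?thesis
      using divide_mult_eq[of "of_nat (Suc n)" z "ennreal (fact n)"] by (simp add: mult.commute)
  qed
  have m2: "(\<lambda>r. \<integral>\<^sup>+x. F (conf n x @ [r]) \<partial>Rpow n) \<in> borel_measurable lborel" for n
  proof -
    interpret sigma_finite_measure "Rpow n" by (rule sigma_finite_Rpow)
    show ?thesis by measurable
  qed
  have step: "(\<integral>\<^sup>+x. of_nat (length (conf (Suc n) x)) * F (conf (Suc n) x) \<partial>Rpow (Suc n)) / ennreal (fact (Suc n))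
      = (\<integral>\<^sup>+r. (\<integral>\<^sup>+x. F (conf n x @ [r]) \<partial>Rpow n) / ennreal (fact n) \<partial>lborel)" for n
  proof -
    have m: "(\<lambda>x. F (conf (Suc n) x)) \<in> borel_measurable (PiM (insert n {..<n}) (\<lambda>_. lborel))"
      using measurable_compose[OF measurable_conf[of "Suc n"] assms] by (simp add: lessThan_Suc)
    have "(\<integral>\<^sup>+x. F (conf (Suc n) x) \<partial>Rpow (Suc n)) = (\<integral>\<^sup>+r. (\<integral>\<^sup>+x. F (conf n x @ [r]) \<partial>Rpow n) \<partial>lborel)"
      using lborel_family.product_nn_integral_insert_rev[OF _ _ m] by (simp add: lessThan_Suc conf_Suc)
    moreover have "(\<integral>\<^sup>+x. of_nat (length (conf (Suc n) x)) * F (conf (Suc n) x) \<partial>Rpow (Suc n))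
        = of_nat (Suc n) * (\<integral>\<^sup>+x. F (conf (Suc n) x) \<partial>Rpow (Suc n))"
      unfolding length_conf by (rule nn_integral_cmult) measurable
    ultimately show ?thesis
      unfolding nn_integral_divide[OF m2] by (simp only: fact)
  qed
  have "(\<integral>\<^sup>+w. of_nat (length w) * F w \<partial>conf_measure)
      = (\<Sum>n. (\<integral>\<^sup>+x. of_nat (length (conf n x)) * F (conf n x) \<partial>Rpow n) / ennreal (fact n))"
    by (rule nn_integral_conf) measurable
  \<comment> \<open>The empty configuration has weight 0, so the summation may start with one
    point.\<close>
  also have "\<dots> = (\<Sum>n. (\<integral>\<^sup>+x. of_nat (length (conf (Suc n) x)) * F (conf (Suc n) x) \<partial>Rpow (Suc n)) / ennreal (fact (Suc n)))"
    by (subst suminf_offset[where i = 1]) (simp_all add: summableI del: of_nat_Suc fact_Suc)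
  also have "\<dots> = (\<integral>\<^sup>+r. (\<Sum>n. (\<integral>\<^sup>+x. F (conf n x @ [r]) \<partial>Rpow n) / ennreal (fact n)) \<partial>lborel)"
    unfolding step by (rule nn_integral_suminf[symmetric]) (intro borel_measurable_divide_ennreal m2, simp)
  also have "\<dots> = (\<integral>\<^sup>+r. (\<integral>\<^sup>+w. F (w @ [r]) \<partial>conf_measure) \<partial>lborel)"
    by (rule nn_integral_cong, rule nn_integral_conf[symmetric]) measurable
  finally show ?thesis .
qed

abbreviation conf_slice :: "nat \<Rightarrow> (real list \<Rightarrow> ennreal) \<Rightarrow> ennreal" where
  "conf_slice n F \<equiv> (\<integral>\<^sup>+w. F w * indicator {w. length w = n} w \<partial>conf_measure)"

lemma conf_slice_0:
  assumes "F \<in> borel_measurable conf_measure"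
  shows "conf_slice 0 F = F []"
  unfolding nn_integral_conf_length[OF assms]
  by (simp add: conf_def PiM_empty nn_integral_count_space_finite divide_ennreal_def)

lemma sets_length_conf [measurable]: "{w. length w = n} \<in> sets conf_measure"
  using measurable_sets[OF measurable_length_conf, of "{n}"]
  by (simp add: vimage_def space_conf_measure)

text \<open>The Mecke formula for a fixed number of points. It serves as the recursion in the
  inductions on slices below, where \<open>conf_slice_eqI\<close> cancels the factor
  \<open>Suc n\<close>.\<close>

lemma conf_slice_Suc:
  assumes [measurable]: "F \<in> borel_measurable conf_measure"
  shows "of_nat (Suc n) * conf_slice (Suc n) F = (\<integral>\<^sup>+r. conf_slice n (\<lambda>w. F (w @ [r])) \<partial>lborel)"
proof -
  have "of_nat (Suc n) * conf_slice (Suc n) F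
      = (\<integral>\<^sup>+w. of_nat (Suc n) * (F w * indicator {w. length w = Suc n} w) \<partial>conf_measure)"
    by (rule nn_integral_cmult[symmetric]) measurable
  also have "\<dots> = (\<integral>\<^sup>+w. of_nat (length w) * (F w * indicator {w. length w = Suc n} w) \<partial>conf_measure)"
    by (intro nn_integral_cong) (auto split: split_indicator)
  also have "\<dots> = (\<integral>\<^sup>+r. (\<integral>\<^sup>+w. F (w @ [r]) * indicator {w. length w = Suc n} (w @ [r]) \<partial>conf_measure) \<partial>lborel)"
    by (rule nn_integral_conf_Mecke) measurable
  finally show ?thesis by (simp add: indicator_def)
qed

lemma conf_slice_eqI:
  assumes "of_nat (Suc n) * x = of_nat (Suc n) * (y :: ennreal)"
  shows "x = y"
  using assms ennreal_mult_cancel_left[of "of_nat (Suc n)" x y] 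
  by (simp del: of_nat_Suc)

lemma nn_integral_conf_slices:
  assumes [measurable]: "F \<in> borel_measurable conf_measure"
  shows "(\<integral>\<^sup>+w. F w \<partial>conf_measure) = (\<Sum>n. conf_slice n F)"
  unfolding nn_integral_conf[OF assms] nn_integral_conf_length[OF assms] ..

section \<open>Null sets, boxes and time reflection\<close>

lemma AE_conf_avoids_null:
  assumes A: "A \<in> null_sets lborel"
  shows "AE w in conf_measure. set w \<inter> A = {}"
proof -
  have [measurable]: "A \<in> sets borel" using A by auto
  let ?F = "\<lambda>w. indicator {w. \<not> set w \<subseteq> - A} w :: ennreal"
  have [measurable]: "?F \<in> borel_measurable conf_measure"
    using pred_all_conf[of "- A"] by measurable
  have "conf_slice n ?F = 0" for n
  proof (induction n)
    case 0
    show ?case by (subst conf_slice_0) simp_all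
  next
    case (Suc n)
    \<comment> \<open>A point \<open>r\<close> outside of \<open>A\<close> does not change whether
      \<open>w\<close> meets \<open>A\<close>, so the slice reduces to the preceding one, which
      vanishes by induction.\<close>
    have "AE r in lborel. conf_slice n (\<lambda>w. ?F (w @ [r])) = 0"
      using AE_not_in[OF A]
    proof eventually_elim
      case (elim r)
      then have "conf_slice n (\<lambda>w. ?F (w @ [r])) = conf_slice n ?F"
        by (intro nn_integral_cong) (auto split: split_indicator)
      with Suc show ?case by simp
    qed
    then have "(\<integral>\<^sup>+r. conf_slice n (\<lambda>w. ?F (w @ [r])) \<partial>lborel) = (\<integral>\<^sup>+r. 0 \<partial>(lborel :: real measure))"
      by (rule nn_integral_cong_AE)
    then have "of_nat (Suc n) * conf_slice (Suc n) ?F = of_nat (Suc n) * 0"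
      by (subst conf_slice_Suc) auto
    then show ?case by (rule conf_slice_eqI)
  qed
  then have "(\<integral>\<^sup>+w. ?F w \<partial>conf_measure) = 0"
    by (subst nn_integral_conf_slices) auto
  then have "AE w in conf_measure. ?F w = 0"
    by (subst (asm) nn_integral_0_iff_AE) auto
  then show ?thesis
    by eventually_elim (auto split: split_indicator_asm)
qed

lemma AE_conf_avoids: "AE w in conf_measure. c \<notin> set w"
proof -
  have "{c} \<in> null_sets lborel" by (simp add: null_sets_def)
  from AE_conf_avoids_null[OF this] show ?thesis by simp
qed

text \<open>Adding a point \<open>r\<close> destroys distinctness only if \<open>r\<close> already
  occurs in \<open>w\<close>, which is excluded for almost all \<open>w\<close>. So each slice
  reduces to the preceding one.\<close>

lemma AE_conf_distinct: "AE w in conf_measure. distinct (w :: real list)"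
proof -
  let ?F = "\<lambda>w. indicator {w. \<not> distinct w} (w :: real list) :: ennreal"
  have [measurable]: "?F \<in> borel_measurable conf_measure"
    by measurable
  have "conf_slice n ?F = 0" for n
  proof (induction n)
    case 0
    show ?case by (subst conf_slice_0) simp_all
  next
    case (Suc n)
    have "conf_slice n (\<lambda>w. ?F (w @ [r])) = 0" for r
    proof -
      have "conf_slice n (\<lambda>w. ?F (w @ [r])) = conf_slice n ?F"
        using AE_conf_avoids[of r] by (intro nn_integral_cong_AE) (auto split: split_indicator)
      with Suc show ?thesis by simp
    qed
    then have "of_nat (Suc n) * conf_slice (Suc n) ?F = of_nat (Suc n) * 0"
      by (subst conf_slice_Suc) auto
    then show ?case by (rule conf_slice_eqI)
  qed
  then have "(\<integral>\<^sup>+w. ?F w \<partial>conf_measure) = 0"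
    by (subst nn_integral_conf_slices) auto
  then have "AE w in conf_measure. ?F w = 0"
    by (subst (asm) nn_integral_0_iff_AE) auto
  then show ?thesis
    by eventually_elim (auto split: split_indicator_asm)
qed

text \<open>These sets have finite measure and exhaust the configuration space. The number of points
  is bounded too, because the norm of a kernel is controlled only by a power of the number of its
  points.\<close>

definition conf_box :: "nat \<Rightarrow> real list set" where
  "conf_box R = {w. length w \<le> R \<and> set w \<subseteq> {- real R..real R}}"

lemma sets_conf_box [measurable]: "conf_box R \<in> sets conf_measure"
proof -
  have "Measurable.pred conf_measure (\<lambda>w. length w \<le> R \<and> set w \<subseteq> {- real R..real R})"
    by measurable
  then show ?thesis by (simp add: conf_box_def pred_def space_conf_measure)
qed

lemma conf_box_mono: "R \<le> S \<Longrightarrow> conf_box R \<subseteq> conf_box S"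
  unfolding conf_box_def by (force simp: subset_iff)

lemma mem_conf_box_ex: "\<exists>R. w \<in> conf_box R"
proof -
  obtain S where S: "\<And>r. r \<in> set w \<Longrightarrow> \<bar>r\<bar> \<le> S"
    using finite_set[of w] by (metis finite_imageI image_eqI Max_ge)
  obtain R where "S \<le> real R" "length w \<le> R"
    by (metis dual_order.trans linear of_nat_le_iff real_arch_simple)
  then have "w \<in> conf_box R"
    using S unfolding conf_box_def by (force simp: abs_le_iff)
  then show ?thesis ..
qed

lemma emeasure_conf_box: "emeasure conf_measure (conf_box R) < \<infinity>"
proof -
  let ?F = "\<lambda>w. indicator {w. set w \<subseteq> {- real R..real R}} w :: ennreal"
  have "Measurable.pred conf_measure (\<lambda>w. set w \<subseteq> {- real R..real R})" by measurable
  then have [measurable]: "?F \<in> borel_measurable conf_measure" by measurable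
  have fin: "conf_slice n ?F < \<infinity>" for n
  proof (induction n)
    case 0
    show ?case by (subst conf_slice_0) simp_all
  next
    case (Suc n)
    have "of_nat (Suc n) * conf_slice (Suc n) ?F
        = (\<integral>\<^sup>+r. indicator {- real R..real R} r * conf_slice n ?F \<partial>lborel)"
      by (subst conf_slice_Suc, simp, intro nn_integral_cong)
         (auto simp: nn_integral_cmult[symmetric] intro!: nn_integral_cong split: split_indicator)
    also have "\<dots> = emeasure lborel {- real R..real R} * conf_slice n ?F"
      by (subst nn_integral_multc) auto
    also have "\<dots> < \<infinity>"
      using Suc by (simp add: ennreal_mult_less_top)
    finally show ?case
      by (auto simp: ennreal_mult_less_top simp del: of_nat_Suc)
  qed
  have "emeasure conf_measure (conf_box R) = (\<integral>\<^sup>+w. indicator (conf_box R) w \<partial>conf_measure)"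
    by simp
  also have "\<dots> = (\<integral>\<^sup>+w. (\<Sum>n\<le>R. ?F w * indicator {w. length w = n} w) \<partial>conf_measure)"
  proof (rule nn_integral_cong)
    fix w
    have "(\<Sum>n\<le>R. ?F w * indicator {w. length w = n} w) = (\<Sum>n\<le>R. if n = length w then ?F w else 0)"
      by (intro sum.cong) auto
    then show "indicator (conf_box R) w = (\<Sum>n\<le>R. ?F w * indicator {w. length w = n} w)"
      by (auto simp: conf_box_def split: split_indicator)
  qed
  also have "\<dots> = (\<Sum>n\<le>R. conf_slice n ?F)"
    by (rule nn_integral_sum) measurable
  also have "\<dots> < \<infinity>"
    using fin by (simp add: less_top)
  finally show ?thesis .
qed

interpretation conf: sigma_finite_measure conf_measure
proof
  have "(\<Union>R. conf_box R) = space conf_measure"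
    using mem_conf_box_ex by (auto simp: space_conf_measure)
  then show "\<exists>A. countable A \<and> A \<subseteq> sets conf_measure \<and> \<Union> A = space conf_measure
      \<and> (\<forall>a\<in>A. emeasure conf_measure a \<noteq> \<infinity>)"
    using emeasure_conf_box by (intro exI[of _ "range conf_box"]) (auto simp: less_top[symmetric])
qed

text \<open>Needed for the adjoint evolution, which runs in reflected time. Lebesgue measure is
  invariant under the reflection of one coordinate, and the recursion for slices passes this on to
  any number of points.\<close>

lemma distr_uminus_conf: "distr conf_measure conf_measure (map uminus) = conf_measure"
proof (rule measure_eqI)
  fix A assume "A \<in> sets (distr conf_measure conf_measure (map uminus))"
  then have A [measurable]: "A \<in> sets conf_measure" by simp
  have slice: "conf_slice n (\<lambda>w. F (map uminus w)) = conf_slice n F"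
    if "F \<in> borel_measurable conf_measure" for n F
    using that
  proof (induction n arbitrary: F)
    case 0
    have [measurable]: "F \<in> borel_measurable conf_measure" by fact
    show ?case by (subst (1 2) conf_slice_0) simp_all
  next
    case (Suc n)
    have [measurable]: "F \<in> borel_measurable conf_measure" by fact
    have "of_nat (Suc n) * conf_slice (Suc n) (\<lambda>w. F (map uminus w))
        = (\<integral>\<^sup>+r. conf_slice n (\<lambda>w. F (map uminus w @ [- r])) \<partial>lborel)"
      by (subst conf_slice_Suc) auto
    also have "\<dots> = (\<integral>\<^sup>+r. conf_slice n (\<lambda>w. F (w @ [- r])) \<partial>lborel)"
      using Suc.IH[of "\<lambda>w. F (w @ [- r])" for r] by simp
    also have "\<dots> = (\<integral>\<^sup>+r. conf_slice n (\<lambda>w. F (w @ [r])) \<partial>distr lborel borel uminus)"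
      by (subst nn_integral_distr) auto
    also have "\<dots> = of_nat (Suc n) * conf_slice (Suc n) F"
      by (subst conf_slice_Suc) (auto simp: lborel_distr_uminus)
    finally show ?case by (rule conf_slice_eqI)
  qed
  have "(\<integral>\<^sup>+w. indicator A (map uminus w) \<partial>conf_measure) = (\<Sum>n. conf_slice n (\<lambda>w. indicator A (map uminus w)))"
    by (rule nn_integral_conf_slices) measurable
  also have "\<dots> = (\<Sum>n. conf_slice n (indicator A))"
    by (intro suminf_cong slice) measurable
  also have "\<dots> = (\<integral>\<^sup>+w. indicator A w \<partial>conf_measure)"
    by (rule nn_integral_conf_slices[symmetric]) measurable
  finally have "(\<integral>\<^sup>+w. indicator A (map uminus w) \<partial>conf_measure) = (\<integral>\<^sup>+w. indicator A w \<partial>conf_measure)" .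
  moreover have "(\<integral>\<^sup>+w. indicator A w \<partial>distr conf_measure conf_measure (map uminus))
      = (\<integral>\<^sup>+w. indicator A (map uminus w) \<partial>conf_measure)"
    by (rule nn_integral_distr) auto
  ultimately show "emeasure (distr conf_measure conf_measure (map uminus)) A = emeasure conf_measure A"
    using A by simp
qed simp


subsection \<open>Splitting a configuration\<close>

interpretation conf_lborel: pair_sigma_finite conf_measure "lborel :: real measure" ..

interpretation conf_conf: pair_sigma_finite conf_measure conf_measure ..

lemma nths_cong_set:
  assumes "\<And>i. i < length w \<Longrightarrow> i \<in> I \<longleftrightarrow> i \<in> J"
  shows "nths w I = nths w J"
  unfolding nths_def using assms by (intro arg_cong[where f = "map fst"] filter_cong) (auto simp: set_zip)

lemma nths_snoc_less:
  assumes "I \<subseteq> {..<length w}"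
  shows "nths (w @ [r]) I = nths w I"
proof -
  have "{j. j + length w \<in> I} = {}" using assms by auto
  then show ?thesis by (simp add: nths_append)
qed

lemma nths_snoc_insert:
  assumes "I \<subseteq> {..<length w}"
  shows "nths (w @ [r]) (insert (length w) I) = nths w I @ [r]"
proof -
  have "nths w (insert (length w) I) = nths w I" by (rule nths_cong_set) auto
  then show ?thesis by (simp add: nths_append)
qed

definition split_sum :: "nat \<Rightarrow> (nat set \<Rightarrow> nat set \<Rightarrow> 'b::comm_monoid_add) \<Rightarrow> 'b" where
  "split_sum n T = (\<Sum>\<alpha>\<in>Pow {..<n}. \<Sum>\<beta>\<in>Pow ({..<n} - \<alpha>). T \<alpha> \<beta>)"

lemma sum_Pow_insert:
  assumes "finite A" "x \<notin> A"
  shows "(\<Sum>\<alpha>\<in>Pow (insert x A). T \<alpha>) = (\<Sum>\<alpha>\<in>Pow A. T \<alpha> + T (insert x \<alpha>))"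
proof -
  have "inj_on (insert x) (Pow A)"
    using assms(2) by (auto simp: inj_on_def)
  moreover have "Pow A \<inter> insert x ` Pow A = {}"
    using assms(2) by auto
  ultimately show ?thesis
    using assms(1) by (simp add: Pow_insert sum.union_disjoint sum.reindex sum.distrib)
qed

lemma split_sum_0 [simp]: "split_sum 0 T = T {} {}"
  by (simp add: split_sum_def)

text \<open>The last position belongs to neither of the two sets, to \<beta>, or to \<alpha>; the
  three summands appear in this order.\<close>

lemma split_sum_Suc:
  "split_sum (Suc n) T = split_sum n T + split_sum n (\<lambda>\<alpha> \<beta>. T \<alpha> (insert n \<beta>))
    + split_sum n (\<lambda>\<alpha> \<beta>. T (insert n \<alpha>) \<beta>)"
proof -
  have 1: "{..<Suc n} - \<alpha> = insert n ({..<n} - \<alpha>)" "{..<Suc n} - insert n \<alpha> = {..<n} - \<alpha>"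
    if "\<alpha> \<subseteq> {..<n}" for \<alpha>
    using that by auto
  have "split_sum (Suc n) T = (\<Sum>\<alpha>\<in>Pow {..<n}.
      (\<Sum>\<beta>\<in>Pow ({..<Suc n} - \<alpha>). T \<alpha> \<beta>) + (\<Sum>\<beta>\<in>Pow ({..<Suc n} - insert n \<alpha>). T (insert n \<alpha>) \<beta>))"
    unfolding split_sum_def lessThan_Suc by (rule sum_Pow_insert) auto
  also have "\<dots> = (\<Sum>\<alpha>\<in>Pow {..<n}.
      (\<Sum>\<beta>\<in>Pow ({..<n} - \<alpha>). T \<alpha> \<beta> + T \<alpha> (insert n \<beta>)) + (\<Sum>\<beta>\<in>Pow ({..<n} - \<alpha>). T (insert n \<alpha>) \<beta>))"
    by (intro sum.cong refl) (simp add: 1 sum_Pow_insert)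
  finally show ?thesis
    by (simp add: split_sum_def sum.distrib)
qed

lemma split_sum_cong:
  assumes "\<And>\<alpha> \<beta>. \<alpha> \<subseteq> {..<n} \<Longrightarrow> \<beta> \<subseteq> {..<n} \<Longrightarrow> \<alpha> \<inter> \<beta> = {} \<Longrightarrow> T \<alpha> \<beta> = S \<alpha> \<beta>"
  shows "split_sum n T = split_sum n S"
  unfolding split_sum_def by (intro sum.cong refl assms) auto

lemma split_sum_add: "split_sum n (\<lambda>\<alpha> \<beta>. T \<alpha> \<beta> + S \<alpha> \<beta>) = split_sum n T + split_sum n S"
  by (simp add: split_sum_def sum.distrib)

lemma borel_measurable_split_sum:
  fixes T :: "nat set \<Rightarrow> nat set \<Rightarrow> real list \<times> 'p \<Rightarrow> 'b::{second_countable_topology, topological_comm_monoid_add}"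
  assumes "\<And>\<alpha> \<beta>. T \<alpha> \<beta> \<in> borel_measurable (conf_measure \<Otimes>\<^sub>M P)"
  shows "(\<lambda>z. split_sum (length (fst z)) (\<lambda>\<alpha> \<beta>. T \<alpha> \<beta> z)) \<in> borel_measurable (conf_measure \<Otimes>\<^sub>M P)"
proof (rule measurable_compose_countable)
  show "(\<lambda>z. split_sum n (\<lambda>\<alpha> \<beta>. T \<alpha> \<beta> z)) \<in> borel_measurable (conf_measure \<Otimes>\<^sub>M P)" for n
    unfolding split_sum_def by (intro borel_measurable_sum assms)
  show "(\<lambda>z. length (fst z)) \<in> conf_measure \<Otimes>\<^sub>M P \<rightarrow>\<^sub>M count_space UNIV"
    by measurable
qed

section \<open>The sum-integral formula for splittings into three parts\<close>

lemma in_space_conf_measure [simp, measurable]: "w \<in> space conf_measure"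
  by (simp add: space_conf_measure)

definition split3 :: "(real list \<times> real list \<times> real list \<Rightarrow> 'b::comm_monoid_add) \<Rightarrow> real list \<Rightarrow> 'b" where
  "split3 H w = split_sum (length w) (\<lambda>\<alpha> \<beta>. H (nths w \<alpha>, nths w \<beta>, nths w ({..<length w} - \<alpha> - \<beta>)))"

lemma split3_Nil [simp]: "split3 H [] = H ([], [], [])"
  by (simp add: split3_def)

lemma split3_snoc:
  "split3 H (w @ [r]) = split3 (\<lambda>(a, b, c). H (a, b, c @ [r])) w + split3 (\<lambda>(a, b, c). H (a, b @ [r], c)) w
    + split3 (\<lambda>(a, b, c). H (a @ [r], b, c)) w"
proof -
  let ?n = "length w"
  have 1: "{..<Suc ?n} - \<alpha> - \<beta> = insert ?n ({..<?n} - \<alpha> - \<beta>)"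
    "{..<Suc ?n} - \<alpha> - insert ?n \<beta> = {..<?n} - \<alpha> - \<beta>"
    "{..<Suc ?n} - insert ?n \<alpha> - \<beta> = {..<?n} - \<alpha> - \<beta>"
    "{..<?n} - \<alpha> - \<beta> \<subseteq> {..<?n}"
    if "\<alpha> \<subseteq> {..<?n}" "\<beta> \<subseteq> {..<?n}" for \<alpha> \<beta>
    using that by auto
  show ?thesis
    unfolding split3_def length_append_singleton split_sum_Suc case_prod_conv
    by (intro arg_cong2[where f = "(+)"] split_sum_cong)
       (simp_all add: 1 nths_snoc_less nths_snoc_insert)
qed

text \<open>The three parts always contain \<open>length w\<close> points in total. So
  \<open>H\<close> may be cut down to triples with a fixed total, for which an induction on this
  total is possible.\<close>

lemma split3_total:
  "split3 (\<lambda>(a, b, c). if length a + length b + length c = length w then H (a, b, c) else 0) w = split3 H w"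
proof (induction w arbitrary: H rule: rev_induct)
  case (snoc r w)
  note snoc[of "\<lambda>(a, b, c). H (a, b, c @ [r])", unfolded case_prod_conv]
    snoc[of "\<lambda>(a, b, c). H (a, b @ [r], c)", unfolded case_prod_conv]
    snoc[of "\<lambda>(a, b, c). H (a @ [r], b, c)", unfolded case_prod_conv]
  then show ?case
    unfolding split3_snoc by simp
qed simp

lemma split3_total_neq:
  assumes "n \<noteq> length w"
  shows "split3 (\<lambda>(a, b, c). if length a + length b + length c = n then H (a, b, c) else 0) w = 0"
proof -
  let ?T = "\<lambda>H n. \<lambda>(a, b, c). if length a + length b + length c = (n::nat) then H (a, b, c) else 0"
  have "split3 (?T H n) w = split3 (?T (?T H n) (length w)) w"
    by (rule split3_total[symmetric])
  also have "?T (?T H n) (length w) = (\<lambda>_. 0)"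
    using assms by (auto simp: fun_eq_iff)
  finally show ?thesis by (simp add: split3_def split_sum_def)
qed

lemma borel_measurable_split3:
  fixes H :: "real list \<times> real list \<times> real list \<Rightarrow> 'b::{second_countable_topology, topological_comm_monoid_add}"
  assumes [measurable]: "H \<in> borel_measurable (conf_measure \<Otimes>\<^sub>M conf_measure \<Otimes>\<^sub>M conf_measure)"
  shows "split3 H \<in> borel_measurable conf_measure"
proof -
  note measurable_nths_conf [measurable]
  have "(\<lambda>z. (\<lambda>n w. split_sum n (\<lambda>\<alpha> \<beta>. H (nths w \<alpha>, nths w \<beta>, nths w ({..<n} - \<alpha> - \<beta>)))) (length z) z)
      \<in> borel_measurable conf_measure"
  proof (rule measurable_compose_countable)
    show "(\<lambda>w. split_sum n (\<lambda>\<alpha> \<beta>. H (nths w \<alpha>, nths w \<beta>, nths w ({..<n} - \<alpha> - \<beta>)))) \<in> borel_measurable conf_measure" for n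
      unfolding split_sum_def by (intro borel_measurable_sum) measurable
  qed measurable
  then show ?thesis by (simp add: split3_def[abs_def])
qed

lemma nn_integral_conf_Nil:
  assumes "F \<in> borel_measurable conf_measure" "\<And>w. w \<noteq> [] \<Longrightarrow> F w = 0"
  shows "(\<integral>\<^sup>+w. F w \<partial>conf_measure) = F []"
proof -
  have "(\<integral>\<^sup>+w. F w \<partial>conf_measure) = conf_slice 0 F"
    using assms(2) by (intro nn_integral_cong) (auto split: split_indicator)
  then show ?thesis
    using conf_slice_0[OF assms(1)] by simp
qed

text \<open>By Mecke's formula a last point is split off from \<open>w\<close>; it goes into one of
  the three parts. Mecke's formula in each of the variables \<open>a\<close>, \<open>b\<close>,
  \<open>c\<close> then restores weights that add up to the total number of points, which is
  \<open>Suc n\<close> wherever \<open>H\<close> does not vanish and cancels against the left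
  side.\<close>

lemma nn_integral_split3_total:
  fixes H :: "real list \<times> real list \<times> real list \<Rightarrow> ennreal"
  assumes "H \<in> borel_measurable (conf_measure \<Otimes>\<^sub>M conf_measure \<Otimes>\<^sub>M conf_measure)"
    and "\<And>a b c. length a + length b + length c \<noteq> n \<Longrightarrow> H (a, b, c) = 0"
  shows "(\<integral>\<^sup>+w. split3 H w \<partial>conf_measure)
    = (\<integral>\<^sup>+a. (\<integral>\<^sup>+b. (\<integral>\<^sup>+c. H (a, b, c) \<partial>conf_measure) \<partial>conf_measure) \<partial>conf_measure)"
  using assms
proof (induction n arbitrary: H)
  case 0
  note [measurable] = 0(1) borel_measurable_split3[OF 0(1)]
  have H: "H (a, b, c) = 0" if "a \<noteq> [] \<or> b \<noteq> [] \<or> c \<noteq> []" for a b c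
    using 0(2)[of a b c] that by simp
  have "H = (\<lambda>(a, b, c). if length a + length b + length c = 0 then H (a, b, c) else 0)"
    using 0(2) by (auto simp: fun_eq_iff)
  then have "split3 H w = 0" if "w \<noteq> []" for w
    using split3_total_neq[of 0 w H] that by simp
  then have "(\<integral>\<^sup>+w. split3 H w \<partial>conf_measure) = H ([], [], [])"
    by (subst nn_integral_conf_Nil) auto
  also have "\<dots> = (\<integral>\<^sup>+a. H (a, [], []) \<partial>conf_measure)"
    by (rule nn_integral_conf_Nil[symmetric]) (auto simp: H)
  also have "\<dots> = (\<integral>\<^sup>+a. (\<integral>\<^sup>+b. H (a, b, []) \<partial>conf_measure) \<partial>conf_measure)"
    by (intro nn_integral_cong nn_integral_conf_Nil[symmetric]) (auto simp: H)
  also have "\<dots> = (\<integral>\<^sup>+a. (\<integral>\<^sup>+b. (\<integral>\<^sup>+c. H (a, b, c) \<partial>conf_measure) \<partial>conf_measure) \<partial>conf_measure)"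
    by (intro nn_integral_cong nn_integral_conf_Nil[symmetric]) (auto simp: H)
  finally show ?case .
next
  case (Suc n)
  note [measurable] = Suc.prems(1)
  have len: "H (a, b, c) = 0" if "length a + length b + length c \<noteq> Suc n" for a b c
    using Suc.prems(2) that by blast
  let ?I = "\<lambda>H. \<integral>\<^sup>+a. (\<integral>\<^sup>+b. (\<integral>\<^sup>+c. H (a, b, c) \<partial>conf_measure) \<partial>conf_measure) \<partial>conf_measure"
  have tot: "split3 H w = 0" if "length w \<noteq> Suc n" for w
  proof -
    have "H = (\<lambda>(a, b, c). if length a + length b + length c = Suc n then H (a, b, c) else 0)"
      using len by (auto simp: fun_eq_iff)
    then show ?thesis
      using split3_total_neq[of "Suc n" w H] that by simp
  qed
  have "of_nat (Suc n) * (\<integral>\<^sup>+w. split3 H w \<partial>conf_measure)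
      = (\<integral>\<^sup>+w. of_nat (Suc n) * split3 H w \<partial>conf_measure)"
    using borel_measurable_split3[OF Suc.prems(1)] by (rule nn_integral_cmult[symmetric])
  also have "\<dots> = (\<integral>\<^sup>+w. of_nat (length w) * split3 H w \<partial>conf_measure)"
    using tot by (intro nn_integral_cong) (metis mult_zero_right)
  also have "\<dots> = (\<integral>\<^sup>+r. (\<integral>\<^sup>+w. split3 H (w @ [r]) \<partial>conf_measure) \<partial>lborel)"
    using borel_measurable_split3[OF Suc.prems(1)] by (rule nn_integral_conf_Mecke)
  also have "\<dots> = (\<integral>\<^sup>+r. ?I (\<lambda>(a, b, c). H (a, b, c @ [r])) + ?I (\<lambda>(a, b, c). H (a, b @ [r], c))
      + ?I (\<lambda>(a, b, c). H (a @ [r], b, c)) \<partial>lborel)"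
  proof (rule nn_integral_cong)
    fix r :: real
    have m: "(\<lambda>(a, b, c). H (a, b, c @ [r])) \<in> borel_measurable (conf_measure \<Otimes>\<^sub>M conf_measure \<Otimes>\<^sub>M conf_measure)"
      "(\<lambda>(a, b, c). H (a, b @ [r], c)) \<in> borel_measurable (conf_measure \<Otimes>\<^sub>M conf_measure \<Otimes>\<^sub>M conf_measure)"
      "(\<lambda>(a, b, c). H (a @ [r], b, c)) \<in> borel_measurable (conf_measure \<Otimes>\<^sub>M conf_measure \<Otimes>\<^sub>M conf_measure)"
      by measurable
    note [measurable] = m[THEN borel_measurable_split3]
    have "(\<integral>\<^sup>+w. split3 H (w @ [r]) \<partial>conf_measure)
        = (\<integral>\<^sup>+w. split3 (\<lambda>(a, b, c). H (a, b, c @ [r])) w \<partial>conf_measure)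
        + (\<integral>\<^sup>+w. split3 (\<lambda>(a, b, c). H (a, b @ [r], c)) w \<partial>conf_measure)
        + (\<integral>\<^sup>+w. split3 (\<lambda>(a, b, c). H (a @ [r], b, c)) w \<partial>conf_measure)"
      unfolding split3_snoc by (simp add: nn_integral_add)
    also have "\<dots> = ?I (\<lambda>(a, b, c). H (a, b, c @ [r])) + ?I (\<lambda>(a, b, c). H (a, b @ [r], c))
        + ?I (\<lambda>(a, b, c). H (a @ [r], b, c))"
      by (intro arg_cong2[where f = "(+)"] Suc.IH m) (auto intro!: len)
    finally show "(\<integral>\<^sup>+w. split3 H (w @ [r]) \<partial>conf_measure) = \<dots>" .
  qed
  also have "\<dots> = (\<integral>\<^sup>+r. ?I (\<lambda>(a, b, c). H (a, b, c @ [r])) \<partial>lborel) + (\<integral>\<^sup>+r. ?I (\<lambda>(a, b, c). H (a, b @ [r], c)) \<partial>lborel)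
      + (\<integral>\<^sup>+r. ?I (\<lambda>(a, b, c). H (a @ [r], b, c)) \<partial>lborel)"
    by (simp add: nn_integral_add)
  also have "(\<integral>\<^sup>+r. ?I (\<lambda>(a, b, c). H (a @ [r], b, c)) \<partial>lborel) = ?I (\<lambda>(a, b, c). of_nat (length a) * H (a, b, c))"
    using nn_integral_conf_Mecke[of "\<lambda>a. \<integral>\<^sup>+b. (\<integral>\<^sup>+c. H (a, b, c) \<partial>conf_measure) \<partial>conf_measure"]
    by (simp add: nn_integral_cmult cong: nn_integral_cong_simp)
  also have "(\<integral>\<^sup>+r. ?I (\<lambda>(a, b, c). H (a, b @ [r], c)) \<partial>lborel) = ?I (\<lambda>(a, b, c). of_nat (length b) * H (a, b, c))"
  proof -
    have "(\<integral>\<^sup>+r. ?I (\<lambda>(a, b, c). H (a, b @ [r], c)) \<partial>lborel)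
      = (\<integral>\<^sup>+a. (\<integral>\<^sup>+r. (\<integral>\<^sup>+b. (\<integral>\<^sup>+c. H (a, b @ [r], c) \<partial>conf_measure) \<partial>conf_measure) \<partial>lborel) \<partial>conf_measure)"
      by (simp, rule conf_lborel.Fubini') measurable
    then show ?thesis
      using nn_integral_conf_Mecke[of "\<lambda>b. \<integral>\<^sup>+c. H (a, b, c) \<partial>conf_measure" for a]
      by (simp add: nn_integral_cmult)
  qed
  also have "(\<integral>\<^sup>+r. ?I (\<lambda>(a, b, c). H (a, b, c @ [r])) \<partial>lborel) = ?I (\<lambda>(a, b, c). of_nat (length c) * H (a, b, c))"
  proof -
    have "(\<integral>\<^sup>+r. ?I (\<lambda>(a, b, c). H (a, b, c @ [r])) \<partial>lborel)
      = (\<integral>\<^sup>+a. (\<integral>\<^sup>+r. (\<integral>\<^sup>+b. (\<integral>\<^sup>+c. H (a, b, c @ [r]) \<partial>conf_measure) \<partial>conf_measure) \<partial>lborel) \<partial>conf_measure)"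
      by (simp, rule conf_lborel.Fubini') measurable
    also have "\<dots> = (\<integral>\<^sup>+a. (\<integral>\<^sup>+b. (\<integral>\<^sup>+r. (\<integral>\<^sup>+c. H (a, b, c @ [r]) \<partial>conf_measure) \<partial>lborel) \<partial>conf_measure) \<partial>conf_measure)"
      by (intro nn_integral_cong conf_lborel.Fubini') measurable
    finally show ?thesis
      using nn_integral_conf_Mecke[of "\<lambda>c. H (a, b, c)" for a b]
      by (simp add: nn_integral_cmult)
  qed
  also have "?I (\<lambda>(a, b, c). of_nat (length c) * H (a, b, c)) + ?I (\<lambda>(a, b, c). of_nat (length b) * H (a, b, c))
      + ?I (\<lambda>(a, b, c). of_nat (length a) * H (a, b, c))
      = ?I (\<lambda>(a, b, c). of_nat (length c) * H (a, b, c) + of_nat (length b) * H (a, b, c) + of_nat (length a) * H (a, b, c))"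
    by (simp add: nn_integral_add)
  also have "\<dots> = ?I (\<lambda>(a, b, c). of_nat (Suc n) * H (a, b, c))"
  proof -
    have "of_nat (length c) * H (a, b, c) + of_nat (length b) * H (a, b, c) + of_nat (length a) * H (a, b, c)
        = of_nat (Suc n) * H (a, b, c)" for a b c
    proof (cases "length a + length b + length c = Suc n")
      case True
      then have "(of_nat (Suc n) :: ennreal) = of_nat (length c) + of_nat (length b) + of_nat (length a)"
        by (metis add.commute add.left_commute of_nat_add)
      then show ?thesis by (simp only: distrib_right)
    qed (simp add: len)
    then show ?thesis by simp
  qed
  also have "\<dots> = of_nat (Suc n) * ?I H"
    by (simp add: nn_integral_cmult del: of_nat_Suc)
  finally show ?case by (rule conf_slice_eqI)
qed

text \<open>The sum-integral lemma of the calculus of kernels on Fock space, for three parts.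
  \<open>H\<close> is decomposed according to the total number of points, and the parts are summed
  by monotone convergence.\<close>

theorem nn_integral_split3:
  fixes H :: "real list \<times> real list \<times> real list \<Rightarrow> ennreal"
  assumes [measurable]: "H \<in> borel_measurable (conf_measure \<Otimes>\<^sub>M conf_measure \<Otimes>\<^sub>M conf_measure)"
  shows "(\<integral>\<^sup>+w. split3 H w \<partial>conf_measure)
    = (\<integral>\<^sup>+a. (\<integral>\<^sup>+b. (\<integral>\<^sup>+c. H (a, b, c) \<partial>conf_measure) \<partial>conf_measure) \<partial>conf_measure)"
proof -
  let ?H = "\<lambda>n. \<lambda>(a, b, c). if length a + length b + length c = n then H (a, b, c) else 0"
  have m: "?H n \<in> borel_measurable (conf_measure \<Otimes>\<^sub>M conf_measure \<Otimes>\<^sub>M conf_measure)" for n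
    by measurable
  have m': "(\<lambda>z. ?H n (f z, g z, h z)) \<in> borel_measurable N"
    if "f \<in> N \<rightarrow>\<^sub>M conf_measure" "g \<in> N \<rightarrow>\<^sub>M conf_measure" "h \<in> N \<rightarrow>\<^sub>M conf_measure" for f g h n
    and N :: "'n measure"
    by (rule measurable_compose[OF _ m]) (intro measurable_Pair that)
  have sum: "H z = (\<Sum>n. ?H n z)" for z
  proof -
    obtain a b c where z: "z = (a, b, c)" by (cases z)
    have "(\<Sum>n. ?H n z) = (\<Sum>n\<in>{length a + length b + length c}. ?H n z)"
      by (rule suminf_finite) (auto simp: z)
    then show ?thesis by (simp add: z)
  qed
  have "split3 H w = (\<Sum>n. split3 (?H n) w)" for w
  proof -
    have "(\<Sum>n. split3 (?H n) w) = (\<Sum>n\<in>{length w}. split3 (?H n) w)"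
      by (rule suminf_finite) (use split3_total_neq[of _ w H] in auto)
    also have "\<dots> = split3 H w"
      using split3_total[of w H] by simp
    finally show ?thesis ..
  qed
  then have "(\<integral>\<^sup>+w. split3 H w \<partial>conf_measure) = (\<integral>\<^sup>+w. (\<Sum>n. split3 (?H n) w) \<partial>conf_measure)"
    by (intro nn_integral_cong)
  also have "\<dots> = (\<Sum>n. \<integral>\<^sup>+w. split3 (?H n) w \<partial>conf_measure)"
    by (intro nn_integral_suminf borel_measurable_split3 m)
  also have "\<dots> = (\<Sum>n. \<integral>\<^sup>+a. (\<integral>\<^sup>+b. (\<integral>\<^sup>+c. ?H n (a, b, c) \<partial>conf_measure) \<partial>conf_measure) \<partial>conf_measure)"
    by (intro suminf_cong nn_integral_split3_total[OF m]) auto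
  also have "\<dots> = (\<integral>\<^sup>+a. (\<Sum>n. \<integral>\<^sup>+b. (\<integral>\<^sup>+c. ?H n (a, b, c) \<partial>conf_measure) \<partial>conf_measure) \<partial>conf_measure)"
    by (intro nn_integral_suminf[symmetric]) measurable
  also have "\<dots> = (\<integral>\<^sup>+a. (\<integral>\<^sup>+b. (\<Sum>n. \<integral>\<^sup>+c. ?H n (a, b, c) \<partial>conf_measure) \<partial>conf_measure) \<partial>conf_measure)"
    by (intro nn_integral_cong nn_integral_suminf[symmetric]) measurable
  also have "\<dots> = (\<integral>\<^sup>+a. (\<integral>\<^sup>+b. (\<integral>\<^sup>+c. (\<Sum>n. ?H n (a, b, c)) \<partial>conf_measure) \<partial>conf_measure) \<partial>conf_measure)"
    by (intro nn_integral_cong nn_integral_suminf[symmetric]) measurable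
  also have "\<dots> = (\<integral>\<^sup>+a. (\<integral>\<^sup>+b. (\<integral>\<^sup>+c. H (a, b, c) \<partial>conf_measure) \<partial>conf_measure) \<partial>conf_measure)"
    by (intro nn_integral_cong sum[symmetric])
  finally show ?thesis .
qed

lemma sum_Pow_filter:
  assumes "finite A"
  shows "(\<Sum>\<alpha>\<in>Pow A. if \<alpha> = {i\<in>A. P i} then x \<alpha> else 0) = (x {i\<in>A. P i} :: 'b::comm_monoid_add)"
proof -
  have "{i\<in>A. P i} \<in> Pow A" by auto
  then show ?thesis using assms by (simp add: sum.delta)
qed

lemma nths_subset_iff:
  assumes "I \<subseteq> {..<length w}"
  shows "set (nths w I) \<subseteq> A \<longleftrightarrow> (\<forall>i\<in>I. w ! i \<in> A)"
  using assms by (auto simp: set_nths subset_iff) 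

lemma mset_nths_Diff:
  assumes "J \<subseteq> I"
  shows "mset (nths w I) = mset (nths w J) + mset (nths w (I - J))"
  using assms
proof (induction w arbitrary: I J)
  case (Cons x w)
  have "{j. Suc j \<in> I - J} = {j. Suc j \<in> I} - {j. Suc j \<in> J}" by auto
  then show ?case
    using Cons.IH[of "{j. Suc j \<in> J}" "{j. Suc j \<in> I}"] Cons.prems by (auto simp: nths_Cons)
qed simp

text \<open>The measure is multiplicative over disjoint sets of points, as for a Poisson process
  without normalisation. It is a case of the sum-integral formula in which a single splitting
  survives.\<close>

theorem nn_integral_conf_split_set:
  fixes F :: "real list \<Rightarrow> ennreal"
  assumes [measurable]: "F \<in> borel_measurable conf_measure" "A \<in> sets borel"
    and sym: "symmetric F"
  shows "(\<integral>\<^sup>+w. F w \<partial>conf_measure) = (\<integral>\<^sup>+a. (\<integral>\<^sup>+b.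
    F (a @ b) * indicator {w. set w \<subseteq> - A} b \<partial>conf_measure) * indicator {w. set w \<subseteq> A} a \<partial>conf_measure)"
proof -
  have [measurable]: "{w. set w \<subseteq> A} \<in> sets conf_measure" "{w. set w \<subseteq> - A} \<in> sets conf_measure"
    using pred_all_conf[of A] pred_all_conf[of "- A"]
    by (simp_all add: pred_def space_conf_measure)
  \<comment> \<open>\<open>H\<close> admits only the splitting whose first part consists of all
    points in \<open>A\<close>, whose middle part is empty and whose third part consists of the
    points outside of \<open>A\<close>.\<close>
  let ?H = "\<lambda>(a, e, b). F (a @ b) * indicator {w. set w \<subseteq> A} a * indicator {[]} (e :: real list) * indicator {w. set w \<subseteq> - A} b"
  have Nil: "{[]} \<in> sets conf_measure"
    using sets_length_conf[of 0] by simp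
  then have [measurable]: "indicator {[]} \<in> borel_measurable conf_measure" by simp
  have m: "?H \<in> borel_measurable (conf_measure \<Otimes>\<^sub>M conf_measure \<Otimes>\<^sub>M conf_measure)"
    by measurable
  have split: "split3 ?H w = F w" for w
  proof -
    let ?n = "length w" and ?I = "{i\<in>{..<length w}. w ! i \<in> A}"
    have "split3 ?H w = (\<Sum>\<alpha>\<in>Pow {..<?n}. \<Sum>\<beta>\<in>Pow ({..<?n} - \<alpha>). if \<beta> = {} then if \<alpha> = ?I then F w else 0 else 0)"
      unfolding split3_def split_sum_def
    proof (intro sum.cong refl)
      fix \<alpha> \<beta> assume ab: "\<alpha> \<in> Pow {..<?n}" "\<beta> \<in> Pow ({..<?n} - \<alpha>)"
      have 1: "nths w \<beta> = [] \<longleftrightarrow> \<beta> = {}"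
        using ab by (auto simp: length_nths simp flip: length_0_conv)
      have 2: "set (nths w \<alpha>) \<subseteq> A \<and> set (nths w ({..<?n} - \<alpha>)) \<subseteq> - A \<longleftrightarrow> \<alpha> = ?I"
        using ab by (subst (1 2) nths_subset_iff) auto
      have "mset (nths w \<alpha> @ nths w ({..<?n} - \<alpha>)) = mset (nths w {..<?n})"
        using ab mset_nths_Diff[of \<alpha> "{..<?n}" w] by simp
      also have "nths w {..<?n} = w"
        by (rule nths_all) auto
      finally have "F (nths w \<alpha> @ nths w ({..<?n} - \<alpha>)) = F w"
        using sym unfolding symmetric_def by blast
      with 1 2 show "?H (nths w \<alpha>, nths w \<beta>, nths w ({..<?n} - \<alpha> - \<beta>)) = (if \<beta> = {} then if \<alpha> = ?I then F w else 0 else 0)"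
        by (auto split: split_indicator)
    qed
    also have "\<dots> = (\<Sum>\<alpha>\<in>Pow {..<?n}. if \<alpha> = ?I then F w else 0)"
      by (intro sum.cong refl) (simp add: sum.delta)
    also have "\<dots> = F w"
      by (rule sum_Pow_filter) simp
    finally show ?thesis .
  qed
  have "(\<integral>\<^sup>+w. F w \<partial>conf_measure) = (\<integral>\<^sup>+w. split3 ?H w \<partial>conf_measure)"
    unfolding split ..
  also have "\<dots> = (\<integral>\<^sup>+a. (\<integral>\<^sup>+e. (\<integral>\<^sup>+b. ?H (a, e, b) \<partial>conf_measure) \<partial>conf_measure) \<partial>conf_measure)"
    by (rule nn_integral_split3[OF m])
  also have "\<dots> = (\<integral>\<^sup>+a. (\<integral>\<^sup>+b. ?H (a, [], b) \<partial>conf_measure) \<partial>conf_measure)"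
  proof (rule nn_integral_cong)
    fix a
    show "(\<integral>\<^sup>+e. (\<integral>\<^sup>+b. ?H (a, e, b) \<partial>conf_measure) \<partial>conf_measure) = (\<integral>\<^sup>+b. ?H (a, [], b) \<partial>conf_measure)"
    proof -
      have "(\<lambda>e. \<integral>\<^sup>+b. ?H (a, e, b) \<partial>conf_measure) \<in> borel_measurable conf_measure"
        by measurable
      from nn_integral_conf_Nil[OF this] show ?thesis by simp
    qed
  qed
  also have "\<dots> = (\<integral>\<^sup>+a. (\<integral>\<^sup>+b.
    F (a @ b) * indicator {w. set w \<subseteq> - A} b \<partial>conf_measure) * indicator {w. set w \<subseteq> A} a \<partial>conf_measure)"
    by (intro nn_integral_cong) (auto split: split_indicator)
  finally show ?thesis .
qed

section \<open>The real scalar product, adjoints, exponentials\<close>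

text \<open>The type of bounded operators consists of real-linear maps. Each of them has an adjoint
  with respect to this real scalar product (\<open>rin_radj\<close>), so that complex linearity need
  not be tracked.\<close>

definition rin :: "'k::complex_hilbert \<Rightarrow> 'k \<Rightarrow> real" where
  "rin x y = Re (cinner x y)"

lemma rin_commute: "rin x y = rin y x"
  unfolding rin_def by (subst cinner_commute) simp

lemma rin_add_right: "rin x (y + z) = rin x y + rin x z"
  by (simp add: rin_def cinner_add_right)

lemma rin_add_left: "rin (x + y) z = rin x z + rin y z"
  by (simp add: rin_commute[of _ z] rin_add_right)

lemma rin_scaleR_right: "rin x (r *\<^sub>R y) = r * rin x y"
  by (simp add: rin_def scaleR_scaleC cinner_scaleC_right)

lemma rin_scaleR_left: "rin (r *\<^sub>R x) y = r * rin x y"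
  by (simp add: rin_commute[of _ y] rin_scaleR_right)

lemma rin_self: "rin x x = (norm x)\<^sup>2"
  by (simp add: rin_def cinner_self)

lemma rin_Cauchy_Schwarz: "\<bar>rin x y\<bar> \<le> norm x * norm y"
proof (cases "y = 0")
  case True
  then show ?thesis using rin_scaleR_right[of x 0 y] by simp
next
  case False
  let ?t = "rin x y / (norm y)\<^sup>2"
  have "0 \<le> (norm (x + (- ?t) *\<^sub>R y))\<^sup>2" by simp
  also have "\<dots> = (norm x)\<^sup>2 - 2 * ?t * rin x y + ?t\<^sup>2 * (norm y)\<^sup>2"
    unfolding rin_self[symmetric] rin_add_left rin_add_right rin_scaleR_left rin_scaleR_right rin_commute[of y x]
    by (simp add: power2_eq_square algebra_simps)
  also have "\<dots> = (norm x)\<^sup>2 - (rin x y)\<^sup>2 / (norm y)\<^sup>2"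
    using False by (simp add: field_simps power2_eq_square)
  finally have "(rin x y)\<^sup>2 \<le> (norm x * norm y)\<^sup>2"
    using False by (simp add: field_simps power_mult_distrib)
  then show ?thesis
    by (metis abs_le_square_iff abs_of_nonneg mult_nonneg_nonneg norm_ge_zero)
qed

interpretation rin: bounded_bilinear "rin :: 'k::complex_hilbert \<Rightarrow> 'k \<Rightarrow> real"
proof
  show "\<exists>K. \<forall>a b. norm (rin a b) \<le> norm a * norm b * K"
    by (intro exI[of _ 1] allI) (simp add: rin_Cauchy_Schwarz)
qed (simp_all add: rin_add_left rin_add_right rin_scaleR_left rin_scaleR_right)

lemma borel_measurable_rin [measurable (raw)]:
  fixes f g :: "'a \<Rightarrow> 'k::{complex_hilbert, second_countable_topology}"
  assumes "f \<in> borel_measurable M" "g \<in> borel_measurable M"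
  shows "(\<lambda>x. rin (f x) (g x)) \<in> borel_measurable M"
  using assms by (rule borel_measurable_continuous_Pair)
    (intro rin.continuous_on continuous_intros)

lemma norm_add_sq: "(norm (x + y))\<^sup>2 = (norm x)\<^sup>2 + 2 * rin x y + (norm (y :: 'k::complex_hilbert))\<^sup>2"
  by (simp add: rin_self[symmetric] rin_add_left rin_add_right rin_commute[of y x])

text \<open>The Riesz vector maximises \<open>f x - \<parallel>x\<parallel>\<^sup>2 / 2\<close>.\<close>

lemma Riesz_representation:
  fixes f :: "'k::complex_hilbert \<Rightarrow> real"
  assumes "bounded_linear f"
  shows "\<exists>y. \<forall>x. f x = rin y x"
proof -
  interpret f: bounded_linear f by fact
  define Q where "Q x = f x - (norm x)\<^sup>2 / 2" for x
  obtain K where K: "\<And>x. norm (f x) \<le> norm x * K" using f.bounded by blast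
  have "Q x \<le> K\<^sup>2 / 2" for x
  proof -
    have "f x \<le> norm x * K" using K[of x] by simp
    moreover have "0 \<le> (norm x - K)\<^sup>2" by simp
    ultimately show ?thesis by (simp add: Q_def power2_diff)
  qed
  then have bdd: "bdd_above (range Q)" by (intro bdd_aboveI[of _ "K\<^sup>2 / 2"]) auto
  define M where "M = (SUP x. Q x)"
  have Q_le: "Q x \<le> M" for x unfolding M_def by (rule cSUP_upper[OF _ bdd]) simp
  have "\<exists>x. M - 1 / Suc n < Q x" for n
  proof -
    have "M - 1 / Suc n < M" by simp
    then show ?thesis unfolding M_def using less_cSUP_iff[OF _ bdd, of "M - 1 / Suc n"] by (auto simp: M_def)
  qed
  then obtain X where X: "\<And>n. M - 1 / Suc n < Q (X n)" by metis
  \<comment> \<open>The parallelogram law. Two points at which \<open>Q\<close> is nearly maximal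
    are close to each other, since \<open>Q\<close> at their midpoint cannot exceed the supremum;
    thus a maximising sequence is Cauchy.\<close>
  have mid: "Q ((1/2) *\<^sub>R (x + y)) = (Q x + Q y) / 2 + (norm (x - y))\<^sup>2 / 8" for x y
  proof -
    have "(norm (x - y))\<^sup>2 = (norm x)\<^sup>2 - 2 * rin x y + (norm y)\<^sup>2"
      using norm_add_sq[of x "- y"] rin_scaleR_right[of x "-1" y] by simp
    then show ?thesis
      by (simp add: Q_def f.scaleR f.add scaleR_add_right power_mult_distrib norm_add_sq rin_scaleR_left
          rin_scaleR_right field_simps)
  qed
  have dist: "(norm (X m - X n))\<^sup>2 \<le> 8 * (1 / Suc N)" if "N \<le> m" "N \<le> n" for m n N
  proof -
    have "M - 1 / Suc N \<le> Q (X m)" "M - 1 / Suc N \<le> Q (X n)"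
      using X[of m] X[of n] that by (smt (verit) frac_le of_nat_le_iff of_nat_0_less_iff Suc_le_mono zero_less_Suc)+
    moreover have "D \<le> 8 * e" if "M - e \<le> p" "M - e \<le> q" "(p + q) / 2 + D / 8 \<le> M" for D e p q :: real
      using that by (simp add: field_simps)
    ultimately show ?thesis
      using Q_le[of "(1/2) *\<^sub>R (X m + X n)"] mid[of "X m" "X n"] by metis
  qed
  have "Cauchy X"
  proof (rule metric_CauchyI)
    fix e :: real assume e: "0 < e"
    obtain N :: nat where "8 / e\<^sup>2 < real N" using reals_Archimedean2 by blast
    then have "8 / e\<^sup>2 < real (Suc N)" by simp
    then have N: "8 * (1 / real (Suc N)) < e\<^sup>2" using e by (simp add: field_simps)
    have "dist (X m) (X n) < e" if "N \<le> m" "N \<le> n" for m n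
      using dist[OF that] N e unfolding dist_norm
      by (meson order_le_less_trans power2_less_imp_less less_imp_le)
    then show "\<exists>N. \<forall>m\<ge>N. \<forall>n\<ge>N. dist (X m) (X n) < e" by blast
  qed
  then obtain y where y: "X \<longlonglongrightarrow> y" using Cauchy_convergent_iff convergent_def by blast
  have "(\<lambda>n. Q (X n)) \<longlonglongrightarrow> Q y"
    unfolding Q_def by (intro tendsto_intros f.tendsto y) simp
  moreover have "(\<lambda>n. M - 1 / Suc n) \<longlonglongrightarrow> M - 0"
    by (intro tendsto_diff tendsto_const LIMSEQ_inverse_real_of_nat[simplified inverse_eq_divide])
  ultimately have "M \<le> Q y"
    using LIMSEQ_le[of "\<lambda>n. M - 1 / Suc n" "M - 0" "\<lambda>n. Q (X n)" "Q y"] X by (auto intro: less_imp_le)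
  then have max: "Q x \<le> Q y" for x using Q_le[of x] by simp
  have le: "f x \<le> rin y x" for x
  proof (rule ccontr)
    assume "\<not> f x \<le> rin y x"
    then have d: "0 < f x - rin y x" by simp
    \<comment> \<open>A step of this size from \<open>y\<close> in the direction \<open>x\<close>
      would increase \<open>Q\<close>: the linear gain exceeds the quadratic loss. The summand 1
      keeps the denominator positive.\<close>
    define t where "t = (f x - rin y x) / ((norm x)\<^sup>2 + 1)"
    have n: "0 < (norm x)\<^sup>2 + 1" by (simp add: add_nonneg_pos)
    then have t: "0 < t" using d by (simp add: t_def)
    have "Q (y + t *\<^sub>R x) = Q y + t * (f x - rin y x) - t\<^sup>2 * (norm x)\<^sup>2 / 2"
      by (simp add: Q_def f.add f.scaleR norm_add_sq rin_scaleR_right power_mult_distrib field_simps)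
    then have "t * (f x - rin y x) \<le> t * (t * (norm x)\<^sup>2 / 2)"
      using max[of "y + t *\<^sub>R x"] by (simp add: power2_eq_square)
    then have "f x - rin y x \<le> t * (norm x)\<^sup>2 / 2" using t by (rule mult_left_le_imp_le)
    moreover have "t * ((norm x)\<^sup>2 + 1) = f x - rin y x" using n by (simp add: t_def)
    ultimately show False using t d by (simp add: algebra_simps)
  qed
  have "f x = rin y x" for x
    using le[of x] le[of "(-1) *\<^sub>R x"] by (simp only: f.scaleR rin_scaleR_right) simp
  then show ?thesis by blast
qed

section \<open>Adjoints for the real scalar product\<close>

lemma rin_eqI: "(\<And>z. rin z x = rin z y) \<Longrightarrow> x = y"
  using rin_self[of "x - y"] by (simp add: rin.diff_right)

definition radj :: "('k::complex_hilbert \<Rightarrow>\<^sub>L 'k) \<Rightarrow> ('k \<Rightarrow>\<^sub>L 'k)" where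
  "radj A = (SOME A'. \<forall>x y. rin (blinfun_apply A x) y = rin x (blinfun_apply A' y))"

text \<open>The Riesz vectors of the functionals that send x to \<open>rin (A x) y\<close> form a
  linear map \<open>g\<close> of \<open>y\<close>. It is bounded because the square of the norm of
  \<open>g y\<close> equals \<open>rin (A (g y)) y\<close>.\<close>

lemma rin_radj: "rin (blinfun_apply A x) y = rin x (blinfun_apply (radj A) y)"
proof -
  have "\<exists>z. \<forall>x. rin (blinfun_apply A x) y = rin z x" for y
    by (intro Riesz_representation bounded_linear_compose[OF rin.bounded_linear_left]
        blinfun.bounded_linear_right)
  then obtain g where g: "\<And>x y. rin (blinfun_apply A x) y = rin (g y) x" by metis
  have "bounded_linear g"
  proof (rule bounded_linear_intro[of _ "norm A"])
    show "g (x + y) = g x + g y" for x y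
      by (rule rin_eqI) (simp add: rin_commute[of _ "g _"] g[symmetric] rin_add_right
          rin_commute[of _ "g _ + g _"] rin_add_left)
    show "g (r *\<^sub>R x) = r *\<^sub>R g x" for r x
      by (rule rin_eqI) (simp add: rin_commute[of _ "g _"] g[symmetric] rin_scaleR_right)
    show "norm (g x) \<le> norm x * norm A" for x
    proof -
      have "norm (g x) * norm (g x) = rin (blinfun_apply A (g x)) x"
        by (simp add: g rin_self power2_eq_square)
      also have "\<dots> \<le> norm (blinfun_apply A (g x)) * norm x"
        using rin_Cauchy_Schwarz abs_le_D1 by blast
      also have "\<dots> \<le> norm A * norm (g x) * norm x"
        by (intro mult_right_mono norm_blinfun) simp
      finally have "norm (g x) * norm (g x) \<le> norm (g x) * (norm x * norm A)" by (simp add: mult_ac)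
      then show ?thesis
        by (cases "g x = 0") (simp_all add: mult_le_cancel_left)
    qed
  qed
  then have "\<forall>x y. rin (blinfun_apply A x) y = rin x (blinfun_apply (Blinfun g) y)"
    by (simp add: bounded_linear_Blinfun_apply g rin_commute[of _ "g _"])
  then have "\<forall>x y. rin (blinfun_apply A x) y = rin x (blinfun_apply (radj A) y)"
    unfolding radj_def by (rule someI)
  then show ?thesis by blast
qed

lemma radj_unique: "(\<And>x y. rin (blinfun_apply A x) y = rin x (blinfun_apply B y)) \<Longrightarrow> radj A = B"
  by (intro blinfun_eqI rin_eqI) (simp flip: rin_radj)

lemma radj_comp: "radj (A o\<^sub>L B) = radj B o\<^sub>L radj A"
  by (rule radj_unique) (simp add: rin_radj)

lemma radj_zero [simp]: "radj 0 = 0"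
  by (rule radj_unique) (simp add: rin.zero_left rin.zero_right)

section \<open>Powers and exponentials of operators\<close>

abbreviation blinfun_pow :: "('k::complex_hilbert \<Rightarrow>\<^sub>L 'k) \<Rightarrow> nat \<Rightarrow> ('k \<Rightarrow>\<^sub>L 'k)" where
  "blinfun_pow T n \<equiv> ((\<lambda>X. T o\<^sub>L X) ^^ n) id_blinfun"

lemma norm_blinfun_pow: "norm (blinfun_pow T n) \<le> norm T ^ n"
proof (induction n)
  case 0
  show ?case using norm_blinfun_id_le by simp
next
  case (Suc n)
  have "norm (T o\<^sub>L blinfun_pow T n) \<le> norm T * norm (blinfun_pow T n)" by (rule norm_blinfun_compose)
  also have "\<dots> \<le> norm T * norm T ^ n" by (intro mult_left_mono Suc) simp
  finally show ?case by simp
qed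

lemma blinfun_pow_add: "blinfun_apply (blinfun_pow T (m + n)) x = blinfun_apply (blinfun_pow T m) (blinfun_apply (blinfun_pow T n) x)"
  by (induction m) auto

lemma blinfun_pow_scaleR: "blinfun_pow (r *\<^sub>R T) n = r ^ n *\<^sub>R blinfun_pow T n"
  by (induction n) (auto intro!: blinfun_eqI simp: blinfun.scaleR_left blinfun.scaleR_right)

lemma summable_norm_op_exp: "summable (\<lambda>n. norm (blinfun_pow T n /\<^sub>R fact n))"
proof (rule summable_comparison_test)
  show "summable (\<lambda>n. norm T ^ n /\<^sub>R fact n)" by (rule summable_exp_generic)
  show "\<exists>N. \<forall>n\<ge>N. norm (norm (blinfun_pow T n /\<^sub>R fact n)) \<le> norm T ^ n /\<^sub>R fact n"
    using norm_blinfun_pow[where T = T] by (auto intro!: mult_left_mono)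
qed

lemma norm_op_exp: "norm (op_exp T) \<le> exp (norm T)"
proof -
  have "norm (op_exp T) \<le> (\<Sum>n. norm (blinfun_pow T n /\<^sub>R fact n))"
    unfolding op_exp_def by (rule summable_norm[OF summable_norm_op_exp])
  also have "\<dots> \<le> (\<Sum>n. norm T ^ n /\<^sub>R fact n)"
    using norm_blinfun_pow[where T = T] 
    by (intro suminf_le summable_norm_op_exp summable_exp_generic) (auto intro!: mult_left_mono)
  finally show ?thesis by (simp only: exp_def)
qed

lemma op_exp_sums: "(\<lambda>n. blinfun_apply (blinfun_pow T n) x /\<^sub>R fact n) sums blinfun_apply (op_exp T) x"
proof -
  have "(\<lambda>n. blinfun_pow T n /\<^sub>R fact n) sums op_exp T"
    unfolding op_exp_def by (rule summable_sums[OF summable_norm_cancel[OF summable_norm_op_exp]])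
  from bounded_linear.sums[OF blinfun.bounded_linear_left this] show ?thesis
    by (simp add: blinfun.scaleR_left)
qed

lemma op_exp_scaleR_sums:
  "(\<lambda>n. (r ^ n / fact n) *\<^sub>R blinfun_apply (blinfun_pow B n) x) sums blinfun_apply (op_exp (r *\<^sub>R B)) x"
  using op_exp_sums[of "r *\<^sub>R B" x]
  by (simp add: blinfun_pow_scaleR blinfun.scaleR_left divide_inverse mult.commute)

lemma op_exp_zero [simp]: "op_exp 0 = id_blinfun"
proof (rule blinfun_eqI)
  fix x :: 'a
  have "(\<lambda>n. (0 ^ n / fact n) *\<^sub>R blinfun_apply (blinfun_pow 0 n) x) sums blinfun_apply (op_exp (0 *\<^sub>R 0)) x"
    by (rule op_exp_scaleR_sums)
  moreover have "(\<lambda>n. (0 ^ n / fact n) *\<^sub>R blinfun_apply (blinfun_pow 0 n) x) = (\<lambda>n. if n = 0 then x else 0)"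
    by (auto simp: fun_eq_iff)
  ultimately show "blinfun_apply (op_exp 0) x = blinfun_apply id_blinfun x"
    using sums_unique2 sums_If_finite_set[of "{0}" "\<lambda>_. x"] by fastforce
qed

lemma radj_op_exp: "radj (op_exp (r *\<^sub>R B)) = op_exp (r *\<^sub>R radj B)"
proof (rule radj_unique)
  fix x y :: 'a
  have pow: "rin (blinfun_apply (blinfun_pow B n) x) y = rin x (blinfun_apply (blinfun_pow (radj B) n) y)" for n x y
  proof (induction n arbitrary: y)
    case (Suc n)
    have "blinfun_pow (radj B) (Suc n) = blinfun_pow (radj B) n o\<^sub>L radj B"
      using blinfun_pow_add[where T = "radj B" and m = n and n = 1] by (intro blinfun_eqI) simp
    then show ?case
      using Suc by (simp add: rin_radj)
  qed simp
  have "(\<lambda>n. rin ((r ^ n / fact n) *\<^sub>R blinfun_apply (blinfun_pow B n) x) y) sums rin (blinfun_apply (op_exp (r *\<^sub>R B)) x) y"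
    by (rule bounded_linear.sums[OF rin.bounded_linear_left op_exp_scaleR_sums])
  moreover have "(\<lambda>n. rin x ((r ^ n / fact n) *\<^sub>R blinfun_apply (blinfun_pow (radj B) n) y)) sums rin x (blinfun_apply (op_exp (r *\<^sub>R radj B)) y)"
    by (rule bounded_linear.sums[OF rin.bounded_linear_right op_exp_scaleR_sums])
  ultimately show "rin (blinfun_apply (op_exp (r *\<^sub>R B)) x) y = rin x (blinfun_apply (op_exp (r *\<^sub>R radj B)) y)"
    by (simp add: rin_scaleR_left rin_scaleR_right pow sums_iff)
qed

text \<open>Measurability is formulated for operators applied to vectors, since the space of
  operators need not be separable. The partial sums of the series are measurable and converge
  pointwise.\<close>

lemma borel_measurable_op_exp:
  fixes B :: "'k::{complex_hilbert, second_countable_topology} \<Rightarrow>\<^sub>L 'k"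
  assumes [measurable]: "s \<in> borel_measurable M" "f \<in> borel_measurable M"
  shows "(\<lambda>w. blinfun_apply (op_exp (s w *\<^sub>R B)) (f w)) \<in> borel_measurable M"
proof (rule borel_measurable_LIMSEQ_metric)
  fix w
  show "(\<lambda>N. \<Sum>n<N. (s w ^ n / fact n) *\<^sub>R blinfun_apply (blinfun_pow B n) (f w))
      \<longlonglongrightarrow> blinfun_apply (op_exp (s w *\<^sub>R B)) (f w)"
    using op_exp_scaleR_sums[of "s w" B "f w"] by (simp add: sums_def)
next
  fix N
  have [measurable]: "(\<lambda>w. blinfun_apply T (f w)) \<in> borel_measurable M" for T :: "'k \<Rightarrow>\<^sub>L 'k"
    by (rule measurable_compose[OF assms(2)], rule borel_measurable_continuous_onI)
       (intro continuous_intros)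
  show "(\<lambda>w. \<Sum>n<N. (s w ^ n / fact n) *\<^sub>R blinfun_apply (blinfun_pow B n) (f w)) \<in> borel_measurable M"
    by measurable
qed

lemma blinfun_compose_assoc: "(A o\<^sub>L B) o\<^sub>L C = A o\<^sub>L (B o\<^sub>L C)"
  by (rule blinfun_eqI) simp

lemma blinfun_compose_id [simp]: "id_blinfun o\<^sub>L A = A" "A o\<^sub>L id_blinfun = A"
  by (auto intro!: blinfun_eqI)

text \<open>The Cauchy product: one double family is summed by rows, giving the composition, and
  along the diagonals, giving the series for \<open>a + b\<close>.\<close>

lemma op_exp_add: "op_exp ((a + b) *\<^sub>R B) = op_exp (a *\<^sub>R B) o\<^sub>L op_exp (b *\<^sub>R B)"
proof (rule blinfun_eqI)
  fix x :: 'a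
  let ?c = "\<lambda>n. blinfun_apply (blinfun_pow B n) x"
  let ?t = "\<lambda>(m, n). (a ^ m / fact m * (b ^ n / fact n)) *\<^sub>R ?c (m + n)"
  let ?y = "blinfun_apply (op_exp (b *\<^sub>R B)) x"
  have summ: "summable (\<lambda>n. norm ((r ^ n / fact n) *\<^sub>R blinfun_apply (blinfun_pow B n) z))" for r z
  proof (rule summable_comparison_test)
    show "summable (\<lambda>n. ((norm (r *\<^sub>R B)) ^ n /\<^sub>R fact n) * norm z)"
      by (intro summable_mult2 summable_exp_generic)
    have "norm (r ^ n *\<^sub>R blinfun_apply (blinfun_pow B n) z) \<le> norm (r *\<^sub>R B) ^ n * norm z" for n
      using norm_blinfun_pow[where T = "r *\<^sub>R B" and n = n] norm_blinfun[of "blinfun_pow (r *\<^sub>R B) n" z]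
      by (metis (no_types, lifting) blinfun.scaleR_left blinfun_pow_scaleR mult_right_mono norm_ge_zero order_trans)
    then show "\<exists>N. \<forall>n\<ge>N. norm (norm ((r ^ n / fact n) *\<^sub>R blinfun_apply (blinfun_pow B n) z))
        \<le> ((norm (r *\<^sub>R B)) ^ n /\<^sub>R fact n) * norm z"
      by (auto simp: field_simps)
  qed
  have hs: "((\<lambda>n. (r ^ n / fact n) *\<^sub>R blinfun_apply (blinfun_pow B n) z) has_sum blinfun_apply (op_exp (r *\<^sub>R B)) z) UNIV" for r z
    by (rule norm_summable_imp_has_sum[OF summ op_exp_scaleR_sums])
  have inner: "((\<lambda>n. ?t (m, n)) has_sum (a ^ m / fact m) *\<^sub>R blinfun_apply (blinfun_pow B m) ?y) UNIV" for m
  proof -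
    have "bounded_linear (\<lambda>y. (a ^ m / fact m) *\<^sub>R blinfun_apply (blinfun_pow B m) y)"
      by (intro bounded_linear_intros)
    from has_sum_bounded_linear[OF this hs[of b x]] show ?thesis
      by (simp add: blinfun.scaleR_right blinfun_pow_add mult.commute)
  qed
  \<comment> \<open>The family is dominated by the product of two scalar exponential series, so the
    order of summation is irrelevant.\<close>
  have "?t summable_on Sigma UNIV (\<lambda>_. UNIV)"
  proof (rule abs_summable_summable)
    let ?p = "\<lambda>r n. (norm r * norm B) ^ n / fact n"
    have p: "(?p r has_sum exp (norm r * norm B)) UNIV" for r :: real
      using norm_summable_imp_has_sum[of "?p r" "exp (norm r * norm B)"]
        summable_exp_generic[of "norm r * norm B"] exp_converges[of "norm r * norm B"]
      by (simp add: divide_inverse mult.commute)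
    have "(\<lambda>(m, n). ?p a m * (?p b n * norm x)) summable_on Sigma UNIV (\<lambda>_. UNIV)"
    proof (rule summable_on_SigmaI)
      show "((\<lambda>n. case (m, n) of (m, n) \<Rightarrow> ?p a m * (?p b n * norm x)) has_sum ?p a m * (exp (norm b * norm B) * norm x)) UNIV" for m
        unfolding case_prod_conv by (intro has_sum_cmult_right has_sum_cmult_left p)
      show "(\<lambda>m. ?p a m * (exp (norm b * norm B) * norm x)) summable_on UNIV"
        by (intro summable_on_cmult_left) (use p in \<open>auto simp: summable_on_def\<close>)
    qed auto
    then show "?t abs_summable_on Sigma UNIV (\<lambda>_. UNIV)"
    proof (rule Infinite_Sum.abs_summable_on_comparison_test')
      fix z :: "nat \<times> nat"
      obtain m n where z: "z = (m, n)" by fastforce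
      have "norm (?c (m + n)) \<le> norm B ^ (m + n) * norm x"
        using norm_blinfun[of "blinfun_pow B (m + n)" x] norm_blinfun_pow[where T = B and n = "m + n"]
        by (meson mult_right_mono norm_ge_zero order_trans)
      then have "\<bar>a\<bar> ^ m * \<bar>b\<bar> ^ n * norm (?c (m + n)) \<le> \<bar>a\<bar> ^ m * \<bar>b\<bar> ^ n * (norm B ^ (m + n) * norm x)"
        by (intro mult_left_mono) auto
      then show "norm (?t z) \<le> (case z of (m, n) \<Rightarrow> ?p a m * (?p b n * norm x))"
        by (simp add: z abs_mult power_abs power_mult_distrib power_add divide_right_mono mult_ac
            del: times_divide_eq_left add: times_divide_eq_right)
    qed
  qed
  then have T: "(?t has_sum blinfun_apply (op_exp (a *\<^sub>R B)) ?y) (Sigma UNIV (\<lambda>_. UNIV))"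
    by (intro has_sum_SigmaI[OF inner hs])
  \<comment> \<open>The diagonal number \<open>N\<close> is the sum of both indices; on it the
    binomial theorem applies.\<close>
  have "bij_betw (\<lambda>(N, m). (m, N - m)) (Sigma UNIV (\<lambda>N. {..N})) (Sigma UNIV (\<lambda>_. UNIV :: nat set))"
    by (rule bij_betwI[of _ _ _ "\<lambda>(m, n). (m + n, m)"]) auto
  then have T': "((\<lambda>z. ?t (case z of (N, m) \<Rightarrow> (m, N - m))) has_sum blinfun_apply (op_exp (a *\<^sub>R B)) ?y) (Sigma UNIV (\<lambda>N. {..N}))"
    using T has_sum_reindex_bij_betw by blast
  have "((\<lambda>N. ((a + b) ^ N / fact N) *\<^sub>R ?c N) has_sum blinfun_apply (op_exp (a *\<^sub>R B)) ?y) UNIV"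
  proof (rule has_sum_SigmaD[OF T'])
    fix N
    have "(\<Sum>m\<le>N. a ^ m / fact m * (b ^ (N - m) / fact (N - m))) = (a + b) ^ N / fact N"
      by (subst binomial_ring) (simp add: sum_divide_distrib binomial_fact field_simps)
    then have "(\<Sum>m\<le>N. ?t (m, N - m)) = ((a + b) ^ N / fact N) *\<^sub>R ?c N"
      by (simp flip: scaleR_sum_left)
    then show "((\<lambda>m. ?t (case (N, m) of (N, m) \<Rightarrow> (m, N - m))) has_sum ((a + b) ^ N / fact N) *\<^sub>R ?c N) {..N}"
      using has_sum_finite[of "{..N}" "\<lambda>m. ?t (m, N - m)"] by simp
  qed
  then have "blinfun_apply (op_exp ((a + b) *\<^sub>R B)) x = blinfun_apply (op_exp (a *\<^sub>R B)) ?y"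
    using hs[of "a + b" x] has_sum_unique by blast
  then show "blinfun_apply (op_exp ((a + b) *\<^sub>R B)) x = blinfun_apply (op_exp (a *\<^sub>R B) o\<^sub>L op_exp (b *\<^sub>R B)) x"
    by simp
qed

section \<open>Time-ordered products\<close>

text \<open>A mark \<open>(r, X)\<close> inserts the operator \<open>X\<close> at the time \<open>r\<close>.\<close>

definition tprod :: "('k::complex_hilbert \<Rightarrow>\<^sub>L 'k) \<Rightarrow> real \<Rightarrow> real \<Rightarrow> (real \<times> ('k \<Rightarrow>\<^sub>L 'k)) list \<Rightarrow> ('k \<Rightarrow>\<^sub>L 'k)" where
  "tprod B s t L = (if distinct (map fst L) \<and> (\<forall>z\<in>set L. s < fst z \<and> fst z < t)
     then time_product B s t (sort_key fst L) else 0)"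

lemma tprod_Nil [simp]: "tprod B s t [] = op_exp ((t - s) *\<^sub>R B)"
  by (simp add: tprod_def)

lemma kernel_eq_tprod:
  "kernel A1 A0 Am B s t \<sigma> \<tau> \<upsilon> =
    tprod B s t (map (\<lambda>r. (r, A1)) \<sigma> @ map (\<lambda>r. (r, A0)) \<tau> @ map (\<lambda>r. (r, Am)) \<upsilon>)"
  unfolding kernel_def tprod_def by (intro if_cong) (simp_all add: comp_def ball_Un)

lemma sort_key_fst_unique:
  assumes "distinct (map fst L)" "mset L' = mset L" "sorted (map fst L')"
  shows "sort_key fst L = L'"
  using sort_key_inj_key_eq[of L L' fst] assms by (simp add: distinct_map)

text \<open>\<open>sort_key\<close> keeps the order of marks with equal times, so the product could
  depend on the order of the list there. The value 0 for coinciding times removes this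
  dependence.\<close>

lemma tprod_perm:
  assumes "mset L = mset L'"
  shows "tprod B s t L = tprod B s t L'"
proof -
  have "set L = set L'" "mset (map fst L) = mset (map fst L')"
    using assms by (auto dest: mset_eq_setD)
  moreover have "sort_key fst L = sort_key fst L'" if "distinct (map fst L)"
    using that assms by (intro sort_key_fst_unique) simp_all
  ultimately show ?thesis
    using mset_eq_imp_distinct_iff[of "map fst L" "map fst L'"] by (auto simp: tprod_def)
qed

lemma time_product_append:
  "time_product B s t (xs @ ys) = time_product B c t ys o\<^sub>L time_product B s c xs"
proof (induction xs arbitrary: s)
  case Nil
  show ?case
  proof (cases ys)
    case Nil
    then show ?thesis using op_exp_add[of "t - c" "c - s" B] by simp
  next
    case (Cons z zs)
    then show ?thesis
      using op_exp_add[of "fst z - c" "c - s" B] by (cases z) (simp add: blinfun_compose_assoc)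
  qed
next
  case (Cons z xs)
  then show ?case by (cases z) (simp add: blinfun_compose_assoc)
qed

lemma sorted_fst_append_sort_key:
  assumes "\<And>y z. y \<in> set L1 \<Longrightarrow> z \<in> set L2 \<Longrightarrow> fst y \<le> fst z"
  shows "sorted (map fst (sort_key fst L1 @ sort_key fst L2))"
  using assms by (auto simp: sorted_append)

lemma tprod_append:
  assumes "s < c" "c < t" "\<And>z. z \<in> set L1 \<Longrightarrow> fst z < c" "\<And>z. z \<in> set L2 \<Longrightarrow> c < fst z"
  shows "tprod B s t (L1 @ L2) = tprod B c t L2 o\<^sub>L tprod B s c L1"
proof -
  have "fst ` set L1 \<inter> fst ` set L2 = {}"
    using assms(3,4) by force
  then have d: "distinct (map fst (L1 @ L2)) \<longleftrightarrow> distinct (map fst L1) \<and> distinct (map fst L2)"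
    by simp
  have r: "(\<forall>z\<in>set (L1 @ L2). s < fst z \<and> fst z < t) \<longleftrightarrow>
      (\<forall>z\<in>set L1. s < fst z \<and> fst z < c) \<and> (\<forall>z\<in>set L2. c < fst z \<and> fst z < t)"
    using assms by (auto dest: order_less_trans) (meson order_less_trans)+
  have "sort_key fst (L1 @ L2) = sort_key fst L1 @ sort_key fst L2" if "distinct (map fst (L1 @ L2))"
  proof (intro sort_key_fst_unique sorted_fst_append_sort_key that)
    show "fst y \<le> fst z" if "y \<in> set L1" "z \<in> set L2" for y z
      using assms(3)[OF that(1)] assms(4)[OF that(2)] by simp
  qed simp
  then show ?thesis
    unfolding tprod_def d r by (auto simp: time_product_append)
qed

lemma tprod_mark:
  assumes "s < c" "c < t" "\<And>z. z \<in> set L1 \<Longrightarrow> fst z < c" "\<And>z. z \<in> set L2 \<Longrightarrow> c < fst z"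
  shows "tprod B s t (L1 @ (c, X) # L2) = tprod B c t L2 o\<^sub>L (X o\<^sub>L tprod B s c L1)"
proof -
  have "fst ` set L1 \<inter> fst ` set L2 = {}" "c \<notin> fst ` set L1" "c \<notin> fst ` set L2"
    using assms(3,4) by force+
  then have d: "distinct (map fst (L1 @ (c, X) # L2)) \<longleftrightarrow> distinct (map fst L1) \<and> distinct (map fst L2)"
    by auto
  have r: "(\<forall>z\<in>set (L1 @ (c, X) # L2). s < fst z \<and> fst z < t) \<longleftrightarrow>
      (\<forall>z\<in>set L1. s < fst z \<and> fst z < c) \<and> (\<forall>z\<in>set L2. c < fst z \<and> fst z < t)"
    using assms by (auto dest: order_less_trans) (meson order_less_trans)+
  have "sort_key fst (L1 @ (c, X) # L2) = sort_key fst L1 @ (c, X) # sort_key fst L2"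
    if "distinct (map fst (L1 @ (c, X) # L2))"
  proof (intro sort_key_fst_unique that)
    have "fst y \<le> fst z" if "y \<in> set L1" "z \<in> set L2" for y z
      using assms(3)[OF that(1)] assms(4)[OF that(2)] by simp
    then show "sorted (map fst (sort_key fst L1 @ (c, X) # sort_key fst L2))"
      using assms(3,4) by (auto simp: sorted_append intro: less_imp_le)
  qed simp
  then show ?thesis
    unfolding tprod_def d r by (auto simp: time_product_append[where c = c] blinfun_compose_assoc)
qed

lemma tprod_eq_0:
  "\<not> distinct (map fst L) \<or> (\<exists>z\<in>set L. fst z \<le> s \<or> t \<le> fst z) \<Longrightarrow> tprod B s t L = 0"
  by (auto simp: tprod_def)

lemma tprod_Cons_mark:
  assumes "c \<notin> fst ` set L" "s < c" "c < t"
  shows "tprod B s t ((c, X) # L) =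
    tprod B c t (filter (\<lambda>z. c < fst z) L) o\<^sub>L (X o\<^sub>L tprod B s c (filter (\<lambda>z. fst z < c) L))"
proof -
  let ?L = "filter (\<lambda>z. fst z < c) L" and ?R = "filter (\<lambda>z. c < fst z) L"
  have "mset L = mset ?L + mset ?R"
    using assms(1) by (induction L) (auto split: if_splits)
  then have "mset ((c, X) # L) = mset (?L @ (c, X) # ?R)"
    by simp
  then have "tprod B s t ((c, X) # L) = tprod B s t (?L @ (c, X) # ?R)"
    by (rule tprod_perm)
  also have "\<dots> = tprod B c t ?R o\<^sub>L (X o\<^sub>L tprod B s c ?L)"
    using assms(2,3) by (intro tprod_mark) auto
  finally show ?thesis .
qed

text \<open>The semigroup law of the exponential: cutting at the time \<open>c\<close> without
  inserting anything changes nothing. This is how the terms with and without a mark at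
  \<open>c\<close> can be merged into one.\<close>

lemma tprod_mark_id:
  assumes "c \<notin> fst ` set L" "s < c" "c < t"
  shows "tprod B s t ((c, id_blinfun) # L) = tprod B s t L"
proof -
  let ?L = "filter (\<lambda>z. fst z < c) L" and ?R = "filter (\<lambda>z. c < fst z) L"
  have "mset L = mset (?L @ ?R)"
    using assms(1) by (induction L) (auto split: if_splits)
  then have "tprod B s t L = tprod B s t (?L @ ?R)"
    by (rule tprod_perm)
  also have "\<dots> = tprod B c t ?R o\<^sub>L tprod B s c ?L"
    using assms(2,3) by (intro tprod_append) auto
  finally show ?thesis
    unfolding tprod_Cons_mark[OF assms] by (auto intro!: blinfun_eqI)
qed

lemma tprod_mark_add:
  "tprod B s t ((c, X + Y) # L) = tprod B s t ((c, X) # L) + tprod B s t ((c, Y) # L)"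
proof (cases "c \<notin> fst ` set L \<and> s < c \<and> c < t")
  case True
  then show ?thesis
    by (auto intro!: blinfun_eqI simp: tprod_Cons_mark blinfun.add_left blinfun.add_right)
next
  case False
  then show ?thesis by (subst (1 2 3) tprod_eq_0) auto
qed

lemma norm_time_product:
  assumes "s \<le> t" "sorted (map fst xs)" "\<And>z. z \<in> set xs \<Longrightarrow> s \<le> fst z \<and> fst z \<le> t \<and> norm (snd z) \<le> K" "0 \<le> K"
  shows "norm (time_product B s t xs) \<le> exp ((t - s) * norm B) * K ^ length xs"
  using assms(1-3)
proof (induction xs arbitrary: s)
  case Nil
  then show ?case using norm_op_exp[of "(t - s) *\<^sub>R B"] by simp
next
  case (Cons z xs)
  obtain r X where z: "z = (r, X)" by fastforce
  have r: "s \<le> r" "r \<le> t" "norm X \<le> K" using Cons.prems(3)[of z] by (auto simp: z)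
  have IH: "norm (time_product B r t xs) \<le> exp ((t - r) * norm B) * K ^ length xs"
    using Cons.prems z r by (intro Cons.IH) auto
  have "norm (time_product B s t (z # xs)) \<le> norm (time_product B r t xs) * (norm X * norm (op_exp ((r - s) *\<^sub>R B)))"
    unfolding z time_product.simps
    by (meson norm_blinfun_compose mult_left_mono norm_ge_zero order_trans)
  also have "\<dots> \<le> (exp ((t - r) * norm B) * K ^ length xs) * (K * exp ((r - s) * norm B))"
    using norm_op_exp[of "(r - s) *\<^sub>R B"] r assms(4) by (intro mult_mono IH) auto
  also have "\<dots> = exp ((t - s) * norm B) * K ^ length (z # xs)"
    by (simp add: exp_add[symmetric] algebra_simps flip: exp_add)
  finally show ?case .
qed

text \<open>The exponential bounds on the successive subintervals multiply to the one for the whole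
  interval, so that the number of marks enters only through the power of \<open>K\<close>.\<close>

lemma norm_tprod:
  assumes "s \<le> t" "\<And>z. z \<in> set L \<Longrightarrow> norm (snd z) \<le> K" "0 \<le> K"
  shows "norm (tprod B s t L) \<le> exp ((t - s) * norm B) * K ^ length L"
proof (cases "distinct (map fst L) \<and> (\<forall>z\<in>set L. s < fst z \<and> fst z < t)")
  case True
  then show ?thesis
    using norm_time_product[of s t "sort_key fst L" K B] assms by (auto simp: tprod_def less_imp_le)
next
  case False
  then show ?thesis using assms(3) by (auto simp: tprod_def)
qed

text \<open>Taking adjoints reverses the order of the factors; negating the times makes the reversed
  list increasing again.\<close>

lemma radj_time_product:
  "radj (time_product B s t xs) = time_product (radj B) (- t) (- s) (rev (map (\<lambda>(r, X). (- r, radj X)) xs))"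
proof (induction xs arbitrary: s)
  case Nil
  show ?case by (simp add: radj_op_exp)
next
  case (Cons z xs)
  then show ?case
    by (cases z) (simp add: radj_comp radj_op_exp time_product_append[where c = "- fst z"] blinfun_compose_assoc)
qed

lemma radj_tprod:
  "radj (tprod B s t L) = tprod (radj B) (- t) (- s) (map (\<lambda>(r, X). (- r, radj X)) L)"
proof -
  let ?f = "\<lambda>(r, X). (- r, radj X)"
  have m: "map fst (map ?f L) = map uminus (map fst L)" for L :: "(real \<times> ('a \<Rightarrow>\<^sub>L 'a)) list" by auto
  have d: "distinct (map fst (map ?f L)) \<longleftrightarrow> distinct (map fst L)"
    unfolding m by (subst distinct_map) (auto simp: inj_on_def)
  have r: "(\<forall>z\<in>set (map ?f L). - t < fst z \<and> fst z < - s) \<longleftrightarrow> (\<forall>z\<in>set L. s < fst z \<and> fst z < t)"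
    by (auto simp: case_prod_beta)
  have "sort_key fst (map ?f L) = rev (map ?f (sort_key fst L))" if "distinct (map fst L)"
  proof (rule sort_key_fst_unique)
    have "map fst (rev (map ?f (sort_key fst L))) = rev (map uminus (map fst (sort_key fst L)))"
      unfolding rev_map[symmetric] m ..
    moreover have "sorted (rev (map uminus xs))" if "sorted xs" for xs :: "real list"
      using that by (induction xs) (auto simp: sorted_append)
    ultimately show "sorted (map fst (rev (map ?f (sort_key fst L))))"
      by (simp only: sorted_sort_key)
    show "distinct (map fst (map ?f L))" using that d by simp
    show "mset (rev (map ?f (sort_key fst L))) = mset (map ?f L)"
      unfolding mset_rev mset_map by simp
  qed
  then show ?thesis
    unfolding tprod_def d r by (auto simp: radj_time_product)
qed

text \<open>Splitting off the first mark reduces the measurability of the time-ordered product in the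
  times to that of the exponentials.\<close>

lemma tprod_first_mark:
  assumes "L \<noteq> []"
  shows "blinfun_apply (tprod B s t L) x = (\<Sum>i<length L.
    if (\<forall>j\<in>{..<length L} - {i}. fst (L ! i) < fst (L ! j)) \<and> s < fst (L ! i) \<and> fst (L ! i) < t
    then blinfun_apply (tprod B (fst (L ! i)) t (take i L @ drop (Suc i) L))
      (blinfun_apply (snd (L ! i)) (blinfun_apply (op_exp ((fst (L ! i) - s) *\<^sub>R B)) x))
    else 0)"
proof -
  let ?P = "\<lambda>i. (\<forall>j\<in>{..<length L} - {i}. fst (L ! i) < fst (L ! j)) \<and> s < fst (L ! i) \<and> fst (L ! i) < t"
  let ?v = "\<lambda>i. blinfun_apply (tprod B (fst (L ! i)) t (take i L @ drop (Suc i) L))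
      (blinfun_apply (snd (L ! i)) (blinfun_apply (op_exp ((fst (L ! i) - s) *\<^sub>R B)) x))"
  have eq: "blinfun_apply (tprod B s t L) x = ?v i" if i: "i < length L" "?P i" for i
  proof -
    let ?R = "take i L @ drop (Suc i) L"
    have "L = take i L @ L ! i # drop (Suc i) L"
      using i(1) by (simp add: id_take_nth_drop)
    then have "mset L = mset ([] @ (fst (L ! i), snd (L ! i)) # ?R)"
      by (metis (no_types, lifting) append_Nil mset.simps(2) mset_append prod.collapse union_mset_add_mset_right)
    then have "tprod B s t L = tprod B s t ([] @ (fst (L ! i), snd (L ! i)) # ?R)"
      by (rule tprod_perm)
    also have "\<dots> = tprod B (fst (L ! i)) t ?R o\<^sub>L (snd (L ! i) o\<^sub>L tprod B s (fst (L ! i)) [])"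
    proof (rule tprod_mark)
      fix z assume "z \<in> set ?R"
      then consider k where "k < i" "z = L ! k" | k where "k < length L - Suc i" "z = L ! (Suc i + k)"
        using i(1) by (auto simp: in_set_conv_nth)
      then obtain j where "j < length L" "j \<noteq> i" "z = L ! j"
      proof cases
        case 1
        then show ?thesis using i(1) that[of k] by simp
      next
        case 2
        then show ?thesis using i(1) that[of "Suc i + k"] by simp
      qed
      then show "fst (L ! i) < fst z" using i by auto
    qed (use i in auto)
    finally show ?thesis by simp
  qed
  show ?thesis
  \<comment> \<open>The index of a strictly least time is unique, so at most one summand is nonzero.
    If there is none, two times coincide or one of them lies outside of the interval, and both sides
    vanish.\<close>
  proof (cases "\<exists>i<length L. ?P i")
    case True
    then obtain i where i: "i < length L" "?P i" by blast
    have "(\<Sum>j<length L. if ?P j then ?v j else 0) = (\<Sum>j<length L. if j = i then ?v i else 0)"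
    proof (intro sum.cong refl)
      fix j assume j: "j \<in> {..<length L}"
      have "\<not> ?P j" if "j \<noteq> i"
        using i j that by (metis Diff_iff lessThan_iff less_asym singletonD)
      then show "(if ?P j then ?v j else 0) = (if j = i then ?v i else 0)"
      proof (cases "j = i")
        case True
        show ?thesis unfolding True by (simp only: if_P[OF i(2)] if_P[OF refl])
      next
        case False
        show ?thesis by (simp only: if_not_P[OF \<open>j \<noteq> i \<Longrightarrow> \<not> ?P j\<close>[OF False]] if_not_P[OF False])
      qed
    qed
    then show ?thesis
      using eq[OF i] i(1) by simp
  next
    case False
    have "\<not> (distinct (map fst L) \<and> (\<forall>z\<in>set L. s < fst z \<and> fst z < t))"
    proof
      assume d: "distinct (map fst L) \<and> (\<forall>z\<in>set L. s < fst z \<and> fst z < t)"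
      have "Min (fst ` set L) \<in> fst ` set L" using assms by simp
      then obtain i where i: "i < length L" "fst (L ! i) = Min (fst ` set L)"
        by (metis (no_types, lifting) imageE in_set_conv_nth)
      have "fst (L ! i) < fst (L ! j)" if "j < length L" "j \<noteq> i" for j
      proof -
        have "fst (L ! i) \<le> fst (L ! j)" using i that by simp
        moreover have "fst (L ! i) \<noteq> fst (L ! j)"
          using d that i(1) by (auto simp: distinct_conv_nth)
        ultimately show ?thesis by simp
      qed
      then have "?P i" using d i(1) by simp
      then show False using False i(1) by blast
    qed
    then have "tprod B s t L = 0" by (auto simp: tprod_def)
    moreover have "(\<Sum>i<length L. if ?P i then ?v i else 0) = 0"
      using False by (intro sum.neutral ballI) auto
    ultimately show ?thesis by simp
  qed
qed

lemma borel_measurable_blinfun_apply_const: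
  fixes X :: "'k::{complex_hilbert, second_countable_topology} \<Rightarrow>\<^sub>L 'k"
  assumes "f \<in> borel_measurable M"
  shows "(\<lambda>w. blinfun_apply X (f w)) \<in> borel_measurable M"
  by (rule measurable_compose[OF assms], rule borel_measurable_continuous_onI)
     (intro continuous_intros)

text \<open>Induction on the number of marks. The starting time must be a function too, since after
  the first mark the product starts at the time of that mark.\<close>

lemma borel_measurable_tprod:
  fixes B :: "'k::{complex_hilbert, second_countable_topology} \<Rightarrow>\<^sub>L 'k"
  assumes "s \<in> borel_measurable N" "x \<in> borel_measurable N"
    and "\<And>z. z \<in> set L \<Longrightarrow> fst z \<in> borel_measurable N"
  shows "(\<lambda>w. blinfun_apply (tprod B (s w) t (map (\<lambda>(f, X). (f w, X)) L)) (x w)) \<in> borel_measurable N"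
  using assms
proof (induction "length L" arbitrary: L s x)
  case 0
  then have "(\<lambda>w. t - s w) \<in> borel_measurable N" by simp
  from borel_measurable_op_exp[OF this 0(3)] show ?case
    using 0 by simp
next
  case (Suc n)
  note [measurable] = Suc.prems(1,2)
  let ?L = "\<lambda>w. map (\<lambda>(f, X). (f w, X)) L"
  have fs [measurable]: "fst (L ! i) \<in> borel_measurable N" if "i < length L" for i
    using Suc.prems(3) that by simp
  have "(\<lambda>w. blinfun_apply (tprod B (s w) t (?L w)) (x w)) = (\<lambda>w. \<Sum>i<length L.
    if (\<forall>j\<in>{..<length L} - {i}. fst (L ! i) w < fst (L ! j) w) \<and> s w < fst (L ! i) w \<and> fst (L ! i) w < t
    then blinfun_apply (tprod B (fst (L ! i) w) t (map (\<lambda>(f, X). (f w, X)) (take i L @ drop (Suc i) L)))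
      (blinfun_apply (snd (L ! i)) (blinfun_apply (op_exp ((fst (L ! i) w - s w) *\<^sub>R B)) (x w)))
    else 0)"
  proof
    fix w
    have "?L w \<noteq> []" using Suc.hyps(2) by auto
    then show "blinfun_apply (tprod B (s w) t (?L w)) (x w) = (\<Sum>i<length L.
    if (\<forall>j\<in>{..<length L} - {i}. fst (L ! i) w < fst (L ! j) w) \<and> s w < fst (L ! i) w \<and> fst (L ! i) w < t
    then blinfun_apply (tprod B (fst (L ! i) w) t (map (\<lambda>(f, X). (f w, X)) (take i L @ drop (Suc i) L)))
      (blinfun_apply (snd (L ! i)) (blinfun_apply (op_exp ((fst (L ! i) w - s w) *\<^sub>R B)) (x w)))
    else 0)"
      by (subst tprod_first_mark) (auto intro!: sum.cong simp: case_prod_beta take_map drop_map)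
  qed
  also have "\<dots> \<in> borel_measurable N"
  proof (intro borel_measurable_sum measurable_If)
    fix i assume "i \<in> {..<length L}"
    then have i: "i < length L" by simp
    let ?P = "\<lambda>w. (\<forall>j\<in>{..<length L} - {i}. fst (L ! i) w < fst (L ! j) w) \<and> s w < fst (L ! i) w \<and> fst (L ! i) w < t"
    have "Measurable.pred N ?P"
    proof (intro pred_intros_logic pred_intros_finite)
      show "Measurable.pred N (\<lambda>w. fst (L ! i) w < fst (L ! j) w)" if "j \<in> {..<length L} - {i}" for j
        using fs[OF i] fs[of j] that by (intro borel_measurable_pred_less) auto
    qed (use fs[OF i] in \<open>auto intro!: borel_measurable_pred_less\<close>)
    then show "{w \<in> space N. ?P w} \<in> sets N" by (simp only: pred_def)
    have m: "(\<lambda>w. fst (L ! i) w - s w) \<in> borel_measurable N"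
      using fs[OF i] by measurable
    show "(\<lambda>w. blinfun_apply (tprod B (fst (L ! i) w) t (map (\<lambda>(f, X). (f w, X)) (take i L @ drop (Suc i) L)))
      (blinfun_apply (snd (L ! i)) (blinfun_apply (op_exp ((fst (L ! i) w - s w) *\<^sub>R B)) (x w)))) \<in> borel_measurable N"
    proof (rule Suc.hyps(1))
      show "n = length (take i L @ drop (Suc i) L)" using Suc.hyps(2) i by simp
      show "fst z \<in> borel_measurable N" if "z \<in> set (take i L @ drop (Suc i) L)" for z
        using that by (intro Suc.prems(3)) (auto dest: in_set_takeD in_set_dropD)
      show "(\<lambda>w. blinfun_apply (snd (L ! i)) (blinfun_apply (op_exp ((fst (L ! i) w - s w) *\<^sub>R B)) (x w))) \<in> borel_measurable N"
        by (intro borel_measurable_blinfun_apply_const borel_measurable_op_exp m Suc.prems(2))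
    qed (rule fs[OF i])
  qed simp
  finally show ?case .
qed

definition marked_kernel ::
  "('k::complex_hilbert \<Rightarrow>\<^sub>L 'k) \<Rightarrow> ('k \<Rightarrow>\<^sub>L 'k) \<Rightarrow> ('k \<Rightarrow>\<^sub>L 'k) \<Rightarrow> ('k \<Rightarrow>\<^sub>L 'k) \<Rightarrow> real \<Rightarrow> real \<Rightarrow>
   (real \<times> ('k \<Rightarrow>\<^sub>L 'k)) list \<Rightarrow> real list \<Rightarrow> real list \<Rightarrow> real list \<Rightarrow> ('k \<Rightarrow>\<^sub>L 'k)" where
  "marked_kernel A1 A0 Am B s t ms \<sigma> \<tau> \<upsilon> =
    tprod B s t (ms @ map (\<lambda>r. (r, A1)) \<sigma> @ map (\<lambda>r. (r, A0)) \<tau> @ map (\<lambda>r. (r, Am)) \<upsilon>)"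

lemma marked_kernel_Nil: "marked_kernel A1 A0 Am B s t [] = kernel A1 A0 Am B s t"
  by (intro ext) (simp add: marked_kernel_def kernel_eq_tprod)

lemma measurable_from_conf_pair_mid:
  assumes "(\<lambda>(w, x, q). f x w q) \<in> conf_measure \<Otimes>\<^sub>M (P \<Otimes>\<^sub>M Q) \<rightarrow>\<^sub>M N"
  shows "(\<lambda>(x, w, q). f x w q) \<in> P \<Otimes>\<^sub>M (conf_measure \<Otimes>\<^sub>M Q) \<rightarrow>\<^sub>M N"
proof -
  have "(\<lambda>z. (fst (snd z), fst z, snd (snd z))) \<in> P \<Otimes>\<^sub>M (conf_measure \<Otimes>\<^sub>M Q) \<rightarrow>\<^sub>M conf_measure \<Otimes>\<^sub>M (P \<Otimes>\<^sub>M Q)"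
    by measurable
  from measurable_compose[OF this assms] show ?thesis by (simp add: case_prod_beta)
qed

text \<open>The three lists are replaced by coordinate vectors one after the other, until the kernel
  is a time-ordered product whose times are measurable coordinates.\<close>

lemma borel_measurable_marked_kernel:
  fixes A1 A0 Am B :: "'k::{complex_hilbert, second_countable_topology} \<Rightarrow>\<^sub>L 'k"
  shows "(\<lambda>(\<sigma>, \<tau>, \<upsilon>, x). blinfun_apply (marked_kernel A1 A0 Am B s t ms \<sigma> \<tau> \<upsilon>) x)
    \<in> borel_measurable (conf_measure \<Otimes>\<^sub>M conf_measure \<Otimes>\<^sub>M conf_measure \<Otimes>\<^sub>M borel)"
proof (rule measurable_from_conf_pair)
  fix n
  let ?f = "\<lambda>y \<tau> \<upsilon> x. blinfun_apply (marked_kernel A1 A0 Am B s t ms (conf n y) \<tau> \<upsilon>) x"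
  have "(\<lambda>(\<tau>, y, \<upsilon>, x). ?f y \<tau> \<upsilon> x) \<in> borel_measurable (conf_measure \<Otimes>\<^sub>M Rpow n \<Otimes>\<^sub>M conf_measure \<Otimes>\<^sub>M borel)"
  proof (rule measurable_from_conf_pair)
    fix m
    have "(\<lambda>(\<upsilon>, (y', y), x). ?f y (conf m y') \<upsilon> x) \<in> borel_measurable (conf_measure \<Otimes>\<^sub>M (Rpow m \<Otimes>\<^sub>M Rpow n) \<Otimes>\<^sub>M borel)"
    proof (rule measurable_from_conf_pair)
      fix l
      let ?N = "Rpow l \<Otimes>\<^sub>M (Rpow m \<Otimes>\<^sub>M Rpow n) \<Otimes>\<^sub>M (borel :: 'k measure)"
      let ?L = "map (\<lambda>(r, X). (\<lambda>_ :: (nat \<Rightarrow> real) \<times> ((nat \<Rightarrow> real) \<times> (nat \<Rightarrow> real)) \<times> 'k. r, X)) ms @ map (\<lambda>i. (\<lambda>w. snd (fst (snd w)) i, A1)) [0..<n]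
        @ map (\<lambda>i. (\<lambda>w. fst (fst (snd w)) i, A0)) [0..<m] @ map (\<lambda>i. (\<lambda>w. fst w i, Am)) [0..<l]"
      have "(\<lambda>w. blinfun_apply (tprod B s t (map (\<lambda>(f, X). (f w, X)) ?L)) (snd (snd w))) \<in> borel_measurable ?N"
      proof (rule borel_measurable_tprod)
        have c: "(\<lambda>y. y i) \<in> borel_measurable (Rpow k)" if "i < k" for i k using that by simp
        have p: "(\<lambda>w. fst (snd w)) \<in> ?N \<rightarrow>\<^sub>M Rpow m \<Otimes>\<^sub>M Rpow n" by measurable
        fix z assume "z \<in> set ?L"
        then show "fst z \<in> borel_measurable ?N"
          by (auto intro!: measurable_compose[OF measurable_fst c]
              measurable_compose[OF measurable_compose[OF p measurable_fst] c]
              measurable_compose[OF measurable_compose[OF p measurable_snd] c])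
      qed measurable
      also have "(\<lambda>w. blinfun_apply (tprod B s t (map (\<lambda>(f, X). (f w, X)) ?L)) (snd (snd w)))
          = (\<lambda>(y'', (y', y), x). ?f y (conf m y') (conf l y'') x)"
        by (auto simp: marked_kernel_def conf_def case_prod_beta comp_def fun_eq_iff)
      finally show "(\<lambda>(y'', p). (\<lambda>((y', y), x). ?f y (conf m y') (conf l y'') x) p) \<in> borel_measurable ?N"
        by simp
    qed
    then have "(\<lambda>(p, \<upsilon>, x). (\<lambda>(y', y). ?f y (conf m y') \<upsilon> x) p) \<in> borel_measurable ((Rpow m \<Otimes>\<^sub>M Rpow n) \<Otimes>\<^sub>M conf_measure \<Otimes>\<^sub>M borel)"
      by (intro measurable_from_conf_pair_mid) (simp add: split_beta')
    from measurable_compose[OF _ this, of "\<lambda>(y', y, \<upsilon>, x). ((y', y), \<upsilon>, x)"]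
    show "(\<lambda>(y', p). (\<lambda>(y, \<upsilon>, x). ?f y (conf m y') \<upsilon> x) p) \<in> borel_measurable (Rpow m \<Otimes>\<^sub>M Rpow n \<Otimes>\<^sub>M conf_measure \<Otimes>\<^sub>M borel)"
      by (simp add: split_beta')
  qed
  from measurable_from_conf_pair_mid[OF this]
  show "(\<lambda>(y, p). (\<lambda>(\<tau>, \<upsilon>, x). ?f y \<tau> \<upsilon> x) p) \<in> borel_measurable (Rpow n \<Otimes>\<^sub>M conf_measure \<Otimes>\<^sub>M conf_measure \<Otimes>\<^sub>M borel)"
    by (simp add: split_beta')
qed

section \<open>Bounded functions with bounded support\<close>

text \<open>In contrast to the test functions, this class is stable under evolution of a part of the
  argument (\<open>mop_append_bfun\<close>). Continuity is lost in general, because the evolved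
  function jumps when a point crosses \<open>s\<close> or \<open>t\<close>.\<close>

definition bfun :: "(real list \<Rightarrow> 'k::complex_hilbert) set" where
  "bfun = {g. g \<in> borel_measurable conf_measure \<and> symmetric g \<and>
     (\<exists>C R. \<forall>w. norm (g w) \<le> C * indicator (conf_box R) w)}"

lemma bfunI:
  assumes "g \<in> borel_measurable conf_measure" "symmetric g"
    "\<And>w. norm (g w) \<le> C * indicator (conf_box R) w"
  shows "g \<in> bfun"
  using assms by (auto simp: bfun_def)

lemma bfun_measurable: "g \<in> bfun \<Longrightarrow> g \<in> borel_measurable conf_measure"
  by (simp add: bfun_def)

lemma bfun_symmetric: "g \<in> bfun \<Longrightarrow> symmetric g"
  by (simp add: bfun_def)

lemma bfun_bound:
  assumes "g \<in> bfun"
  obtains C R where "0 \<le> C" "\<And>w. norm (g w) \<le> C * indicator (conf_box R) w"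
proof -
  obtain C R where CR: "\<And>w. norm (g w) \<le> C * indicator (conf_box R) w"
    using assms by (auto simp: bfun_def)
  have "norm (g w) \<le> \<bar>C\<bar> * indicator (conf_box R) w" for w
    using CR[of w] by (auto split: split_indicator_asm)
  then show ?thesis by (rule that[OF abs_ge_zero])
qed

lemma symmetricD: "symmetric f \<Longrightarrow> mset v = mset w \<Longrightarrow> f v = f w"
  unfolding symmetric_def by blast

lemma conf_box_appendD: "v @ w \<in> conf_box R \<Longrightarrow> v \<in> conf_box R" "v @ w \<in> conf_box R \<Longrightarrow> w \<in> conf_box R"
  by (auto simp: conf_box_def)

lemma indicator_conf_box_append:
  "indicator (conf_box R) (v @ w) \<le> (indicator (conf_box R) v :: real)"
  "indicator (conf_box R) (v @ w) \<le> (indicator (conf_box R) w :: real)"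
  using conf_box_appendD[of v w R] by (auto split: split_indicator)

lemma bfun_append:
  assumes "g \<in> bfun"
  shows "(\<lambda>v. g (v @ w)) \<in> bfun"
proof -
  obtain C R where C: "0 \<le> C" "\<And>w. norm (g w) \<le> C * indicator (conf_box R) w"
    using bfun_bound[OF assms] by metis
  note [measurable] = bfun_measurable[OF assms]
  show ?thesis
  proof (rule bfunI)
    show "symmetric (\<lambda>v. g (v @ w))"
      unfolding symmetric_def by (auto intro!: symmetricD[OF bfun_symmetric[OF assms]])
    show "norm (g (v @ w)) \<le> C * indicator (conf_box R) v" for v
      using C(2)[of "v @ w"] mult_left_mono[OF indicator_conf_box_append(1)[of R v w] C(1)] by linarith
  qed measurable
qed

lemma integrable_conf_box:
  fixes f :: "real list \<Rightarrow> 'b::{banach, second_countable_topology}"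
  assumes "f \<in> borel_measurable conf_measure" "\<And>w. norm (f w) \<le> C * indicator (conf_box R) w"
  shows "integrable conf_measure f"
proof (rule Bochner_Integration.integrable_bound)
  show "integrable conf_measure (\<lambda>w. C * indicator (conf_box R) w)"
    using emeasure_conf_box[of R] by (intro integrable_mult_right integrable_real_indicator) auto
  show "AE w in conf_measure. norm (f w) \<le> norm (C * indicator (conf_box R) w)"
    using assms(2) by (auto intro: order_trans[OF _ abs_ge_self])
qed (rule assms(1))

lemma bfun_norm2_finite:
  fixes g :: "real list \<Rightarrow> 'k::{complex_hilbert, second_countable_topology}"
  assumes "g \<in> bfun"
  shows "integrable conf_measure (\<lambda>w. (norm (g w))\<^sup>2)"
proof -
  obtain C R where C: "0 \<le> C" "\<And>w. norm (g w) \<le> C * indicator (conf_box R) w"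
    using bfun_bound[OF assms] by metis
  note [measurable] = bfun_measurable[OF assms]
  have "norm ((norm (g w))\<^sup>2) \<le> C\<^sup>2 * indicator (conf_box R) w" for w
    using power_mono[OF C(2)[of w], of 2] by (auto simp: indicator_def split: if_splits)
  then show ?thesis by (intro integrable_conf_box) measurable
qed

section \<open>The operators of marked kernels\<close>

lemma kernel_op_eq_split_sum:
  "kernel_op u g w = split_sum (length w) (\<lambda>\<alpha> \<beta>. LINT v|conf_measure.
      blinfun_apply (u (nths w \<alpha>) (nths w \<beta>) v) (g (nths w ({..<length w} - \<alpha>) @ v)))"
  by (simp add: kernel_op_def split_sum_def)

lemma kernel_op_zero [simp]: "kernel_op u (\<lambda>_. 0) w = 0"
  by (simp add: kernel_op_def)

lemma mset_nths_eq: "mset (nths w I) = image_mset ((!) w) (mset_set {i\<in>I. i < length w})"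
proof (induction w rule: rev_induct)
  case (snoc r w)
  let ?n = "length w"
  have 1: "image_mset ((!) (w @ [r])) (mset_set {i\<in>I. i < ?n}) = image_mset ((!) w) (mset_set {i\<in>I. i < ?n})"
    by (intro image_mset_cong) (auto simp: nth_append)
  have "nths (w @ [r]) I = nths w I @ (if ?n \<in> I then [r] else [])"
    by (simp add: nths_append nths_singleton)
  moreover have "{i\<in>I. i < length (w @ [r])} = (if ?n \<in> I then insert ?n {i\<in>I. i < ?n} else {i\<in>I. i < ?n})"
    by (auto simp: less_Suc_eq)
  ultimately show ?case
    by (simp add: 1 snoc)
qed simp

lemma mset_nths_permute_list:
  assumes p: "p permutes {..<length w}" and I: "I \<subseteq> {..<length w}"
  shows "mset (nths (permute_list p w) I) = mset (nths w (p ` I))"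
proof -
  have inj: "inj_on p J" for J using permutes_inj[OF p] by (rule inj_on_subset) simp
  have "{i \<in> p ` I. i < length w} = p ` I" "{i \<in> I. i < length w} = I"
    using I permutes_in_image[OF p] by auto
  moreover have "image_mset ((!) (permute_list p w)) (mset_set I) = image_mset ((!) w) (image_mset p (mset_set I))"
    unfolding multiset.map_comp
    by (intro image_mset_cong) (use I finite_subset[OF I] in \<open>auto simp: permute_list_nth[OF p]\<close>)
  ultimately show ?thesis
    by (simp add: mset_nths_eq image_mset_mset_set[OF inj])
qed

text \<open>The permutation of positions that relates two arrangements of a configuration maps the
  pairs of disjoint sets of positions bijectively onto each other; it only reorders the double
  sum.\<close>

lemma symmetric_kernel_op:
  assumes u: "\<And>a a' b b' v. mset a = mset a' \<Longrightarrow> mset b = mset b' \<Longrightarrow> u a b v = u a' b' v"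
    and g: "symmetric g"
  shows "symmetric (kernel_op u g)"
  unfolding symmetric_def
proof (intro allI impI)
  fix v w :: "real list" assume vw: "mset v = mset w"
  from mset_eq_permutation[OF vw] obtain p where p: "p permutes {..<length w}" "permute_list p w = v" .
  let ?n = "length w"
  have n: "length v = ?n" using vw by (rule mset_eq_length)
  define F where "F \<alpha> \<beta> = (LINT x|conf_measure.
      blinfun_apply (u (nths w \<alpha>) (nths w \<beta>) x) (g (nths w ({..<?n} - \<alpha>) @ x)))" for \<alpha> \<beta>
  have inj: "inj_on p J" for J using permutes_inj[OF p(1)] by (rule inj_on_subset) simp
  have im: "p ` ({..<?n} - \<alpha>) = {..<?n} - p ` \<alpha>" if "\<alpha> \<subseteq> {..<?n}" for \<alpha>
    using permutes_image[OF p(1)] that by (simp add: image_set_diff[OF permutes_inj[OF p(1)]])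
  have bij: "bij_betw ((`) p) (Pow J) (Pow (p ` J))" for J
    by (rule bij_betw_Pow) (simp add: bij_betw_def inj)
  have "kernel_op u g v = (\<Sum>\<alpha>\<in>Pow {..<?n}. \<Sum>\<beta>\<in>Pow ({..<?n} - \<alpha>). F (p ` \<alpha>) (p ` \<beta>))"
    unfolding kernel_op_def n F_def
  proof (intro sum.cong refl Bochner_Integration.integral_cong)
    fix \<alpha> \<beta> x assume ab: "\<alpha> \<in> Pow {..<?n}" "\<beta> \<in> Pow ({..<?n} - \<alpha>)"
    have "mset (nths v I) = mset (nths w (p ` I))" if "I \<subseteq> {..<?n}" for I
      using mset_nths_permute_list[OF p(1) that] p(2) by simp
    note this[of \<alpha>] this[of \<beta>] this[of "{..<?n} - \<alpha>"]
    moreover have "\<beta> \<subseteq> {..<?n}" "\<alpha> \<subseteq> {..<?n}" using ab by auto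
    ultimately show "blinfun_apply (u (nths v \<alpha>) (nths v \<beta>) x) (g (nths v ({..<?n} - \<alpha>) @ x))
        = blinfun_apply (u (nths w (p ` \<alpha>)) (nths w (p ` \<beta>)) x) (g (nths w ({..<?n} - p ` \<alpha>) @ x))"
      by (intro arg_cong2[where f = blinfun_apply] u symmetricD[OF g]) (simp_all add: im)
  qed
  also have "\<dots> = (\<Sum>\<alpha>\<in>Pow {..<?n}. \<Sum>\<beta>\<in>Pow (p ` ({..<?n} - \<alpha>)). F (p ` \<alpha>) \<beta>)"
    by (intro sum.cong refl sum.reindex_bij_betw bij)
  also have "\<dots> = (\<Sum>\<alpha>\<in>Pow {..<?n}. \<Sum>\<beta>\<in>Pow ({..<?n} - p ` \<alpha>). F (p ` \<alpha>) \<beta>)"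
    by (intro sum.cong refl) (auto simp: im)
  also have "\<dots> = (\<Sum>\<alpha>\<in>Pow (p ` {..<?n}). \<Sum>\<beta>\<in>Pow ({..<?n} - \<alpha>). F \<alpha> \<beta>)"
    by (rule sum.reindex_bij_betw[OF bij, where g = "\<lambda>\<alpha>. \<Sum>\<beta>\<in>Pow ({..<?n} - \<alpha>). F \<alpha> \<beta>"])
  also have "\<dots> = kernel_op u g w"
    by (simp add: permutes_image[OF p(1)] kernel_op_def F_def)
  finally show "kernel_op u g v = kernel_op u g w" .
qed

locale evolution_kernel =
  fixes A1 A0 Am B :: "'k::{complex_hilbert, second_countable_topology} \<Rightarrow>\<^sub>L 'k"
begin

abbreviation mker where "mker \<equiv> marked_kernel A1 A0 Am B"

abbreviation mop where "mop s t ms \<equiv> kernel_op (mker s t ms)"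

lemma mker_perm:
  assumes "mset ms = mset ms'" "mset a = mset a'" "mset b = mset b'" "mset v = mset v'"
  shows "mker s t ms a b v = mker s t ms' a' b' v'"
  unfolding marked_kernel_def by (rule tprod_perm) (simp add: assms)

lemma mop_perm: "mset ms = mset ms' \<Longrightarrow> mop s t ms = mop s t ms'"
  by (intro arg_cong[where f = kernel_op] ext mker_perm) simp_all

lemma symmetric_mop: "symmetric g \<Longrightarrow> symmetric (mop s t ms g)"
  by (rule symmetric_kernel_op) (auto intro: mker_perm)

text \<open>A common bound for all operators in the kernel. It is at least 1, so that its powers
  grow with the exponent.\<close>

definition mbound :: "(real \<times> ('k \<Rightarrow>\<^sub>L 'k)) list \<Rightarrow> real" where
  "mbound ms = Max (insert 1 (norm ` (snd ` set ms \<union> {A1, A0, Am})))"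

lemma mbound: "1 \<le> mbound ms" "norm A1 \<le> mbound ms" "norm A0 \<le> mbound ms" "norm Am \<le> mbound ms"
  "z \<in> set ms \<Longrightarrow> norm (snd z) \<le> mbound ms"
  unfolding mbound_def by (intro Max_ge; force)+

lemma norm_mker:
  assumes "s \<le> t"
  shows "norm (mker s t ms a b v) \<le> exp ((t - s) * norm B) * mbound ms ^ (length ms + length a + length b + length v)"
proof -
  have "norm (mker s t ms a b v) \<le> exp ((t - s) * norm B)
      * mbound ms ^ length (ms @ map (\<lambda>r. (r, A1)) a @ map (\<lambda>r. (r, A0)) b @ map (\<lambda>r. (r, Am)) v)"
    unfolding marked_kernel_def
    by (rule norm_tprod[OF assms]) (use mbound[where ms = ms] in \<open>auto\<close>)
  then show ?thesis by (simp add: add.assoc)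
qed

text \<open>The vector vanishes unless \<open>v\<close> has at most \<open>R\<close> points.
  Therefore \<open>R\<close> can replace the length of \<open>v\<close> in the exponent, and the
  bound is integrable in \<open>v\<close>.\<close>

lemma norm_mker_apply:
  assumes "s \<le> t" "norm x \<le> C * indicator (conf_box R) (c @ v)" "0 \<le> C"
  shows "norm (blinfun_apply (mker s t ms a b v) x)
    \<le> exp ((t - s) * norm B) * mbound ms ^ (length ms + length a + length b + R) * C * indicator (conf_box R) v"
proof (cases "c @ v \<in> conf_box R")
  case True
  then have v: "length v \<le> R" "v \<in> conf_box R" by (auto simp: conf_box_def)
  have "norm (blinfun_apply (mker s t ms a b v) x) \<le> norm (mker s t ms a b v) * norm x"
    by (rule norm_blinfun)
  also have "\<dots> \<le> (exp ((t - s) * norm B) * mbound ms ^ (length ms + length a + length b + R)) * C"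
  proof (intro mult_mono)
    have "mbound ms ^ (length ms + length a + length b + length v) \<le> mbound ms ^ (length ms + length a + length b + R)"
      using v mbound(1)[where ms = ms] by (intro power_increasing) auto
    with norm_mker[OF assms(1), of ms a b v]
    show "norm (mker s t ms a b v) \<le> exp ((t - s) * norm B) * mbound ms ^ (length ms + length a + length b + R)"
      by (meson exp_ge_zero mult_left_mono order_trans)
  qed (use assms(2) True mbound(1)[where ms = ms] in \<open>auto\<close>)
  finally show ?thesis using v by simp
next
  case False
  then have "x = 0" using assms(2) by simp
  then show ?thesis using assms(3) mbound(1)[where ms = ms] by simp
qed

lemma borel_measurable_mker_apply [measurable (raw)]:
  assumes "a \<in> N \<rightarrow>\<^sub>M conf_measure" "b \<in> N \<rightarrow>\<^sub>M conf_measure" "v \<in> N \<rightarrow>\<^sub>M conf_measure" "x \<in> borel_measurable N"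
  shows "(\<lambda>z. blinfun_apply (mker s t ms (a z) (b z) (v z)) (x z)) \<in> borel_measurable N"
proof -
  have "(\<lambda>z. (a z, b z, v z, x z)) \<in> N \<rightarrow>\<^sub>M conf_measure \<Otimes>\<^sub>M conf_measure \<Otimes>\<^sub>M conf_measure \<Otimes>\<^sub>M borel"
    using assms by measurable
  from measurable_compose[OF this borel_measurable_marked_kernel] show ?thesis by simp
qed

lemma integrable_mker_apply:
  assumes "s \<le> t" "g \<in> borel_measurable conf_measure" "0 \<le> C" "\<And>w. norm (g w) \<le> C * indicator (conf_box R) w"
  shows "integrable conf_measure (\<lambda>v. blinfun_apply (mker s t ms a b v) (g (c @ v)))"
proof (rule integrable_conf_box)
  note [measurable] = assms(2)
  show "(\<lambda>v. blinfun_apply (mker s t ms a b v) (g (c @ v))) \<in> borel_measurable conf_measure"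
    by measurable
  show "norm (blinfun_apply (mker s t ms a b v) (g (c @ v)))
    \<le> exp ((t - s) * norm B) * mbound ms ^ (length ms + length a + length b + R) * C * indicator (conf_box R) v" for v
    by (rule norm_mker_apply[OF assms(1) assms(4) assms(3)])
qed

lemma integrable_mker_bfun:
  assumes "s \<le> t" "g \<in> bfun"
  shows "integrable conf_measure (\<lambda>v. blinfun_apply (mker s t ms a b v) (g (c @ v)))"
proof -
  obtain C R where "0 \<le> C" "\<And>w. norm (g w) \<le> C * indicator (conf_box R) w"
    using bfun_bound[OF assms(2)] by metis
  then show ?thesis
    by (rule integrable_mker_apply[OF assms(1) bfun_measurable[OF assms(2)]])
qed

lemma of_nat_le_two_pow: "m \<le> 2 ^ n \<Longrightarrow> real m \<le> 2 ^ n"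
  by (metis of_nat_le_iff of_nat_numeral of_nat_power)

text \<open>The constant is the same for all functions with the same size and support. This
  uniformity is needed in \<open>mop_append_bfun\<close>, where the function depends on the second
  part of the argument.\<close>

lemma mop_bounded:
  assumes "s \<le> t" "0 \<le> C"
  shows "\<exists>D\<ge>0. \<forall>g w. g \<in> borel_measurable conf_measure \<longrightarrow> (\<forall>v. norm (g v) \<le> C * indicator (conf_box R) v)
    \<longrightarrow> length w \<le> n \<longrightarrow> norm (mop s t ms g w) \<le> D"
proof -
  let ?E = "exp ((t - s) * norm B) * mbound ms ^ (length ms + n + n + R) * C"
  let ?D = "?E * measure conf_measure (conf_box R)"
  have K: "1 \<le> mbound ms" by (rule mbound)
  have D: "0 \<le> ?D" using K assms(2) by simp
  \<comment> \<open>There are at most \<open>2 ^ n\<close> choices for \<alpha> and, for each of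
    them, at most \<open>2 ^ n\<close> choices for \<beta>.\<close>
  have "norm (mop s t ms g w) \<le> 2 ^ n * (2 ^ n * ?D)"
    if g: "g \<in> borel_measurable conf_measure" "\<And>v. norm (g v) \<le> C * indicator (conf_box R) v" and w: "length w \<le> n" for g w
  proof -
    have trm: "norm (LINT v|conf_measure. blinfun_apply (mker s t ms (nths w \<alpha>) (nths w \<beta>) v) (g (c @ v))) \<le> ?D"
      for \<alpha> \<beta> c
    proof -
      let ?f = "\<lambda>v. blinfun_apply (mker s t ms (nths w \<alpha>) (nths w \<beta>) v) (g (c @ v))"
      have len: "length (nths w I) \<le> n" for I
      proof -
        have "length (nths w I) \<le> card {..<length w}"
          unfolding length_nths by (rule card_mono) auto
        then show ?thesis using w by simp
      qed
      have "norm (?f v) \<le> ?E * indicator (conf_box R) v" for v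
      proof -
        have "norm (?f v) \<le> exp ((t - s) * norm B) * mbound ms ^ (length ms + length (nths w \<alpha>) + length (nths w \<beta>) + R) * C * indicator (conf_box R) v"
          by (rule norm_mker_apply[OF assms(1) g(2) assms(2)])
        also have "\<dots> \<le> ?E * indicator (conf_box R) v"
          using len[of \<alpha>] len[of \<beta>] K assms(2)
          by (intro mult_right_mono mult_left_mono power_increasing) auto
        finally show ?thesis .
      qed
      moreover have "integrable conf_measure (\<lambda>v. ?E * indicator (conf_box R) v)"
        using emeasure_conf_box[of R] by (intro integrable_mult_right integrable_real_indicator) auto
      moreover have "integrable conf_measure (\<lambda>v. norm (?f v))"
        by (rule integrable_norm[OF integrable_mker_apply[OF assms(1) g(1) assms(2) g(2)]])
      ultimately have "(LINT v|conf_measure. norm (?f v)) \<le> (LINT v|conf_measure. ?E * indicator (conf_box R) v)"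
        by (intro integral_mono)
      then have "norm (integral\<^sup>L conf_measure ?f) \<le> (LINT v|conf_measure. ?E * indicator (conf_box R) v)"
        by (rule order_trans[OF integral_norm_bound])
      then show ?thesis by simp
    qed
    have pow: "card (Pow J) \<le> 2 ^ n" if "J \<subseteq> {..<length w}" for J
    proof -
      have "card J \<le> n" using card_mono[OF _ that] w by simp
      then show ?thesis using finite_subset[OF that] by (simp add: card_Pow power_increasing)
    qed
    have "norm (mop s t ms g w) \<le> (\<Sum>\<alpha>\<in>Pow {..<length w}. 2 ^ n * ?D)"
      unfolding kernel_op_def
    proof (rule sum_norm_le)
      fix \<alpha> assume "\<alpha> \<in> Pow {..<length w}"
      have "norm (\<Sum>\<beta>\<in>Pow ({..<length w} - \<alpha>). LINT v|conf_measure. blinfun_apply (mker s t ms (nths w \<alpha>) (nths w \<beta>) v) (g (nths w ({..<length w} - \<alpha>) @ v)))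
          \<le> of_nat (card (Pow ({..<length w} - \<alpha>))) * ?D"
        by (rule sum_norm_bound) (rule trm)
      also have "\<dots> \<le> 2 ^ n * ?D"
        using D of_nat_le_two_pow[OF pow[of "{..<length w} - \<alpha>"]] by (intro mult_right_mono) simp_all
      finally show "norm (\<Sum>\<beta>\<in>Pow ({..<length w} - \<alpha>). LINT v|conf_measure. blinfun_apply (mker s t ms (nths w \<alpha>) (nths w \<beta>) v) (g (nths w ({..<length w} - \<alpha>) @ v)))
          \<le> 2 ^ n * ?D" .
    qed
    also have "\<dots> = of_nat (card (Pow {..<length w})) * (2 ^ n * ?D)" by simp
    also have "\<dots> \<le> 2 ^ n * (2 ^ n * ?D)"
      using D of_nat_le_two_pow[OF pow[of "{..<length w}"]]
      by (intro mult_right_mono) simp_all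
    finally show ?thesis .
  qed
  then show ?thesis using D by (intro exI[of _ "2 ^ n * (2 ^ n * ?D)"]) auto
qed

lemma borel_measurable_mop_param:
  assumes G: "G \<in> borel_measurable (conf_measure \<Otimes>\<^sub>M P)"
  shows "(\<lambda>z. mop s t ms (\<lambda>v. G (v, snd z)) (fst z)) \<in> borel_measurable (conf_measure \<Otimes>\<^sub>M P)"
proof -
  note measurable_nths_conf [measurable] G [measurable]
  \<comment> \<open>The complement \<open>- \<alpha>\<close> selects the same sublist but does not
    depend on the length of the list, as \<open>borel_measurable_split_sum\<close> requires.\<close>
  have eq: "mop s t ms (\<lambda>v. G (v, snd z)) (fst z) = split_sum (length (fst z)) (\<lambda>\<alpha> \<beta>. LINT v|conf_measure.
      blinfun_apply (mker s t ms (nths (fst z) \<alpha>) (nths (fst z) \<beta>) v) (G (nths (fst z) (- \<alpha>) @ v, snd z)))" for z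
    unfolding kernel_op_eq_split_sum
    using nths_cong_set[of "fst z" "{..<length (fst z)} - \<alpha>" "- \<alpha>" for \<alpha>] by simp
  have "(\<lambda>z. LINT v|conf_measure.
      blinfun_apply (mker s t ms (nths (fst z) \<alpha>) (nths (fst z) \<beta>) v) (G (nths (fst z) (- \<alpha>) @ v, snd z)))
    \<in> borel_measurable (conf_measure \<Otimes>\<^sub>M P)" for \<alpha> \<beta>
    by (rule conf.borel_measurable_lebesgue_integral) measurable
  then show ?thesis
    unfolding eq by (rule borel_measurable_split_sum)
qed

lemma borel_measurable_mop [measurable (raw)]:
  assumes [measurable]: "g \<in> borel_measurable conf_measure"
  shows "mop s t ms g \<in> borel_measurable conf_measure"
proof -
  have "(\<lambda>w. (w, ())) \<in> conf_measure \<rightarrow>\<^sub>M conf_measure \<Otimes>\<^sub>M count_space UNIV"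
    by measurable
  from measurable_compose[OF this borel_measurable_mop_param[of "\<lambda>z. g (fst z)"]]
  show ?thesis by simp
qed

lemma mop_add:
  assumes "s \<le> t" "g \<in> bfun" "h \<in> bfun"
  shows "mop s t ms (\<lambda>v. g v + h v) w = mop s t ms g w + mop s t ms h w"
  unfolding kernel_op_eq_split_sum
  by (simp add: blinfun.add_right integrable_mker_bfun[OF assms(1)] assms(2,3) split_sum_add)

lemma mop_Nil: "mop s t ms g [] = (LINT v|conf_measure. blinfun_apply (mker s t ms [] [] v) (g v))"
  by (simp add: kernel_op_def)

text \<open>By time ordering, a point in the first or second argument of the kernel acts like a mark
  with \<open>A1\<close> or \<open>A0\<close>. The last point \<open>c\<close> is in neither set, in
  \<beta>, or in \<alpha>. In the first two cases it remains in the argument of \<open>g\<close>; in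
  the third it has been created by the evolution and \<open>g\<close> does not see it.\<close>

lemma mop_snoc_eq:
  fixes c :: real
  assumes st: "s \<le> t" and g: "g \<in> bfun"
  shows "mop s t ms g (w @ [c]) = mop s t ms (\<lambda>v. g (v @ [c])) w + mop s t ((c, A0) # ms) (\<lambda>v. g (v @ [c])) w
    + mop s t ((c, A1) # ms) g w"
proof -
  let ?n = "length w"
  have sym: "g ((x @ [c]) @ v) = g ((x @ v) @ [c])" for x v
    by (rule symmetricD[OF bfun_symmetric[OF g]]) simp
  have 1: "{..<Suc ?n} - \<alpha> = insert ?n ({..<?n} - \<alpha>)" "{..<Suc ?n} - insert ?n \<alpha> = {..<?n} - \<alpha>" "{..<?n} - \<alpha> \<subseteq> {..<?n}"
    if "\<alpha> \<subseteq> {..<?n}" for \<alpha>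
    using that by auto
  have k: "mker s t ms (a @ [c]) b v = mker s t ((c, A1) # ms) a b v"
    "mker s t ms a (b @ [c]) v = mker s t ((c, A0) # ms) a b v" for a b v
    unfolding marked_kernel_def by (rule tprod_perm; simp)+
  show ?thesis
    unfolding kernel_op_eq_split_sum length_append_singleton split_sum_Suc
    by (intro arg_cong2[where f = "(+)"] split_sum_cong)
       (simp_all add: 1 nths_snoc_less nths_snoc_insert k sym del: append_assoc)
qed

text \<open>A mark outside of the open interval annihilates the kernel, so only the first of the
  three terms remains.\<close>

lemma mop_snoc_out:
  assumes "s \<le> t" "g \<in> bfun" "c \<le> s \<or> t \<le> c"
  shows "mop s t ms g (w @ [c]) = mop s t ms (\<lambda>v. g (v @ [c])) w"
proof -
  have "mker s t ((c, X) # ms) = (\<lambda>_ _ _. 0)" for X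
    unfolding marked_kernel_def using assms(3) by (intro ext tprod_eq_0) auto
  then show ?thesis
    unfolding mop_snoc_eq[OF assms(1,2)] by (simp add: kernel_op_def)
qed

text \<open>The term without a mark is the one with the identity as a mark, and it merges with the
  term for \<open>A0\<close>. Under the unitarity conditions the sum \<open>A0 + id_blinfun\<close>
  is the operator \<Upsilon>.\<close>

lemma mop_snoc_in:
  assumes st: "s < c" "c < t" and g: "g \<in> bfun" and c: "c \<notin> set w" "c \<notin> fst ` set ms"
  shows "mop s t ms g (w @ [c]) = mop s t ((c, A1) # ms) g w
    + mop s t ((c, A0 + id_blinfun) # ms) (\<lambda>v. g (v @ [c])) w"
proof -
  let ?g = "\<lambda>v. g (v @ [c])"
  have le: "s \<le> t" using st by simp
  have g': "?g \<in> bfun" by (rule bfun_append[OF g])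
  have "mop s t ms ?g w + mop s t ((c, A0) # ms) ?g w = mop s t ((c, A0 + id_blinfun) # ms) ?g w"
    unfolding kernel_op_eq_split_sum split_sum_add[symmetric]
  proof (rule split_sum_cong)
    fix \<alpha> \<beta>
    let ?a = "nths w \<alpha>" and ?b = "nths w \<beta>" and ?x = "nths w ({..<length w} - \<alpha>)"
    have ab: "c \<notin> set ?a" "c \<notin> set ?b" using c(1) by (auto dest: in_set_nthsD)
    have eq: "mker s t ((c, A0 + id_blinfun) # ms) ?a ?b v = mker s t ms ?a ?b v + mker s t ((c, A0) # ms) ?a ?b v"
      if "c \<notin> set v" for v
    proof -
      have "c \<notin> fst ` set (ms @ map (\<lambda>r. (r, A1)) ?a @ map (\<lambda>r. (r, A0)) ?b @ map (\<lambda>r. (r, Am)) v)"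
        using c(2) ab that by auto
      from tprod_mark_id[OF this st] show ?thesis
        unfolding marked_kernel_def append_Cons tprod_mark_add by simp
    qed
    \<comment> \<open>The identity can be inserted only at a time that is not among the points of
      \<open>v\<close>; the exceptional \<open>v\<close> form a null set.\<close>
    have "AE v in conf_measure. blinfun_apply (mker s t ((c, A0 + id_blinfun) # ms) ?a ?b v) (?g (?x @ v))
        = blinfun_apply (mker s t ms ?a ?b v) (?g (?x @ v)) + blinfun_apply (mker s t ((c, A0) # ms) ?a ?b v) (?g (?x @ v))"
      using AE_conf_avoids[of c] by eventually_elim (simp add: eq blinfun.add_left)
    note [measurable] = bfun_measurable[OF g]
    have "(LINT v|conf_measure. blinfun_apply (mker s t ((c, A0 + id_blinfun) # ms) ?a ?b v) (?g (?x @ v)))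
        = (LINT v|conf_measure. blinfun_apply (mker s t ms ?a ?b v) (?g (?x @ v)) + blinfun_apply (mker s t ((c, A0) # ms) ?a ?b v) (?g (?x @ v)))"
      by (rule integral_cong_AE) (measurable, fact)
    then show "(LINT v|conf_measure. blinfun_apply (mker s t ms ?a ?b v) (?g (?x @ v)))
        + (LINT v|conf_measure. blinfun_apply (mker s t ((c, A0) # ms) ?a ?b v) (?g (?x @ v)))
        = (LINT v|conf_measure. blinfun_apply (mker s t ((c, A0 + id_blinfun) # ms) ?a ?b v) (?g (?x @ v)))"
      using integrable_mker_bfun[OF le g'] by simp
  qed
  then show ?thesis
    unfolding mop_snoc_eq[OF le g] by (simp add: add.commute)
qed

end

section \<open>Composition of evolutions at a mark\<close>

lemma integral_conf_split_set:
  fixes f :: "real list \<Rightarrow> 'b::{banach, second_countable_topology}"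
  assumes f: "integrable conf_measure f" and [measurable]: "A \<in> sets borel" and sym: "symmetric f"
  shows "(LINT w|conf_measure. f w) = (LINT b|conf_measure. (LINT a|conf_measure.
    (indicator {w. set w \<subseteq> A} a * indicator {w. set w \<subseteq> - A} b) *\<^sub>R f (a @ b)))"
proof -
  have [measurable]: "f \<in> borel_measurable conf_measure" using f by simp
  let ?MM = "conf_measure \<Otimes>\<^sub>M conf_measure"
  let ?i = "\<lambda>z. indicator {w. set w \<subseteq> A} (fst z) * indicator {w. set w \<subseteq> - A} (snd z) :: real"
  let ?T = "\<lambda>z. f (fst z @ snd z)"
  let ?N = "density ?MM (\<lambda>z. ennreal (?i z))"
  have i [measurable]: "?i \<in> borel_measurable ?MM" by measurable
  have T: "?T \<in> borel_measurable ?MM" by measurable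
  then have T': "?T \<in> borel_measurable ?N" by simp
  \<comment> \<open>Applied to indicators, the splitting formula for nonnegative functions says that
    \<open>f\<close> and the map from (a, b) to \<open>f (a @ b)\<close>, the latter under the
    restricted product measure, have the same distribution. Integrability and the Bochner integral
    depend on the distribution only.\<close>
  have distr: "distr conf_measure borel f = distr ?N borel ?T"
  proof (rule measure_eqI)
    fix S assume "S \<in> sets (distr conf_measure borel f)"
    then have S [measurable]: "S \<in> sets borel" by simp
    have "emeasure (distr conf_measure borel f) S = (\<integral>\<^sup>+w. indicator S (f w) \<partial>conf_measure)"
      using S by (simp flip: nn_integral_indicator add: nn_integral_distr)
    also have "\<dots> = (\<integral>\<^sup>+a. (\<integral>\<^sup>+b. indicator S (f (a @ b)) * indicator {w. set w \<subseteq> - A} b \<partial>conf_measure)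
        * indicator {w. set w \<subseteq> A} a \<partial>conf_measure)"
    proof (rule nn_integral_conf_split_set)
      show "symmetric (\<lambda>w. indicator S (f w) :: ennreal)"
        unfolding symmetric_def using symmetricD[OF sym] by metis
    qed measurable
    also have "\<dots> = (\<integral>\<^sup>+a. (\<integral>\<^sup>+b. ennreal (?i (a, b)) * indicator S (?T (a, b)) \<partial>conf_measure) \<partial>conf_measure)"
      by (auto intro!: nn_integral_cong split: split_indicator)
    also have "\<dots> = (\<integral>\<^sup>+z. ennreal (?i z) * indicator S (?T z) \<partial>?MM)"
      by (rule conf.nn_integral_fst) measurable
    also have "\<dots> = (\<integral>\<^sup>+z. indicator S (?T z) \<partial>?N)"
      by (subst nn_integral_density) auto
    also have "\<dots> = emeasure (distr ?N borel ?T) S"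
      using S T' by (simp flip: nn_integral_indicator add: nn_integral_distr)
    finally show "emeasure (distr conf_measure borel f) S = emeasure (distr ?N borel ?T) S" .
  qed simp
  have "integrable (distr conf_measure borel f) (\<lambda>x. x)"
    using f by (subst integrable_distr_eq) auto
  then have "integrable ?N ?T"
    unfolding distr using T' by (subst (asm) integrable_distr_eq) auto
  then have int: "integrable ?MM (\<lambda>z. ?i z *\<^sub>R ?T z)"
    using integrable_density[OF T i] by (auto split: split_indicator)
  have "(LINT w|conf_measure. f w) = (LINT x|distr conf_measure borel f. x)"
    by (subst integral_distr) auto
  also have "\<dots> = (LINT z|?N. ?T z)"
    unfolding distr using T' by (subst integral_distr) auto
  also have "\<dots> = (LINT z|?MM. ?i z *\<^sub>R ?T z)"
    using T by (subst integral_density) auto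
  also have "\<dots> = (LINT b|conf_measure. (LINT a|conf_measure. ?i (a, b) *\<^sub>R ?T (a, b)))"
    using conf_conf.integral_snd[of "\<lambda>a b. ?i (a, b) *\<^sub>R ?T (a, b)"] int
    by (simp add: split_beta' del: scaleR_conv_of_real)
  finally show ?thesis by simp
qed

context evolution_kernel
begin

text \<open>The first stage of a composed evolution must yield an admissible function of the points
  that are still to be processed. For all \<open>v2\<close> the functions sending v1 to
  \<open>g (v1 @ v2)\<close> obey one bound, so \<open>mop_bounded\<close> gives a common
  constant.\<close>

lemma mop_append_bfun:
  fixes X :: "'k \<Rightarrow>\<^sub>L 'k"
  assumes st: "s \<le> t" and g: "g \<in> bfun"
  shows "(\<lambda>v2. blinfun_apply X (mop s t ms (\<lambda>v1. g (v1 @ v2)) w)) \<in> bfun"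
proof -
  obtain C R where C: "0 \<le> C" "\<And>w. norm (g w) \<le> C * indicator (conf_box R) w"
    using bfun_bound[OF g] by metis
  note [measurable] = bfun_measurable[OF g]
  obtain D where D: "0 \<le> D" "\<And>g' w'. g' \<in> borel_measurable conf_measure \<Longrightarrow>
      (\<And>v. norm (g' v) \<le> C * indicator (conf_box R) v) \<Longrightarrow> length w' \<le> length w \<Longrightarrow> norm (mop s t ms g' w') \<le> D"
    using mop_bounded[OF st C(1), of R "length w" ms] by blast
  show ?thesis
  proof (rule bfunI)
    have "(\<lambda>v2. (w, v2)) \<in> conf_measure \<rightarrow>\<^sub>M conf_measure \<Otimes>\<^sub>M conf_measure" by measurable
    moreover have "(\<lambda>z. g (fst z @ snd z)) \<in> borel_measurable (conf_measure \<Otimes>\<^sub>M conf_measure)" by measurable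
    ultimately have "(\<lambda>v2. mop s t ms (\<lambda>v1. g (v1 @ v2)) w) \<in> borel_measurable conf_measure"
      using measurable_compose[OF _ borel_measurable_mop_param, of "\<lambda>v2. (w, v2)" _ _ "\<lambda>z. g (fst z @ snd z)"]
      by simp
    then show "(\<lambda>v2. blinfun_apply X (mop s t ms (\<lambda>v1. g (v1 @ v2)) w)) \<in> borel_measurable conf_measure"
      by (rule borel_measurable_blinfun_apply_const)
    show "symmetric (\<lambda>v2. blinfun_apply X (mop s t ms (\<lambda>v1. g (v1 @ v2)) w))"
      unfolding symmetric_def
    proof (intro allI impI)
      fix v v' :: "real list" assume "mset v = mset v'"
      then have "(\<lambda>v1. g (v1 @ v)) = (\<lambda>v1. g (v1 @ v'))"
        by (intro ext symmetricD[OF bfun_symmetric[OF g]]) simp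
      then show "blinfun_apply X (mop s t ms (\<lambda>v1. g (v1 @ v)) w) = blinfun_apply X (mop s t ms (\<lambda>v1. g (v1 @ v')) w)"
        by simp
    qed
    show "norm (blinfun_apply X (mop s t ms (\<lambda>v1. g (v1 @ v2)) w)) \<le> (norm X * D) * indicator (conf_box R) v2" for v2
    proof (cases "v2 \<in> conf_box R")
      case True
      have "norm (mop s t ms (\<lambda>v1. g (v1 @ v2)) w) \<le> D"
      proof (rule D(2))
        show "norm (g (v @ v2)) \<le> C * indicator (conf_box R) v" for v
          using C(2)[of "v @ v2"] mult_left_mono[OF indicator_conf_box_append(1)[of R v v2] C(1)] by linarith
      qed simp_all
      then have "norm X * norm (mop s t ms (\<lambda>v1. g (v1 @ v2)) w) \<le> norm X * D"
        by (intro mult_left_mono) auto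
      then show ?thesis
        using norm_blinfun[of X "mop s t ms (\<lambda>v1. g (v1 @ v2)) w"] True by simp
    next
      case False
      then have "g (v1 @ v2) = 0" for v1
        using C(2)[of "v1 @ v2"] conf_box_appendD(2)[of v1 v2 R] by (auto split: split_indicator_asm)
      then show ?thesis using False by (simp add: blinfun.zero_right)
    qed
  qed
qed

text \<open>The cocycle property for the empty argument. The integration variable is split into its
  points before and after \<open>c\<close>, and the kernel factorises by \<open>tprod_mark\<close>.
  Where points lie on the wrong side, both integrands vanish.\<close>

lemma mop_compose_Nil:
  assumes st: "s < c" "c < t" and g: "g \<in> bfun"
    and ms: "\<And>z. z \<in> set ms1 \<Longrightarrow> fst z < c" "\<And>z. z \<in> set ms2 \<Longrightarrow> c < fst z"
  shows "mop s t (ms1 @ (c, X) # ms2) g []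
    = mop c t ms2 (\<lambda>v2. blinfun_apply X (mop s c ms1 (\<lambda>v1. g (v1 @ v2)) [])) []"
proof -
  let ?k = "\<lambda>v. blinfun_apply (mker s t (ms1 @ (c, X) # ms2) [] [] v) (g v)"
  let ?A = "{..<c}"
  let ?i = "\<lambda>a b. indicator {w. set w \<subseteq> ?A} a * indicator {w. set w \<subseteq> - ?A} b :: real"
  have le: "s \<le> t" "s \<le> c" using st by auto
  have "mop s t (ms1 @ (c, X) # ms2) g [] = (LINT v|conf_measure. ?k v)"
    by (rule mop_Nil)
  also have "\<dots> = (LINT b|conf_measure. (LINT a|conf_measure. ?i a b *\<^sub>R ?k (a @ b)))"
  proof (rule integral_conf_split_set)
    show "integrable conf_measure ?k"
      using integrable_mker_bfun[OF le(1) g, of "ms1 @ (c, X) # ms2" "[]" "[]" "[]"] by simp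
    show "symmetric ?k"
      unfolding symmetric_def
      by (auto intro!: arg_cong2[where f = blinfun_apply] mker_perm symmetricD[OF bfun_symmetric[OF g]])
  qed simp
  also have "\<dots> = (LINT b|conf_measure. blinfun_apply (mker c t ms2 [] [] b)
      (blinfun_apply X (LINT a|conf_measure. blinfun_apply (mker s c ms1 [] [] a) (g (a @ b)))))"
  proof (rule integral_cong_AE)
    have 1: "(LINT a|conf_measure. ?i a b *\<^sub>R ?k (a @ b)) = blinfun_apply (mker c t ms2 [] [] b)
      (blinfun_apply X (LINT a|conf_measure. blinfun_apply (mker s c ms1 [] [] a) (g (a @ b))))"
      if c: "c \<notin> set b" for b
    proof (cases "set b \<subseteq> {c<..}")
      case True
      then have b: "set b \<subseteq> - ?A" by auto
      have "?i a b *\<^sub>R ?k (a @ b) = blinfun_apply (mker c t ms2 [] [] b)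
        (blinfun_apply X (blinfun_apply (mker s c ms1 [] [] a) (g (a @ b))))" for a
      proof (cases "set a \<subseteq> ?A")
        case True
        let ?l = "map (\<lambda>r. (r, Am))"
        have "tprod B s t ((ms1 @ (c, X) # ms2) @ ?l (a @ b)) = tprod B s t ((ms1 @ ?l a) @ (c, X) # (ms2 @ ?l b))"
          by (rule tprod_perm) simp
        also have "\<dots> = tprod B c t (ms2 @ ?l b) o\<^sub>L (X o\<^sub>L tprod B s c (ms1 @ ?l a))"
          using True \<open>set b \<subseteq> {c<..}\<close> ms st by (intro tprod_mark) auto
        finally show ?thesis
          using True b by (simp add: marked_kernel_def)
      next
        case False
        then obtain r where r: "r \<in> set a" "c \<le> r" by (meson lessThan_iff not_le subsetI)
        have "mker s c ms1 [] [] a = 0"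
          unfolding marked_kernel_def by (rule tprod_eq_0, rule disjI2, rule bexI[of _ "(r, Am)"]) (use r in auto)
        then show ?thesis using False by (simp add: blinfun.zero_right)
      qed
      then have "(LINT a|conf_measure. ?i a b *\<^sub>R ?k (a @ b)) = (LINT a|conf_measure.
          blinfun_apply (mker c t ms2 [] [] b o\<^sub>L X) (blinfun_apply (mker s c ms1 [] [] a) (g (a @ b))))"
        by simp
      also have "\<dots> = blinfun_apply (mker c t ms2 [] [] b o\<^sub>L X) (LINT a|conf_measure. blinfun_apply (mker s c ms1 [] [] a) (g (a @ b)))"
        using integrable_mker_bfun[OF le(2) bfun_append[OF g], of ms1 "[]" "[]" "[]" b]
        by (intro integral_bounded_linear blinfun.bounded_linear_right) simp
      finally show ?thesis by simp
    next
      case False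
      then obtain r where r: "r \<in> set b" "r \<le> c" by (meson greaterThan_iff not_le subsetI)
      then have "r < c" using c by (cases "r = c") auto
      then have i: "?i a b *\<^sub>R ?k (a @ b) = 0" for a using r by (auto split: split_indicator)
      have "mker c t ms2 [] [] b = 0"
        unfolding marked_kernel_def by (rule tprod_eq_0, rule disjI2, rule bexI[of _ "(r, Am)"]) (use r in auto)
      then show ?thesis unfolding i by simp
    qed
    show "AE b in conf_measure. (LINT a|conf_measure. ?i a b *\<^sub>R ?k (a @ b)) = blinfun_apply (mker c t ms2 [] [] b)
      (blinfun_apply X (LINT a|conf_measure. blinfun_apply (mker s c ms1 [] [] a) (g (a @ b))))"
      using AE_conf_avoids[of c] by eventually_elim (rule 1)
    note [measurable] = bfun_measurable[OF g]
    show "(\<lambda>b. LINT a|conf_measure. ?i a b *\<^sub>R ?k (a @ b)) \<in> borel_measurable conf_measure"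
      by (rule conf.borel_measurable_lebesgue_integral) measurable
    have "(\<lambda>b. LINT a|conf_measure. blinfun_apply (mker s c ms1 [] [] a) (g (a @ b))) \<in> borel_measurable conf_measure"
      by (rule conf.borel_measurable_lebesgue_integral) measurable
    from borel_measurable_blinfun_apply_const[OF this, of X]
    show "(\<lambda>b. blinfun_apply (mker c t ms2 [] [] b)
      (blinfun_apply X (LINT a|conf_measure. blinfun_apply (mker s c ms1 [] [] a) (g (a @ b))))) \<in> borel_measurable conf_measure"
      by (intro borel_measurable_mker_apply) measurable
  qed
  finally show ?thesis by (simp add: mop_Nil)
qed

text \<open>Points of the argument are traded for marks by \<open>mop_snoc_in\<close>, on both sides
  of the equation, until the argument is empty. Here they lie before \<open>c\<close> and enter the
  first evolution.\<close>

lemma mop_compose_left: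
  assumes st: "s < c" "c < t" and g: "g \<in> bfun"
    and ms: "\<And>z. z \<in> set ms1 \<Longrightarrow> fst z < c" "\<And>z. z \<in> set ms2 \<Longrightarrow> c < fst z"
    and w: "set w \<subseteq> {s<..<c}" "distinct w" "set w \<inter> fst ` set ms1 = {}"
  shows "mop s t (ms1 @ (c, X) # ms2) g w
    = mop c t ms2 (\<lambda>v2. blinfun_apply X (mop s c ms1 (\<lambda>v1. g (v1 @ v2)) w)) []"
  using g ms(1) w
proof (induction w arbitrary: g ms1 rule: rev_induct)
  case Nil
  then show ?case using ms(2) by (intro mop_compose_Nil[OF st]) auto
next
  case (snoc r w)
  let ?ms = "ms1 @ (c, X) # ms2" and ?Y = "A0 + id_blinfun"
  let ?g = "\<lambda>v. g (v @ [r])"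
  note g = snoc.prems(1)
  have g': "?g \<in> bfun" by (rule bfun_append[OF g])
  have r: "s < r" "r < c" "r < t" "r \<notin> set w" "r \<notin> fst ` set ms1" "s \<le> t" "s \<le> c" "c \<le> t"
    using snoc.prems st by auto
  have r2: "r \<notin> fst ` set ?ms" using r ms(2) by force
  have perm: "mop s t ((r, Z) # ?ms) = mop s t (((r, Z) # ms1) @ (c, X) # ms2)" for Z by simp
  let ?h = "\<lambda>Z g v2. blinfun_apply X (mop s c ((r, Z) # ms1) (\<lambda>v1. g (v1 @ v2)) w)"
  have "mop s t ?ms g (w @ [r]) = mop s t ((r, A1) # ?ms) g w + mop s t ((r, ?Y) # ?ms) ?g w"
    by (rule mop_snoc_in[OF r(1,3) g r(4) r2])
  also have "\<dots> = mop c t ms2 (?h A1 g) [] + mop c t ms2 (?h ?Y ?g) []"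
    unfolding perm using snoc.prems r
    by (intro arg_cong2[where f = "(+)"] snoc.IH g g') auto
  also have "\<dots> = mop c t ms2 (\<lambda>v2. ?h A1 g v2 + ?h ?Y ?g v2) []"
    by (rule mop_add[symmetric]) (intro mop_append_bfun g g' r)+
  also have "(\<lambda>v2. ?h A1 g v2 + ?h ?Y ?g v2) = (\<lambda>v2. blinfun_apply X (mop s c ms1 (\<lambda>v1. g (v1 @ v2)) (w @ [r])))"
  proof
    fix v2
    have sym: "g ((v @ [r]) @ v2) = g ((v @ v2) @ [r])" for v
      by (rule symmetricD[OF bfun_symmetric[OF g]]) simp
    show "?h A1 g v2 + ?h ?Y ?g v2 = blinfun_apply X (mop s c ms1 (\<lambda>v1. g (v1 @ v2)) (w @ [r]))"
      unfolding mop_snoc_in[OF r(1,2) bfun_append[OF g] r(4,5)] sym by (simp add: blinfun.add_right)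
  qed
  finally show ?case .
qed

text \<open>The same exchange of points for marks, now for points after \<open>c\<close>, whose
  marks enter the second evolution.\<close>

lemma mop_compose:
  assumes st: "s < c" "c < t" and g: "g \<in> bfun"
    and ms: "\<And>z. z \<in> set ms1 \<Longrightarrow> fst z < c" "\<And>z. z \<in> set ms2 \<Longrightarrow> c < fst z"
    and w1: "set w1 \<subseteq> {s<..<c}" "distinct w1" "set w1 \<inter> fst ` set ms1 = {}"
    and w2: "set w2 \<subseteq> {c<..<t}" "distinct w2" "set w2 \<inter> fst ` set ms2 = {}"
  shows "mop s t (ms1 @ (c, X) # ms2) g (w1 @ w2)
    = mop c t ms2 (\<lambda>v2. blinfun_apply X (mop s c ms1 (\<lambda>v1. g (v1 @ v2)) w1)) w2"
  using g ms(2) w2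
proof (induction w2 arbitrary: g ms2 rule: rev_induct)
  case Nil
  then show ?case using ms(1) w1 by (simp add: mop_compose_left[OF st])
next
  case (snoc r w2)
  let ?ms = "ms1 @ (c, X) # ms2" and ?Y = "A0 + id_blinfun"
  let ?g = "\<lambda>v. g (v @ [r])"
  note g = snoc.prems(1)
  have g': "?g \<in> bfun" by (rule bfun_append[OF g])
  have r: "s < r" "c < r" "r < t" "r \<notin> set (w1 @ w2)" "r \<notin> fst ` set ms2" "r \<notin> set w2" "s \<le> c"
    using snoc.prems st w1(1) by auto
  have r2: "r \<notin> fst ` set ?ms" using r ms(1) by force
  have perm: "mop s t ((r, Z) # ?ms) = mop s t (ms1 @ (c, X) # (r, Z) # ms2)" for Z
    by (rule mop_perm) simp
  let ?h = "\<lambda>g v2. blinfun_apply X (mop s c ms1 (\<lambda>v1. g (v1 @ v2)) w1)"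
  have "mop s t ?ms g (w1 @ w2 @ [r]) = mop s t ((r, A1) # ?ms) g (w1 @ w2) + mop s t ((r, ?Y) # ?ms) ?g (w1 @ w2)"
    using mop_snoc_in[OF r(1,3) g r(4) r2] by simp
  also have "\<dots> = mop c t ((r, A1) # ms2) (?h g) w2 + mop c t ((r, ?Y) # ms2) (?h ?g) w2"
    unfolding perm using snoc.prems r
    by (intro arg_cong2[where f = "(+)"] snoc.IH g g') auto
  also have "?h ?g = (\<lambda>v. ?h g (v @ [r]))" by simp
  also have "mop c t ((r, A1) # ms2) (?h g) w2 + mop c t ((r, ?Y) # ms2) (\<lambda>v. ?h g (v @ [r])) w2 = mop c t ms2 (?h g) (w2 @ [r])"
    by (rule mop_snoc_in[OF r(2,3) mop_append_bfun[OF r(7) g] r(6,5), symmetric])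
  finally show ?case .
qed

lemma mop_append_out:
  assumes "s \<le> t" "g \<in> bfun" "set b \<inter> {s<..<t} = {}"
  shows "mop s t ms g (a @ b) = mop s t ms (\<lambda>v. g (v @ b)) a"
  using assms(2,3)
proof (induction b arbitrary: g rule: rev_induct)
  case (snoc r b)
  have "mop s t ms g (a @ b @ [r]) = mop s t ms (\<lambda>v. g (v @ [r])) (a @ b)"
    using mop_snoc_out[OF assms(1) snoc.prems(1), of r ms "a @ b"] snoc.prems(2) by (auto simp: not_less)
  also have "\<dots> = mop s t ms (\<lambda>v. g (v @ b @ [r])) a"
    using snoc.IH[OF bfun_append[OF snoc.prems(1)], of "[r]"] snoc.prems(2) by simp
  finally show ?case by simp
qed simp

end

section \<open>Contractions\<close>

lemma nn_integral_conf_split_interval: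
  fixes F :: "real list \<Rightarrow> ennreal"
  assumes st: "s < c" "c < t" and [measurable]: "F \<in> borel_measurable conf_measure" and sym: "symmetric F"
  shows "(\<integral>\<^sup>+w. indicator {w. set w \<subseteq> {s<..<t}} w * F w \<partial>conf_measure)
    = (\<integral>\<^sup>+a. indicator {w. set w \<subseteq> {s<..<c}} a * (\<integral>\<^sup>+b. indicator {w. set w \<subseteq> {c<..<t}} b * F (a @ b) \<partial>conf_measure) \<partial>conf_measure)"
proof -
  let ?F = "\<lambda>w. indicator {w. set w \<subseteq> {s<..<t}} w * F w"
  have "(\<integral>\<^sup>+w. ?F w \<partial>conf_measure) = (\<integral>\<^sup>+a. (\<integral>\<^sup>+b. ?F (a @ b) * indicator {w. set w \<subseteq> - {..<c}} b \<partial>conf_measure)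
      * indicator {w. set w \<subseteq> {..<c}} a \<partial>conf_measure)"
  proof (rule nn_integral_conf_split_set)
    show "symmetric ?F"
      unfolding symmetric_def
    proof (intro allI impI)
      fix v w :: "real list" assume vw: "mset v = mset w"
      show "?F v = ?F w"
        using mset_eq_setD[OF vw] symmetricD[OF sym vw] by (simp add: indicator_def)
    qed
  qed measurable
  also have "\<dots> = (\<integral>\<^sup>+a. indicator {w. set w \<subseteq> {s<..<c}} a * (\<integral>\<^sup>+b. indicator {w. set w \<subseteq> {c<..<t}} b * F (a @ b) \<partial>conf_measure) \<partial>conf_measure)"
  proof (rule nn_integral_cong)
    fix a :: "real list"
    show "(\<integral>\<^sup>+b. ?F (a @ b) * indicator {w. set w \<subseteq> - {..<c}} b \<partial>conf_measure) * indicator {w. set w \<subseteq> {..<c}} a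
      = indicator {w. set w \<subseteq> {s<..<c}} a * (\<integral>\<^sup>+b. indicator {w. set w \<subseteq> {c<..<t}} b * F (a @ b) \<partial>conf_measure)"
    proof (cases "set a \<subseteq> {s<..<c}")
      case True
      then have a: "set a \<subseteq> {..<c}" "set a \<subseteq> {s<..<t}" using st by auto
      have "(\<integral>\<^sup>+b. ?F (a @ b) * indicator {w. set w \<subseteq> - {..<c}} b \<partial>conf_measure)
        = (\<integral>\<^sup>+b. indicator {w. set w \<subseteq> {c<..<t}} b * F (a @ b) \<partial>conf_measure)"
      \<comment> \<open>The two halves of the splitting overlap in the wrong way only at
        \<open>c\<close> itself, and configurations that contain \<open>c\<close> form a null
        set.\<close>
      proof (rule nn_integral_cong_AE, use AE_conf_avoids[of c] in eventually_elim)
        fix b :: "real list" assume "c \<notin> set b"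
        then have "set b \<subseteq> {s<..<t} \<and> set b \<subseteq> - {..<c} \<longleftrightarrow> set b \<subseteq> {c<..<t}"
          using st by (auto simp: subset_iff not_less le_less)
        then show "?F (a @ b) * indicator {w. set w \<subseteq> - {..<c}} b = indicator {w. set w \<subseteq> {c<..<t}} b * F (a @ b)"
          using a by (auto simp: indicator_def)
      qed
      then show ?thesis using True a by simp
    next
      case False
      have "\<not> (set a \<subseteq> {s<..<t} \<and> set a \<subseteq> {..<c})"
        using False by (auto simp: subset_iff)
      then consider "\<not> set a \<subseteq> {..<c}" | "\<And>b. ?F (a @ b) = 0"
        by (auto simp: indicator_def)
      then have "(\<integral>\<^sup>+b. ?F (a @ b) * indicator {w. set w \<subseteq> - {..<c}} b \<partial>conf_measure) * indicator {w. set w \<subseteq> {..<c}} a = 0"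
      proof cases
        case 2
        then show ?thesis by (simp only: mult_zero_left nn_integral_const)
      qed simp
      then show ?thesis using False by simp
    qed
  qed
  finally show ?thesis .
qed

lemma nn_integral_conf_swap:
  fixes F :: "real list \<Rightarrow> real list \<Rightarrow> ennreal"
  assumes "(\<lambda>z. F (fst z) (snd z)) \<in> borel_measurable (conf_measure \<Otimes>\<^sub>M conf_measure)"
    and [measurable]: "p \<in> borel_measurable conf_measure" "q \<in> borel_measurable conf_measure"
  shows "(\<integral>\<^sup>+a. p a * (\<integral>\<^sup>+b. q b * F a b \<partial>conf_measure) \<partial>conf_measure)
    = (\<integral>\<^sup>+b. q b * (\<integral>\<^sup>+a. p a * F a b \<partial>conf_measure) \<partial>conf_measure)"
proof -
  have 1: "(\<lambda>(a, b). F a b) \<in> borel_measurable (conf_measure \<Otimes>\<^sub>M conf_measure)"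
    using assms(1) by (simp add: split_beta')
  note [measurable] = 1
  have Fb: "(\<lambda>b. F a b) \<in> borel_measurable conf_measure" for a
    using measurable_compose[OF measurable_Pair1' 1, of a] by simp
  have Fa: "(\<lambda>a. F a b) \<in> borel_measurable conf_measure" for b
    using measurable_compose[OF measurable_Pair2' 1, of b] by simp
  have "(\<integral>\<^sup>+a. p a * (\<integral>\<^sup>+b. q b * F a b \<partial>conf_measure) \<partial>conf_measure)
      = (\<integral>\<^sup>+a. (\<integral>\<^sup>+b. p a * (q b * F a b) \<partial>conf_measure) \<partial>conf_measure)"
    using Fb by (intro nn_integral_cong nn_integral_cmult[symmetric]) measurable
  also have "\<dots> = (\<integral>\<^sup>+b. (\<integral>\<^sup>+a. p a * (q b * F a b) \<partial>conf_measure) \<partial>conf_measure)"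
    by (rule conf_conf.Fubini'[symmetric]) measurable
  also have "\<dots> = (\<integral>\<^sup>+b. (\<integral>\<^sup>+a. q b * (p a * F a b) \<partial>conf_measure) \<partial>conf_measure)"
    by (simp only: mult.left_commute)
  also have "\<dots> = (\<integral>\<^sup>+b. q b * (\<integral>\<^sup>+a. p a * F a b \<partial>conf_measure) \<partial>conf_measure)"
    using Fa by (intro nn_integral_cong nn_integral_cmult) measurable
  finally show ?thesis .
qed

abbreviation sqn :: "'k::complex_hilbert \<Rightarrow> ennreal" where
  "sqn x \<equiv> ennreal ((norm x)\<^sup>2)"

lemma symmetric_sqn: "symmetric f \<Longrightarrow> symmetric (\<lambda>w. sqn (f w))"
  by (subst symmetric_def) (metis symmetricD)

lemma sqn_blinfun: "norm X \<le> K \<Longrightarrow> sqn (blinfun_apply X x) \<le> ennreal (K\<^sup>2) * sqn x"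
proof -
  assume K: "norm X \<le> K"
  have "norm (blinfun_apply X x) \<le> K * norm x"
    using norm_blinfun[of X x] mult_right_mono[OF K, of "norm x"] by simp
  then have "(norm (blinfun_apply X x))\<^sup>2 \<le> K\<^sup>2 * (norm x)\<^sup>2"
    by (metis norm_ge_zero power_mono power_mult_distrib)
  then show ?thesis
    by (simp add: ennreal_leI flip: ennreal_mult)
qed

text \<open>Contractivity is what the bounds below need to know about the evolution besides its
  kernel. As an assumption of the locale it serves both the forward evolution and the reflected
  adjoint.\<close>

locale contraction_kernel = evolution_kernel +
  assumes contr: "s < t \<Longrightarrow> g \<in> bfun \<Longrightarrow>
    (\<integral>\<^sup>+w. sqn (mop s t [] g w) \<partial>conf_measure) \<le> (\<integral>\<^sup>+w. sqn (g w) \<partial>conf_measure)"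
begin

text \<open>The kernel vanishes as soon as \<open>v\<close> has a point outside of the interval, and
  the remaining points of the argument of \<open>g\<close> come from \<open>w\<close>.\<close>

lemma mop_restrict:
  assumes w: "set w \<subseteq> {s<..<t}"
  shows "mop s t ms g w = mop s t ms (\<lambda>v. indicator {v. set v \<subseteq> {s<..<t}} v *\<^sub>R g v) w"
  unfolding kernel_op_eq_split_sum
proof (intro split_sum_cong Bochner_Integration.integral_cong refl)
  fix \<alpha> \<beta> v
  show "blinfun_apply (mker s t ms (nths w \<alpha>) (nths w \<beta>) v) (g (nths w ({..<length w} - \<alpha>) @ v)) =
    blinfun_apply (mker s t ms (nths w \<alpha>) (nths w \<beta>) v)
      (indicator {v. set v \<subseteq> {s<..<t}} (nths w ({..<length w} - \<alpha>) @ v) *\<^sub>R g (nths w ({..<length w} - \<alpha>) @ v))"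
  proof (cases "set v \<subseteq> {s<..<t}")
    case True
    then have "set (nths w ({..<length w} - \<alpha>) @ v) \<subseteq> {s<..<t}"
      using w set_nths_subset[of w] by auto
    then show ?thesis by simp
  next
    case False
    then obtain r where r: "r \<in> set v" "r \<le> s \<or> t \<le> r"
      by (meson greaterThanLessThan_iff not_le subsetI)
    have "mker s t ms (nths w \<alpha>) (nths w \<beta>) v = 0"
      unfolding marked_kernel_def by (rule tprod_eq_0, rule disjI2, rule bexI[of _ "(r, Am)"]) (use r in auto)
    then show ?thesis by simp
  qed
qed

text \<open>Contractivity is applied to \<open>g\<close> cut off outside of the interval, which does
  not change the left side.\<close>

lemma contr_interval:
  assumes st: "s < t" and g: "g \<in> bfun"
  shows "(\<integral>\<^sup>+w. indicator {w. set w \<subseteq> {s<..<t}} w * sqn (mop s t [] g w) \<partial>conf_measure)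
    \<le> (\<integral>\<^sup>+w. indicator {w. set w \<subseteq> {s<..<t}} w * sqn (g w) \<partial>conf_measure)"
proof -
  let ?i = "indicator {w. set w \<subseteq> {s<..<t}}"
  let ?g = "\<lambda>v. ?i v *\<^sub>R g v"
  note [measurable] = bfun_measurable[OF g]
  obtain C R where C: "0 \<le> C" "\<And>w. norm (g w) \<le> C * indicator (conf_box R) w"
    using bfun_bound[OF g] by metis
  have g': "?g \<in> bfun"
  proof (rule bfunI)
    show "symmetric ?g"
      unfolding symmetric_def
    proof (intro allI impI)
      fix v w :: "real list" assume vw: "mset v = mset w"
      show "?g v = ?g w"
        using mset_eq_setD[OF vw] symmetricD[OF bfun_symmetric[OF g] vw] by (simp add: indicator_def)
    qed
    show "norm (?g w) \<le> C * indicator (conf_box R) w" for w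
      using C(2)[of w] C(1) by (auto simp: indicator_def)
  qed measurable
  have "(\<integral>\<^sup>+w. ?i w * sqn (mop s t [] g w) \<partial>conf_measure) \<le> (\<integral>\<^sup>+w. sqn (mop s t [] ?g w) \<partial>conf_measure)"
    using mop_restrict[of _ s t "[]" g] by (intro nn_integral_mono) (auto simp: indicator_def)
  also have "\<dots> \<le> (\<integral>\<^sup>+w. sqn (?g w) \<partial>conf_measure)"
    by (rule contr[OF st g'])
  also have "\<dots> = (\<integral>\<^sup>+w. ?i w * sqn (g w) \<partial>conf_measure)"
    by (intro nn_integral_cong) (auto simp: indicator_def)
  finally show ?thesis .
qed

text \<open>The mark with the latest time is removed. After it there is an evolution without marks,
  a contraction in the later points; at it, one operator of norm at most \<open>K\<close>; before
  it, the induction hypothesis applies in the earlier points. Each mark costs a factor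
  \<open>K\<^sup>2\<close>.\<close>

lemma contr_marks_interval:
  assumes "s < t" "sorted_wrt (<) (map fst ms)" "\<And>z. z \<in> set ms \<Longrightarrow> s < fst z \<and> fst z < t \<and> norm (snd z) \<le> K"
    and K: "0 \<le> K" and "g \<in> bfun"
  shows "(\<integral>\<^sup>+w. indicator {w. set w \<subseteq> {s<..<t}} w * sqn (mop s t ms g w) \<partial>conf_measure)
    \<le> ennreal ((K\<^sup>2) ^ length ms) * (\<integral>\<^sup>+w. indicator {w. set w \<subseteq> {s<..<t}} w * sqn (g w) \<partial>conf_measure)"
  using assms(1-3,5)
proof (induction ms arbitrary: t g rule: rev_induct)
  case Nil
  then show ?case using contr_interval[of s t g] by simp
next
  case (snoc z ms)
  obtain c X where z: "z = (c, X)" by fastforce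
  have c: "s < c" "c < t" "norm X \<le> K" using snoc.prems(3)[of z] by (auto simp: z)
  have ms: "sorted_wrt (<) (map fst ms)" "\<And>z. z \<in> set ms \<Longrightarrow> s < fst z \<and> fst z < c \<and> norm (snd z) \<le> K"
    using snoc.prems(2,3) by (auto simp: z sorted_wrt_append)
  note g = snoc.prems(4)
  note [measurable] = bfun_measurable[OF g]
  let ?I = "indicator {w. set w \<subseteq> {s<..<c}} :: real list \<Rightarrow> ennreal"
    and ?J = "indicator {w. set w \<subseteq> {c<..<t}} :: real list \<Rightarrow> ennreal"
    and ?IJ = "indicator {w. set w \<subseteq> {s<..<t}} :: real list \<Rightarrow> ennreal"
  let ?f = "\<lambda>a b. mop s c ms (\<lambda>v. g (v @ b)) a"
  let ?h = "\<lambda>a b. blinfun_apply X (?f a b)"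
  have f: "(\<lambda>z. ?f (fst z) (snd z)) \<in> borel_measurable (conf_measure \<Otimes>\<^sub>M conf_measure)"
  proof -
    have "(\<lambda>z. g (fst z @ snd z)) \<in> borel_measurable (conf_measure \<Otimes>\<^sub>M conf_measure)" by measurable
    from borel_measurable_mop_param[OF this, of s c ms] show ?thesis by simp
  qed
  then have h: "(\<lambda>z. ?h (fst z) (snd z)) \<in> borel_measurable (conf_measure \<Otimes>\<^sub>M conf_measure)"
    by (rule borel_measurable_blinfun_apply_const)
  have "(\<integral>\<^sup>+w. ?IJ w * sqn (mop s t (ms @ [z]) g w) \<partial>conf_measure)
      = (\<integral>\<^sup>+a. ?I a * (\<integral>\<^sup>+b. ?J b * sqn (mop s t (ms @ [z]) g (a @ b)) \<partial>conf_measure) \<partial>conf_measure)"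
    using c by (intro nn_integral_conf_split_interval symmetric_sqn symmetric_mop bfun_symmetric g) measurable
  \<comment> \<open>For fixed earlier points \<open>a\<close>, contractivity is used in the later
    points \<open>b\<close>.\<close>
  also have "\<dots> \<le> (\<integral>\<^sup>+a. ?I a * (\<integral>\<^sup>+b. ?J b * sqn (?h a b) \<partial>conf_measure) \<partial>conf_measure)"
  proof (rule nn_integral_mono_AE)
    have "fst ` set ms \<in> null_sets lborel"
      by (intro finite_imp_null_set_lborel) simp
    from AE_conf_avoids_null[OF this] AE_conf_distinct
    show "AE a in conf_measure. ?I a * (\<integral>\<^sup>+b. ?J b * sqn (mop s t (ms @ [z]) g (a @ b)) \<partial>conf_measure)
        \<le> ?I a * (\<integral>\<^sup>+b. ?J b * sqn (?h a b) \<partial>conf_measure)"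
    proof eventually_elim
      case (elim a)
      show ?case
      proof (cases "set a \<subseteq> {s<..<c}")
        case True
        have "(\<integral>\<^sup>+b. ?J b * sqn (mop s t (ms @ [z]) g (a @ b)) \<partial>conf_measure)
            = (\<integral>\<^sup>+b. ?J b * sqn (mop c t [] (?h a) b) \<partial>conf_measure)"
        proof (rule nn_integral_cong_AE, use AE_conf_distinct in eventually_elim)
          case (elim b)
          show ?case
          proof (cases "set b \<subseteq> {c<..<t}")
            case True
            have "mop s t (ms @ (c, X) # []) g (a @ b) = mop c t [] (?h a) b"
              using c g ms True \<open>set a \<subseteq> {s<..<c}\<close> \<open>distinct a\<close> \<open>set a \<inter> fst ` set ms = {}\<close> elim
              by (intro mop_compose) auto
            then show ?thesis by (simp add: z)
          qed simp
        qed
        also have "\<dots> \<le> (\<integral>\<^sup>+b. ?J b * sqn (?h a b) \<partial>conf_measure)"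
          using c by (intro contr_interval mop_append_bfun g) auto
        finally show ?thesis by (rule mult_left_mono) simp
      qed simp
    qed
  qed
  also have "\<dots> = (\<integral>\<^sup>+b. ?J b * (\<integral>\<^sup>+a. ?I a * sqn (?h a b) \<partial>conf_measure) \<partial>conf_measure)"
    by (intro nn_integral_conf_swap) (use h in measurable)
  \<comment> \<open>For fixed later points \<open>b\<close>, the operator \<open>X\<close> and then
    the remaining marks are estimated in the earlier points \<open>a\<close>.\<close>
  also have "\<dots> \<le> (\<integral>\<^sup>+b. ?J b * (ennreal (K\<^sup>2) * (ennreal ((K\<^sup>2) ^ length ms) * (\<integral>\<^sup>+a. ?I a * sqn (g (a @ b)) \<partial>conf_measure))) \<partial>conf_measure)"
  proof (intro nn_integral_mono mult_left_mono)
    fix b :: "real list"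
    have fb: "(\<lambda>a. ?f a b) \<in> borel_measurable conf_measure"
      by (intro borel_measurable_mop) measurable
    have "(\<integral>\<^sup>+a. ?I a * sqn (?h a b) \<partial>conf_measure) \<le> (\<integral>\<^sup>+a. ennreal (K\<^sup>2) * (?I a * sqn (?f a b)) \<partial>conf_measure)"
      using sqn_blinfun[OF c(3)] by (intro nn_integral_mono) (auto simp: indicator_def)
    also have "\<dots> = ennreal (K\<^sup>2) * (\<integral>\<^sup>+a. ?I a * sqn (?f a b) \<partial>conf_measure)"
      using fb by (intro nn_integral_cmult) measurable
    also have "\<dots> \<le> ennreal (K\<^sup>2) * (ennreal ((K\<^sup>2) ^ length ms) * (\<integral>\<^sup>+a. ?I a * sqn (g (a @ b)) \<partial>conf_measure))"
      using ms c by (intro mult_left_mono snoc.IH bfun_append g) auto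
    finally show "(\<integral>\<^sup>+a. ?I a * sqn (?h a b) \<partial>conf_measure) \<le> \<dots>" .
  qed simp
  also have "\<dots> = (\<integral>\<^sup>+b. ennreal ((K\<^sup>2) ^ length (ms @ [z])) * (?J b * (\<integral>\<^sup>+a. ?I a * sqn (g (a @ b)) \<partial>conf_measure)) \<partial>conf_measure)"
    using K by (intro nn_integral_cong) (simp add: ennreal_mult' mult_ac)
  also have "\<dots> = ennreal ((K\<^sup>2) ^ length (ms @ [z])) * (\<integral>\<^sup>+b. ?J b * (\<integral>\<^sup>+a. ?I a * sqn (g (a @ b)) \<partial>conf_measure) \<partial>conf_measure)"
    by (intro nn_integral_cmult) measurable
  also have "(\<integral>\<^sup>+b. ?J b * (\<integral>\<^sup>+a. ?I a * sqn (g (a @ b)) \<partial>conf_measure) \<partial>conf_measure)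
      = (\<integral>\<^sup>+a. ?I a * (\<integral>\<^sup>+b. ?J b * sqn (g (a @ b)) \<partial>conf_measure) \<partial>conf_measure)"
    by (rule nn_integral_conf_swap[symmetric]) measurable
  also have "\<dots> = (\<integral>\<^sup>+w. ?IJ w * sqn (g w) \<partial>conf_measure)"
    using c by (intro nn_integral_conf_split_interval[symmetric] symmetric_sqn bfun_symmetric g) measurable
  finally show ?case .
qed

text \<open>Points outside of the interval are mere parameters by \<open>mop_append_out\<close>. The
  bound on the interval is applied for each choice of them and integrated.\<close>

theorem contr_marks:
  assumes st: "s < t" and ms: "distinct (map fst ms)" "\<And>z. z \<in> set ms \<Longrightarrow> s < fst z \<and> fst z < t \<and> norm (snd z) \<le> K"
    and K: "0 \<le> K" and g: "g \<in> bfun"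
  shows "(\<integral>\<^sup>+w. sqn (mop s t ms g w) \<partial>conf_measure) \<le> ennreal ((K\<^sup>2) ^ length ms) * (\<integral>\<^sup>+w. sqn (g w) \<partial>conf_measure)"
proof -
  let ?ms = "sort_key fst ms"
  let ?A = "{s<..<t}"
  let ?I = "indicator {w. set w \<subseteq> ?A} :: real list \<Rightarrow> ennreal"
    and ?J = "indicator {w. set w \<subseteq> - ?A} :: real list \<Rightarrow> ennreal"
  let ?f = "\<lambda>a b. mop s t ?ms (\<lambda>v. g (v @ b)) a"
  note [measurable] = bfun_measurable[OF g]
  have sorted: "sorted_wrt (<) (map fst ?ms)"
    using ms(1) by (simp add: strict_sorted_iff distinct_map)
  have f: "(\<lambda>z. ?f (fst z) (snd z)) \<in> borel_measurable (conf_measure \<Otimes>\<^sub>M conf_measure)"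
  proof -
    have "(\<lambda>z. g (fst z @ snd z)) \<in> borel_measurable (conf_measure \<Otimes>\<^sub>M conf_measure)" by measurable
    from borel_measurable_mop_param[OF this, of s t ?ms] show ?thesis by simp
  qed
  have "(\<integral>\<^sup>+w. sqn (mop s t ms g w) \<partial>conf_measure) = (\<integral>\<^sup>+w. sqn (mop s t ?ms g w) \<partial>conf_measure)"
    by (simp add: mop_perm[of ms ?ms])
  also have "\<dots> = (\<integral>\<^sup>+a. (\<integral>\<^sup>+b. sqn (mop s t ?ms g (a @ b)) * ?J b \<partial>conf_measure) * ?I a \<partial>conf_measure)"
    by (intro nn_integral_conf_split_set symmetric_sqn symmetric_mop bfun_symmetric g) measurable
  also have "\<dots> = (\<integral>\<^sup>+a. ?I a * (\<integral>\<^sup>+b. ?J b * sqn (?f a b) \<partial>conf_measure) \<partial>conf_measure)"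
  proof (rule nn_integral_cong)
    fix a
    have "sqn (mop s t ?ms g (a @ b)) * ?J b = ?J b * sqn (?f a b)" for b
    proof (cases "set b \<subseteq> - ?A")
      case True
      then show ?thesis
        using mop_append_out[OF less_imp_le[OF st] g, of b ?ms a] by (simp add: disjoint_eq_subset_Compl)
    qed simp
    then show "(\<integral>\<^sup>+b. sqn (mop s t ?ms g (a @ b)) * ?J b \<partial>conf_measure) * ?I a = ?I a * (\<integral>\<^sup>+b. ?J b * sqn (?f a b) \<partial>conf_measure)"
      by (simp add: mult.commute)
  qed
  also have "\<dots> = (\<integral>\<^sup>+b. ?J b * (\<integral>\<^sup>+a. ?I a * sqn (?f a b) \<partial>conf_measure) \<partial>conf_measure)"
    by (intro nn_integral_conf_swap) (use f in measurable)
  also have "\<dots> \<le> (\<integral>\<^sup>+b. ?J b * (ennreal ((K\<^sup>2) ^ length ?ms) * (\<integral>\<^sup>+a. ?I a * sqn (g (a @ b)) \<partial>conf_measure)) \<partial>conf_measure)"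
    using ms(2) K by (intro nn_integral_mono mult_left_mono contr_marks_interval[OF st sorted] bfun_append g) auto
  also have "\<dots> = (\<integral>\<^sup>+b. ennreal ((K\<^sup>2) ^ length ms) * (?J b * (\<integral>\<^sup>+a. ?I a * sqn (g (a @ b)) \<partial>conf_measure)) \<partial>conf_measure)"
    by (intro nn_integral_cong) (simp add: mult_ac)
  also have "\<dots> = ennreal ((K\<^sup>2) ^ length ms) * (\<integral>\<^sup>+b. ?J b * (\<integral>\<^sup>+a. ?I a * sqn (g (a @ b)) \<partial>conf_measure) \<partial>conf_measure)"
    by (intro nn_integral_cmult) measurable
  also have "(\<integral>\<^sup>+b. ?J b * (\<integral>\<^sup>+a. ?I a * sqn (g (a @ b)) \<partial>conf_measure) \<partial>conf_measure)
      = (\<integral>\<^sup>+a. ?I a * (\<integral>\<^sup>+b. ?J b * sqn (g (a @ b)) \<partial>conf_measure) \<partial>conf_measure)"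
    by (rule nn_integral_conf_swap[symmetric]) measurable
  also have "\<dots> = (\<integral>\<^sup>+a. (\<integral>\<^sup>+b. sqn (g (a @ b)) * ?J b \<partial>conf_measure) * ?I a \<partial>conf_measure)"
    by (simp add: mult.commute)
  also have "\<dots> = (\<integral>\<^sup>+w. sqn (g w) \<partial>conf_measure)"
    by (intro nn_integral_conf_split_set[symmetric] symmetric_sqn bfun_symmetric g) measurable
  finally show ?thesis .
qed

end

section \<open>Norms with powers of the number operator\<close>

definition wnorm2 :: "nat \<Rightarrow> (real list \<Rightarrow> 'k::complex_hilbert) \<Rightarrow> ennreal" where
  "wnorm2 k f = (\<integral>\<^sup>+w. ennreal ((1 + real (length w)) ^ k * (norm (f w))\<^sup>2) \<partial>conf_measure)"

text \<open>The pure power of the particle number is the weight to which Mecke's formula applies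
  directly.\<close>

definition pnorm2 :: "nat \<Rightarrow> (real list \<Rightarrow> 'k::complex_hilbert) \<Rightarrow> ennreal" where
  "pnorm2 k f = (\<integral>\<^sup>+w. ennreal (real (length w) ^ k * (norm (f w))\<^sup>2) \<partial>conf_measure)"

lemma number_succ_power_eq: "number_succ_power k f w = (1 + real (length w)) ^ k *\<^sub>R f w"
proof (induction k)
  case (Suc k)
  then show ?case
    by (simp add: number_succ_power_def number_op_def algebra_simps)
qed (simp add: number_succ_power_def)

lemma Gamma_norm2_eq_wnorm2: "Gamma_norm2 k f = wnorm2 k f"
  unfolding Gamma_norm2_def wnorm2_def number_succ_power_eq rin_def[symmetric]
  by (simp add: rin_scaleR_right rin_self)

lemma wnorm2_0: "wnorm2 0 f = (\<integral>\<^sup>+w. sqn (f w) \<partial>conf_measure)"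
  by (simp add: wnorm2_def)

lemma wnorm2_mono: "k \<le> l \<Longrightarrow> wnorm2 k f \<le> wnorm2 l f"
  unfolding wnorm2_def
  by (intro nn_integral_mono ennreal_leI mult_right_mono power_increasing) auto

lemma pnorm2_le_wnorm2: "pnorm2 k f \<le> wnorm2 k f"
  unfolding wnorm2_def pnorm2_def
  by (intro nn_integral_mono ennreal_leI mult_right_mono power_mono) auto

lemma borel_measurable_weight [measurable]:
  fixes f :: "real list \<Rightarrow> 'k::{complex_hilbert, second_countable_topology}"
  assumes [measurable]: "f \<in> borel_measurable conf_measure"
  shows "(\<lambda>w. ennreal ((1 + real (length w)) ^ k * (norm (f w))\<^sup>2)) \<in> borel_measurable conf_measure"
    "(\<lambda>w. ennreal (real (length w) ^ k * (norm (f w))\<^sup>2)) \<in> borel_measurable conf_measure"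
  by measurable

text \<open>One factor is spent on Mecke's formula. The other \<open>k\<close> factors are evaluated
  at a configuration with one more point, which turns them into the weight of
  \<open>wnorm2\<close>.\<close>

lemma pnorm2_Suc:
  fixes f :: "real list \<Rightarrow> 'k::{complex_hilbert, second_countable_topology}"
  assumes [measurable]: "f \<in> borel_measurable conf_measure"
  shows "pnorm2 (Suc k) f = (\<integral>\<^sup>+r. wnorm2 k (\<lambda>w. f (w @ [r])) \<partial>lborel)"
proof -
  have "pnorm2 (Suc k) f = (\<integral>\<^sup>+w. of_nat (length w) * ennreal (real (length w) ^ k * (norm (f w))\<^sup>2) \<partial>conf_measure)"
    unfolding pnorm2_def
    by (intro nn_integral_cong) (simp add: ennreal_of_nat_eq_real_of_nat mult.assoc flip: ennreal_mult)
  also have "\<dots> = (\<integral>\<^sup>+r. (\<integral>\<^sup>+w. ennreal (real (length (w @ [r])) ^ k * (norm (f (w @ [r])))\<^sup>2) \<partial>conf_measure) \<partial>lborel)"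
    by (rule nn_integral_conf_Mecke) measurable
  finally show ?thesis by (simp add: wnorm2_def)
qed

lemma wnorm2_Suc_le:
  fixes f :: "real list \<Rightarrow> 'k::{complex_hilbert, second_countable_topology}"
  assumes [measurable]: "f \<in> borel_measurable conf_measure"
  shows "wnorm2 (Suc k) f \<le> ennreal (2 ^ Suc k) * (wnorm2 0 f + pnorm2 (Suc k) f)"
proof -
  \<comment> \<open>For n at least 1 this follows from the bound of 1 + n by 2n; the summand 1 on
    the right takes care of the empty configuration.\<close>
  have le: "(1 + real n) ^ Suc k \<le> 2 ^ Suc k * (1 + real n ^ Suc k)" for n
  proof (cases n)
    case 0
    have "(1::real) \<le> 2 ^ Suc k" by (rule one_le_power) simp
    then show ?thesis using 0 by simp
  next
    case (Suc m)
    then have "(1 + real n) ^ Suc k \<le> (2 * real n) ^ Suc k" by (intro power_mono) auto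
    also have "\<dots> = 2 ^ Suc k * real n ^ Suc k" by (rule power_mult_distrib)
    also have "\<dots> \<le> 2 ^ Suc k * (1 + real n ^ Suc k)" by (intro mult_left_mono) auto
    finally show ?thesis .
  qed
  have "wnorm2 (Suc k) f \<le> (\<integral>\<^sup>+w. ennreal (2 ^ Suc k) * (sqn (f w) + ennreal (real (length w) ^ Suc k * (norm (f w))\<^sup>2)) \<partial>conf_measure)"
    unfolding wnorm2_def
  proof (rule nn_integral_mono)
    fix w
    have "(1 + real (length w)) ^ Suc k * (norm (f w))\<^sup>2 \<le> (2 ^ Suc k * (1 + real (length w) ^ Suc k)) * (norm (f w))\<^sup>2"
      by (intro mult_right_mono le) simp
    also have "\<dots> = 2 ^ Suc k * ((norm (f w))\<^sup>2 + real (length w) ^ Suc k * (norm (f w))\<^sup>2)"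
      by (simp add: algebra_simps)
    finally have "ennreal ((1 + real (length w)) ^ Suc k * (norm (f w))\<^sup>2)
        \<le> ennreal (2 ^ Suc k * ((norm (f w))\<^sup>2 + real (length w) ^ Suc k * (norm (f w))\<^sup>2))"
      by (rule ennreal_leI)
    also have "\<dots> = ennreal (2 ^ Suc k) * (sqn (f w) + ennreal (real (length w) ^ Suc k * (norm (f w))\<^sup>2))"
      by (simp only: ennreal_mult'' ennreal_plus zero_le_power2 zero_le_power of_nat_0_le_iff mult_nonneg_nonneg add_nonneg_nonneg)
    finally show "ennreal ((1 + real (length w)) ^ Suc k * (norm (f w))\<^sup>2) \<le> \<dots>" .
  qed
  also have "\<dots> = ennreal (2 ^ Suc k) * (\<integral>\<^sup>+w. sqn (f w) + ennreal (real (length w) ^ Suc k * (norm (f w))\<^sup>2) \<partial>conf_measure)"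
    by (rule nn_integral_cmult) measurable
  also have "(\<integral>\<^sup>+w. sqn (f w) + ennreal (real (length w) ^ Suc k * (norm (f w))\<^sup>2) \<partial>conf_measure) = wnorm2 0 f + pnorm2 (Suc k) f"
    unfolding wnorm2_0 pnorm2_def by (rule nn_integral_add) measurable
  finally show ?thesis .
qed

lemma wnorm2_add_le:
  fixes f g :: "real list \<Rightarrow> 'k::{complex_hilbert, second_countable_topology}"
  assumes [measurable]: "f \<in> borel_measurable conf_measure" "g \<in> borel_measurable conf_measure"
  shows "wnorm2 k (\<lambda>w. f w + g w) \<le> 2 * wnorm2 k f + 2 * wnorm2 k g"
proof -
  let ?p = "\<lambda>w :: real list. (1 + real (length w)) ^ k"
  have "wnorm2 k (\<lambda>w. f w + g w) \<le> (\<integral>\<^sup>+w. 2 * ennreal (?p w * (norm (f w))\<^sup>2) + 2 * ennreal (?p w * (norm (g w))\<^sup>2) \<partial>conf_measure)"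
    unfolding wnorm2_def
  proof (rule nn_integral_mono)
    fix w
    have "norm (f w + g w) \<le> norm (f w) + norm (g w)" by (rule norm_triangle_ineq)
    then have "(norm (f w + g w))\<^sup>2 \<le> (norm (f w) + norm (g w))\<^sup>2" by (rule power_mono) simp
    also have "\<dots> \<le> 2 * (norm (f w))\<^sup>2 + 2 * (norm (g w))\<^sup>2"
      using zero_le_power2[of "norm (f w) - norm (g w)"] by (simp add: power2_sum power2_diff)
    finally have "?p w * (norm (f w + g w))\<^sup>2 \<le> ?p w * (2 * (norm (f w))\<^sup>2 + 2 * (norm (g w))\<^sup>2)"
      by (rule mult_left_mono) simp
    also have "\<dots> = 2 * (?p w * (norm (f w))\<^sup>2) + 2 * (?p w * (norm (g w))\<^sup>2)"
      by (simp add: algebra_simps)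
    finally have "ennreal (?p w * (norm (f w + g w))\<^sup>2) \<le> ennreal (2 * (?p w * (norm (f w))\<^sup>2) + 2 * (?p w * (norm (g w))\<^sup>2))"
      by (rule ennreal_leI)
    then show "ennreal (?p w * (norm (f w + g w))\<^sup>2) \<le> 2 * ennreal (?p w * (norm (f w))\<^sup>2) + 2 * ennreal (?p w * (norm (g w))\<^sup>2)"
      by (simp add: ennreal_mult')
  qed
  also have "\<dots> = (\<integral>\<^sup>+w. 2 * ennreal (?p w * (norm (f w))\<^sup>2) \<partial>conf_measure) + (\<integral>\<^sup>+w. 2 * ennreal (?p w * (norm (g w))\<^sup>2) \<partial>conf_measure)"
    by (rule nn_integral_add) measurable
  also have "\<dots> = 2 * wnorm2 k f + 2 * wnorm2 k g"
    unfolding wnorm2_def by (intro arg_cong2[where f = "(+)"] nn_integral_cmult) measurable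
  finally show ?thesis .
qed

lemma wnorm2_cong_AE:
  "(AE w in conf_measure. f w = g w) \<Longrightarrow> wnorm2 k f = wnorm2 k g"
  unfolding wnorm2_def by (rule nn_integral_cong_AE) auto

context contraction_kernel
begin

text \<open>The induction step integrates the bounds for the functions \<open>w \<mapsto> (U g) (w + r)\<close>, which by
  \<open>mop_snoc_in\<close> are sums of operators with one more mark. Therefore the bound is needed for all
  numbers of marks at once.\<close>

theorem mop_wnorm2_bound:
  assumes K: "norm A1 \<le> K" "norm (A0 + id_blinfun) \<le> K"
  shows "\<exists>C\<ge>0. \<forall>s t ms g. s < t \<longrightarrow> length ms = m \<longrightarrow> distinct (map fst ms) \<longrightarrow>
    (\<forall>z\<in>set ms. s < fst z \<and> fst z < t \<and> norm (snd z) \<le> K) \<longrightarrow> g \<in> bfun \<longrightarrow>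
    wnorm2 k (mop s t ms g) \<le> ennreal (C * (1 + (t - s)) ^ k) * wnorm2 k g"
proof (induction k arbitrary: m)
  case 0
  have "0 \<le> K" using K(1) norm_ge_zero order_trans by blast
  then show ?case
    by (intro exI[of _ "(K\<^sup>2) ^ m"] conjI allI impI) (simp, unfold wnorm2_0, auto intro!: contr_marks simp del: split_paired_All)
next
  case (Suc k)
  have K0: "0 \<le> K" using K(1) norm_ge_zero order_trans by blast
  obtain C1 where C1: "0 \<le> C1" "\<And>s t ms g. s < t \<Longrightarrow> length ms = Suc m \<Longrightarrow> distinct (map fst ms) \<Longrightarrow>
    (\<forall>z\<in>set ms. s < fst z \<and> fst z < t \<and> norm (snd z) \<le> K) \<Longrightarrow> g \<in> bfun \<Longrightarrow>
    wnorm2 k (mop s t ms g) \<le> ennreal (C1 * (1 + (t - s)) ^ k) * wnorm2 k g"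
    using Suc.IH[of "Suc m"] by blast
  obtain C0 where C0: "0 \<le> C0" "\<And>s t ms g. s < t \<Longrightarrow> length ms = m \<Longrightarrow> distinct (map fst ms) \<Longrightarrow>
    (\<forall>z\<in>set ms. s < fst z \<and> fst z < t \<and> norm (snd z) \<le> K) \<Longrightarrow> g \<in> bfun \<Longrightarrow>
    wnorm2 k (mop s t ms g) \<le> ennreal (C0 * (1 + (t - s)) ^ k) * wnorm2 k g"
    using Suc.IH[of m] by blast
  \<comment> \<open>The prefactor is the one of \<open>wnorm2_Suc_le\<close>. In the bracket stand
    the contributions of the norm of order 0, of the term with \<open>A1\<close>, whose integral
    yields \<open>t - s\<close>, and of the terms that contain \<open>?g r\<close>, inside and
    outside of the interval.\<close>
  define D where "D = 2 ^ Suc k * ((K\<^sup>2) ^ m + 2 * C1 + (2 * C1 + C0))"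
  have "wnorm2 (Suc k) (mop s t ms g) \<le> ennreal (D * (1 + (t - s)) ^ Suc k) * wnorm2 (Suc k) g"
    if st: "s < t" and len: "length ms = m" and ms: "distinct (map fst ms)"
      "\<forall>z\<in>set ms. s < fst z \<and> fst z < t \<and> norm (snd z) \<le> K" and g: "g \<in> bfun" for s t ms g
  proof -
    let ?F = "mop s t ms g" and ?Y = "A0 + id_blinfun" and ?g = "\<lambda>r w. g (w @ [r])"
    let ?T = "(1 + (t - s)) ^ k" and ?I = "indicator {s..t} :: real \<Rightarrow> ennreal"
    let ?W = "wnorm2 (Suc k) g"
    note [measurable] = bfun_measurable[OF g]
    have g': "?g r \<in> bfun" for r by (rule bfun_append[OF g])
    have T: "0 \<le> ?T" using st by simp
    \<comment> \<open>Inside, the function is a sum of two evolutions with \<open>Suc m\<close>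
      marks, whence \<open>C1\<close> and the factor 2 of \<open>wnorm2_add_le\<close>. Outside, the
      number of marks stays \<open>m\<close>, whence \<open>C0\<close>. Only the summand without
      \<open>?g r\<close> is restricted to the interval.\<close>
    have bound: "wnorm2 k (\<lambda>w. ?F (w @ [r])) \<le> ?I r * (ennreal (2 * C1 * ?T) * wnorm2 k g) + ennreal ((2 * C1 + C0) * ?T) * wnorm2 k (?g r)"
      if r: "r \<notin> fst ` set ms" for r
    proof (cases "s < r \<and> r < t")
      case True
      let ?F1 = "mop s t ((r, A1) # ms) g" and ?F2 = "mop s t ((r, ?Y) # ms) (?g r)"
      have "wnorm2 k (\<lambda>w. ?F (w @ [r])) = wnorm2 k (\<lambda>w. ?F1 w + ?F2 w)"
        using AE_conf_avoids[of r]
        by (intro wnorm2_cong_AE) (auto simp: mop_snoc_in[OF _ _ g _ r] True elim!: eventually_mono)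
      also have "\<dots> \<le> 2 * wnorm2 k ?F1 + 2 * wnorm2 k ?F2"
        using g' by (intro wnorm2_add_le borel_measurable_mop bfun_measurable g)
      also have "\<dots> \<le> 2 * (ennreal (C1 * ?T) * wnorm2 k g) + 2 * (ennreal (C1 * ?T) * wnorm2 k (?g r))"
        using st len ms r K True by (intro add_mono mult_left_mono C1(2) g g') auto
      also have "\<dots> = ennreal (2 * C1 * ?T) * wnorm2 k g + ennreal (2 * C1 * ?T) * wnorm2 k (?g r)"
        using C1(1) T by (simp add: ennreal_mult' mult.assoc)
      also have "\<dots> \<le> ennreal (2 * C1 * ?T) * wnorm2 k g + ennreal ((2 * C1 + C0) * ?T) * wnorm2 k (?g r)"
        using C0(1) C1(1) T by (intro add_left_mono mult_right_mono ennreal_leI) auto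
      finally show ?thesis using True by simp
    next
      case False
      have "(\<lambda>w. ?F (w @ [r])) = mop s t ms (?g r)"
        using mop_snoc_out[OF less_imp_le[OF st] g, of r ms] False by (auto simp: not_less)
      then have "wnorm2 k (\<lambda>w. ?F (w @ [r])) \<le> ennreal (C0 * ?T) * wnorm2 k (?g r)"
        using C0(2)[OF st len ms g'] by simp
      also have "\<dots> \<le> ennreal ((2 * C1 + C0) * ?T) * wnorm2 k (?g r)"
        using C0(1) C1(1) T by (intro mult_right_mono ennreal_leI) auto
      finally show ?thesis by (rule order_trans) simp
    qed
    have "pnorm2 (Suc k) ?F = (\<integral>\<^sup>+r. wnorm2 k (\<lambda>w. ?F (w @ [r])) \<partial>lborel)"
      by (rule pnorm2_Suc) measurable
    also have "\<dots> \<le> (\<integral>\<^sup>+r. ?I r * (ennreal (2 * C1 * ?T) * wnorm2 k g) + ennreal ((2 * C1 + C0) * ?T) * wnorm2 k (?g r) \<partial>lborel)"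
    proof (rule nn_integral_mono_AE)
      have "fst ` set ms \<in> null_sets lborel"
        by (intro finite_imp_null_set_lborel) simp
      from AE_not_in[OF this]
      show "AE r in lborel. wnorm2 k (\<lambda>w. ?F (w @ [r])) \<le> ?I r * (ennreal (2 * C1 * ?T) * wnorm2 k g)
        + ennreal ((2 * C1 + C0) * ?T) * wnorm2 k (?g r)"
        by eventually_elim (rule bound)
    qed
    also have "\<dots> = (\<integral>\<^sup>+r. ?I r * (ennreal (2 * C1 * ?T) * wnorm2 k g) \<partial>lborel) + (\<integral>\<^sup>+r. ennreal ((2 * C1 + C0) * ?T) * wnorm2 k (?g r) \<partial>lborel)"
      unfolding wnorm2_def by (rule nn_integral_add) measurable
    also have "(\<integral>\<^sup>+r. ennreal ((2 * C1 + C0) * ?T) * wnorm2 k (?g r) \<partial>lborel) = ennreal ((2 * C1 + C0) * ?T) * pnorm2 (Suc k) g"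
      unfolding pnorm2_Suc[OF bfun_measurable[OF g]] unfolding wnorm2_def by (rule nn_integral_cmult) measurable
    \<comment> \<open>This integrand is constant in \<open>r\<close> on the interval, which produces
      the additional power of \<open>t - s\<close>.\<close>
    also have "(\<integral>\<^sup>+r. ?I r * (ennreal (2 * C1 * ?T) * wnorm2 k g) \<partial>lborel) = ennreal (t - s) * (ennreal (2 * C1 * ?T) * wnorm2 k g)"
      using st by (subst nn_integral_multc) auto
    also have "ennreal (t - s) * (ennreal (2 * C1 * ?T) * wnorm2 k g) + ennreal ((2 * C1 + C0) * ?T) * pnorm2 (Suc k) g
        \<le> ennreal (t - s) * (ennreal (2 * C1 * ?T) * ?W) + ennreal ((2 * C1 + C0) * ?T) * ?W"
      by (intro add_mono mult_left_mono wnorm2_mono pnorm2_le_wnorm2) auto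
    finally have p: "pnorm2 (Suc k) ?F \<le> \<dots>" .
    have w0: "wnorm2 0 ?F \<le> ennreal ((K\<^sup>2) ^ m) * ?W"
    proof -
      have "wnorm2 0 ?F \<le> ennreal ((K\<^sup>2) ^ m) * wnorm2 0 g"
        using contr_marks[OF st ms(1) _ K0 g] ms(2) len by (simp add: wnorm2_0)
      also have "\<dots> \<le> ennreal ((K\<^sup>2) ^ m) * ?W"
        by (intro mult_left_mono wnorm2_mono) auto
      finally show ?thesis .
    qed
    have "wnorm2 (Suc k) ?F \<le> ennreal (2 ^ Suc k) * (wnorm2 0 ?F + pnorm2 (Suc k) ?F)"
      by (rule wnorm2_Suc_le) measurable
    also have "\<dots> \<le> ennreal (2 ^ Suc k) * (ennreal ((K\<^sup>2) ^ m) * ?W + (ennreal (t - s) * (ennreal (2 * C1 * ?T) * ?W) + ennreal ((2 * C1 + C0) * ?T) * ?W))"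
      by (intro mult_left_mono add_mono w0 p) auto
    also have "\<dots> = ennreal (2 ^ Suc k * ((K\<^sup>2) ^ m + ((t - s) * (2 * C1 * ?T) + (2 * C1 + C0) * ?T))) * ?W"
      using C0(1) C1(1) T st
      by (simp only: ennreal_mult' ennreal_mult'' ennreal_plus distrib_right distrib_left mult.assoc
          zero_le_power2 zero_le_power mult_nonneg_nonneg add_nonneg_nonneg zero_le_numeral diff_ge_0_iff_ge less_imp_le)
    \<comment> \<open>Each of 1, \<open>?T\<close> and \<open>(t - s) * ?T\<close> is at most the
      next power of \<open>1 + (t - s)\<close>.\<close>
    also have "\<dots> \<le> ennreal (D * (1 + (t - s)) ^ Suc k) * ?W"
    proof (intro mult_right_mono ennreal_leI)
      let ?x = "t - s"
      have x: "0 \<le> ?x" using st by simp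
      have 1: "1 \<le> (1 + ?x) ^ Suc k" using x by (intro one_le_power) simp
      have 2: "?T \<le> (1 + ?x) ^ Suc k" using x by (intro power_increasing) auto
      have 3: "?x * ?T \<le> (1 + ?x) ^ Suc k" using x by (simp add: mult_right_mono)
      have "(K\<^sup>2) ^ m + (?x * (2 * C1 * ?T) + (2 * C1 + C0) * ?T) = (K\<^sup>2) ^ m * 1 + (2 * C1 * (?x * ?T) + (2 * C1 + C0) * ?T)"
        by simp
      also have "\<dots> \<le> (K\<^sup>2) ^ m * (1 + ?x) ^ Suc k + (2 * C1 * (1 + ?x) ^ Suc k + (2 * C1 + C0) * (1 + ?x) ^ Suc k)"
        using C0(1) C1(1) by (intro add_mono mult_left_mono 1 2 3) auto
      also have "\<dots> = ((K\<^sup>2) ^ m + 2 * C1 + (2 * C1 + C0)) * (1 + ?x) ^ Suc k"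
        by (simp only: distrib_right add.assoc)
      finally have "2 ^ Suc k * ((K\<^sup>2) ^ m + (?x * (2 * C1 * ?T) + (2 * C1 + C0) * ?T))
          \<le> 2 ^ Suc k * (((K\<^sup>2) ^ m + 2 * C1 + (2 * C1 + C0)) * (1 + ?x) ^ Suc k)"
        by (rule mult_left_mono) simp
      then show "2 ^ Suc k * ((K\<^sup>2) ^ m + (?x * (2 * C1 * ?T) + (2 * C1 + C0) * ?T)) \<le> D * (1 + ?x) ^ Suc k"
        by (simp only: D_def mult.assoc)
    qed simp
    finally show ?thesis .
  qed
  moreover have "0 \<le> D" using C0(1) C1(1) by (simp add: D_def)
  ultimately show ?case by blast
qed

end

section \<open>The test functions determine the functions on the configuration space\<close>

lemma PiE_eq_Collect: "PiE I F = {f \<in> PiE I (\<lambda>_. UNIV). \<forall>i\<in>I. f i \<in> F i}"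
  by (auto simp: PiE_def)

lemma boxI:
  fixes a b :: "nat \<Rightarrow> real"
  assumes "Z = PiE {..<n} (\<lambda>i. {a i<..<b i})"
  shows "Z \<in> {PiE {..<n} (\<lambda>i. {a i<..<b i}) | a b. True}"
  unfolding mem_Collect_eq by (rule exI[of _ a], rule exI[of _ b]) (simp only: assms simp_thms)

text \<open>Open boxes generate the product sigma-algebra and are stable under intersection, so a
  measure that is finite on a covering sequence of boxes is determined by its values on
  boxes.\<close>

lemma sets_Rpow_boxes:
  "sets (Rpow n) = sigma_sets (PiE {..<n} (\<lambda>_. UNIV)) {PiE {..<n} (\<lambda>i. {a i<..<b i}) | a b. True}"
proof -
  let ?E = "range (\<lambda>(a, b). {a<..<b :: real})"
  have borel: "sets (lborel :: real measure) = sets (sigma UNIV ?E)"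
    unfolding sets_lborel by (subst borel_eq_box) (simp add: box_real split_beta')
  have cover: "\<exists>S\<subseteq>?E. countable S \<and> UNIV = \<Union>S"
  proof (intro exI conjI)
    show "range (\<lambda>k::nat. {- real k<..<real k}) \<subseteq> ?E" by auto
    show "UNIV = \<Union> (range (\<lambda>k::nat. {- real k<..<real k}))"
    proof (intro equalityI subsetI)
      fix r :: real
      obtain k :: nat where "\<bar>r\<bar> < real k" using reals_Archimedean2 by blast
      then show "r \<in> \<Union> (range (\<lambda>k::nat. {- real k<..<real k}))"
        by (intro UN_I[of k]) (auto simp: abs_less_iff)
    qed simp
  qed simp
  have eq: "{{f \<in> PiE {..<n} (\<lambda>_. UNIV). \<forall>i\<in>j. f i \<in> A i} | A j. j \<in> {{..<n}} \<and> A \<in> Pi j (\<lambda>_. ?E)}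
      = {PiE {..<n} (\<lambda>i. {a i<..<b i}) | a b. True}" (is "?l = ?r")
  proof (intro equalityI subsetI)
    fix Z assume "Z \<in> ?l"
    then obtain A where A: "Z = {f \<in> PiE {..<n} (\<lambda>_. UNIV). \<forall>i\<in>{..<n}. f i \<in> A i}" "\<And>i. i < n \<Longrightarrow> A i \<in> ?E"
      by auto
    have "\<forall>i. \<exists>z. i < n \<longrightarrow> A i = {fst z<..<snd z}" using A(2) by fastforce
    then obtain z where z: "\<And>i. i < n \<Longrightarrow> A i = {fst (z i)<..<snd (z i)}" by metis
    have "Z = PiE {..<n} A"
      unfolding A(1) by (rule PiE_eq_Collect[symmetric])
    also have "\<dots> = PiE {..<n} (\<lambda>i. {fst (z i)<..<snd (z i)})"
      using z by (intro PiE_cong) simp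
    finally have Z: "Z = PiE {..<n} (\<lambda>i. {fst (z i)<..<snd (z i)})" .
    show "Z \<in> ?r" by (rule boxI[OF Z])
  next
    fix Z assume "Z \<in> ?r"
    then obtain a b where Z: "Z = PiE {..<n} (\<lambda>i. {a i<..<b i})" by auto
    have "(\<lambda>i. {a i<..<b i}) \<in> Pi {..<n} (\<lambda>_. ?E)"
    proof (rule Pi_I)
      show "{a i<..<b i} \<in> ?E" for i by (rule image_eqI[of _ _ "(a i, b i)"]) simp_all
    qed
    then show "Z \<in> ?l"
      unfolding mem_Collect_eq Z
      by (intro exI[of _ "\<lambda>i. {a i<..<b i}"] exI[of _ "{..<n}"] conjI PiE_eq_Collect singletonI)
  qed
  have "sets (Rpow n) = sets (PiM {..<n} (\<lambda>_. sigma UNIV ?E))"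
    by (rule sets_PiM_cong[OF refl borel])
  also have "\<dots> = sets (sigma (PiE {..<n} (\<lambda>_. UNIV))
      {{f \<in> PiE {..<n} (\<lambda>_. UNIV). \<forall>i\<in>j. f i \<in> A i} | A j. j \<in> {{..<n}} \<and> A \<in> Pi j (\<lambda>_. ?E)})"
    using cover by (intro sets_PiM_sigma[where \<Omega> = "\<lambda>_. UNIV" and E = "\<lambda>_. ?E"]) auto
  also have "\<dots> = sigma_sets (PiE {..<n} (\<lambda>_. UNIV)) {PiE {..<n} (\<lambda>i. {a i<..<b i}) | a b. True}"
    unfolding eq by (rule sets_measure_of) auto
  finally show ?thesis .
qed

section \<open>Continuous bumps and functions that vanish almost everywhere\<close>

lemma enn2real_inj:
  assumes "enn2real x = enn2real y" "x < top" "y < top"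
  shows "x = y"
  by (subst ennreal_enn2real[OF assms(2), symmetric], subst assms(1), rule ennreal_enn2real[OF assms(3)])

lemma indicator_le_indicator: "A \<subseteq> B \<Longrightarrow> indicator A x \<le> (indicator B x :: real)"
  by (auto simp: indicator_def)

text \<open>A trapezoid that vanishes outside of the open interval and tends to its indicator as m
  grows. All of these functions lie below that indicator, which gives dominated convergence.\<close>

definition bump :: "real \<Rightarrow> real \<Rightarrow> nat \<Rightarrow> real \<Rightarrow> real" where
  "bump a b m r = min 1 (real m * max 0 (min (r - a) (b - r)))"

lemma bump_bounds: "0 \<le> bump a b m r" "bump a b m r \<le> 1"
  by (auto simp: bump_def)

lemma bump_outside:
  assumes "r \<notin> {a<..<b}"
  shows "bump a b m r = 0"
proof -
  have "min (r - a) (b - r) \<le> 0" using assms by (auto simp: min_def)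
  then show ?thesis by (simp add: bump_def max_absorb1)
qed

lemma continuous_bump: "continuous_on UNIV (bump a b m)"
  unfolding bump_def by (intro continuous_intros)

lemma bump_tendsto: "(\<lambda>m. bump a b m r) \<longlonglongrightarrow> indicator {a<..<b} r"
proof (cases "r \<in> {a<..<b}")
  case True
  then have d: "0 < min (r - a) (b - r)" by simp
  obtain M :: nat where M: "1 / min (r - a) (b - r) < real M" using reals_Archimedean2 by blast
  have "bump a b m r = 1" if "M \<le> m" for m
  proof -
    have "1 / min (r - a) (b - r) < real m" using M that by (simp add: order_less_le_trans)
    then have "1 \<le> real m * min (r - a) (b - r)" using d by (simp add: field_simps)
    moreover have "max 0 (min (r - a) (b - r)) = min (r - a) (b - r)" using d by simp
    ultimately show ?thesis unfolding bump_def by simp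
  qed
  then have "\<forall>\<^sub>F m in sequentially. bump a b m r = indicator {a<..<b} r"
    using True by (auto simp: eventually_sequentially)
  then show ?thesis by (rule tendsto_eventually)
qed (simp add: bump_outside)

text \<open>Dominated convergence replaces the bumps by open boxes. The positive and the negative
  part of \<open>k\<close>, cut off to a cube, then define finite measures that agree on boxes,
  hence everywhere, and densities are unique.\<close>

lemma Rpow_AE_zeroI:
  fixes k :: "(nat \<Rightarrow> real) \<Rightarrow> real"
  assumes k [measurable]: "k \<in> borel_measurable (Rpow n)"
    and int: "\<And>R. integrable (Rpow n) (\<lambda>x. (\<Prod>i<n. indicator {- real R..real R} (x i)) * k x)"
    and zero: "\<And>a b m. (LINT x|Rpow n. (\<Prod>i<n. bump (a i) (b i) m (x i)) * k x) = 0"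
  shows "AE x in Rpow n. k x = 0"
proof -
  have comp [measurable]: "(\<lambda>x. x i) \<in> borel_measurable (Rpow n)" if "i < n" for i using that by simp
  have box_meas: "(\<lambda>x. \<Prod>i<n. indicator {a i<..<b i} (x i) :: real) \<in> borel_measurable (Rpow n)" for a b :: "nat \<Rightarrow> real"
    by (intro borel_measurable_prod measurable_compose[OF comp]) auto
  have bump_meas: "(\<lambda>x. \<Prod>i<n. bump (a i) (b i) m (x i)) \<in> borel_measurable (Rpow n)" for a b m
    by (intro borel_measurable_prod measurable_compose[OF comp] borel_measurable_continuous_onI continuous_bump) simp
  have dom: "\<bar>(\<Prod>i<n. f i (x i)) * k x\<bar> \<le> \<bar>(\<Prod>i<n. indicator {- real R..real R} (x i)) * k x\<bar>"
    if "\<And>i r. i < n \<Longrightarrow> 0 \<le> f i r \<and> f i r \<le> indicator {- real R..real R} r" for f R x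
    unfolding abs_mult abs_prod using that by (intro mult_right_mono prod_mono) auto
  obtain Rab where Rab: "\<And>a b :: nat \<Rightarrow> real. \<And>i. i < n \<Longrightarrow> {a i<..<b i} \<subseteq> {- real (Rab a b)..real (Rab a b)}"
  proof -
    have "\<exists>R. \<forall>i<n. {a i<..<b i} \<subseteq> {- real R..real R}" for a b :: "nat \<Rightarrow> real"
    proof -
      obtain R :: nat where R: "(\<Sum>i<n. \<bar>a i\<bar> + \<bar>b i\<bar>) \<le> real R" using real_arch_simple by blast
      have "\<bar>a i\<bar> + \<bar>b i\<bar> \<le> real R" if "i < n" for i
        using member_le_sum[of i "{..<n}" "\<lambda>i. \<bar>a i\<bar> + \<bar>b i\<bar>"] that R by simp
      then show ?thesis by (intro exI[of _ R]) force
    qed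
    then show ?thesis using that by metis
  qed
  have box_int: "integrable (Rpow n) (\<lambda>x. (\<Prod>i<n. indicator {a i<..<b i} (x i)) * k x)" for a b
  proof (rule Bochner_Integration.integrable_bound[OF int[of "Rab a b"]])
    show "AE x in Rpow n. norm ((\<Prod>i<n. indicator {a i<..<b i} (x i)) * k x)
        \<le> norm ((\<Prod>i<n. indicator {- real (Rab a b)..real (Rab a b)} (x i)) * k x)"
      unfolding real_norm_def
      by (intro AE_I2 dom conjI indicator_le_indicator Rab) simp
  qed (intro borel_measurable_times box_meas k)
  have box_zero: "(LINT x|Rpow n. (\<Prod>i<n. indicator {a i<..<b i} (x i)) * k x) = 0" for a b
  proof -
    have "(\<lambda>m. LINT x|Rpow n. (\<Prod>i<n. bump (a i) (b i) m (x i)) * k x)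
      \<longlonglongrightarrow> (LINT x|Rpow n. (\<Prod>i<n. indicator {a i<..<b i} (x i)) * k x)"
    proof (rule integral_dominated_convergence)
      show "integrable (Rpow n) (\<lambda>x. \<bar>(\<Prod>i<n. indicator {- real (Rab a b)..real (Rab a b)} (x i)) * k x\<bar>)"
        by (intro integrable_abs int)
      show "AE x in Rpow n. (\<lambda>m. (\<Prod>i<n. bump (a i) (b i) m (x i)) * k x)
          \<longlonglongrightarrow> (\<Prod>i<n. indicator {a i<..<b i} (x i)) * k x"
        by (intro AE_I2 tendsto_mult tendsto_prod bump_tendsto tendsto_const)
      show "AE x in Rpow n. norm ((\<Prod>i<n. bump (a i) (b i) m (x i)) * k x)
          \<le> \<bar>(\<Prod>i<n. indicator {- real (Rab a b)..real (Rab a b)} (x i)) * k x\<bar>" for m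
      proof -
        have "0 \<le> bump (a i) (b i) m r \<and> bump (a i) (b i) m r \<le> indicator {- real (Rab a b)..real (Rab a b)} r"
          if "i < n" for i r
          using bump_bounds[of "a i" "b i" m r] bump_outside[of r "a i" "b i" m] Rab[OF that, of a b]
          by (cases "r \<in> {a i<..<b i}") (auto split: split_indicator)
        then show ?thesis unfolding real_norm_def by (intro AE_I2 dom)
      qed
    qed (intro borel_measurable_times box_meas bump_meas k)+
    then show ?thesis unfolding zero by (rule LIMSEQ_unique) simp
  qed
  have "AE x in Rpow n. (\<Prod>i<n. indicator {- real R<..<real R} (x i)) * k x = 0" for R
  proof -
    let ?k = "\<lambda>x. (\<Prod>i<n. indicator {- real R<..<real R} (x i)) * k x"
    have km [measurable]: "?k \<in> borel_measurable (Rpow n)" by (intro borel_measurable_times box_meas k)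
    have ki: "integrable (Rpow n) ?k" by (rule box_int)
    let ?p = "\<lambda>x. ennreal (?k x)" and ?q = "\<lambda>x. ennreal (- ?k x)"
    have pq: "(\<integral>\<^sup>+x. ?p x * indicator Z x \<partial>Rpow n) = (\<integral>\<^sup>+x. ?q x * indicator Z x \<partial>Rpow n)"
      if Z: "Z = PiE {..<n} (\<lambda>i. {a i<..<b i})" for Z and a b :: "nat \<Rightarrow> real"
    proof -
      let ?f = "\<lambda>x. (\<Prod>i<n. indicator {max (a i) (- real R)<..<min (b i) (real R)} (x i)) * k x"
      have ind: "indicator Z x * ?k x = ?f x" if x: "x \<in> space (Rpow n)" for x
      proof -
        have "indicator Z x = (\<Prod>i<n. indicator {a i<..<b i} (x i) :: real)"
        proof (cases "x \<in> Z")
          case True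
          then show ?thesis by (auto simp: Z PiE_iff intro!: prod.neutral[symmetric])
        next
          case False
          then obtain i where "i < n" "x i \<notin> {a i<..<b i}"
            using x unfolding Z space_PiM PiE_iff by auto
          then have "(\<Prod>i<n. indicator {a i<..<b i} (x i) :: real) = 0"
            by (intro prod_zero bexI[of _ i]) simp_all
          then show ?thesis using False by simp
        qed
        then show ?thesis
          by (simp add: mult.assoc[symmetric] flip: prod.distrib indicator_inter_arith)
      qed
      have "(\<integral>\<^sup>+x. ?p x * indicator Z x \<partial>Rpow n) = (\<integral>\<^sup>+x. ennreal (?f x) \<partial>Rpow n)"
        by (intro nn_integral_cong) (simp add: ind[symmetric] split: split_indicator)
      moreover have "(\<integral>\<^sup>+x. ?q x * indicator Z x \<partial>Rpow n) = (\<integral>\<^sup>+x. ennreal (- ?f x) \<partial>Rpow n)"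
        by (intro nn_integral_cong) (simp add: ind[symmetric] split: split_indicator)
      moreover have "(\<integral>\<^sup>+x. ennreal (?f x) \<partial>Rpow n) = (\<integral>\<^sup>+x. ennreal (- ?f x) \<partial>Rpow n)"
      proof -
        have fi: "integrable (Rpow n) ?f" by (rule box_int)
        have "enn2real (\<integral>\<^sup>+x. ennreal (?f x) \<partial>Rpow n) = enn2real (\<integral>\<^sup>+x. ennreal (- ?f x) \<partial>Rpow n)"
          using real_lebesgue_integral_def[OF fi] box_zero by simp
        moreover have "(\<integral>\<^sup>+x. ennreal (?f x) \<partial>Rpow n) < top" "(\<integral>\<^sup>+x. ennreal (- ?f x) \<partial>Rpow n) < top"
          using fi unfolding real_integrable_def by (simp_all add: less_top)
        ultimately show ?thesis by (intro enn2real_inj)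
      qed
      ultimately show ?thesis by simp
    qed
    \<comment> \<open>On a box the two measures differ by the integral of \<open>k\<close> over the
      intersection of the box with the cube. This is again a box, so the integral is 0.\<close>
    have dens: "density (Rpow n) ?p = density (Rpow n) ?q"
    proof (rule measure_eqI_generator_eq)
      let ?G = "{PiE {..<n} (\<lambda>i. {a i<..<b i :: real}) | a b. True}"
      show "Int_stable ?G"
      proof (rule Int_stableI)
        fix X Y assume "X \<in> ?G" "Y \<in> ?G"
        then obtain a b c d where XY: "X = PiE {..<n} (\<lambda>i. {a i<..<b i})" "Y = PiE {..<n} (\<lambda>i. {c i<..<d i})" by auto
        have "X \<inter> Y = PiE {..<n} (\<lambda>i. {max (a i) (c i)<..<min (b i) (d i)})"
          unfolding XY PiE_Int by (intro PiE_cong) auto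
        then show "X \<inter> Y \<in> ?G" by (rule boxI)
      qed
      show "?G \<subseteq> Pow (PiE {..<n} (\<lambda>_. UNIV))"
      proof
        fix X assume "X \<in> ?G"
        then obtain a b where "X = PiE {..<n} (\<lambda>i. {a i<..<b i})" by auto
        moreover have "PiE {..<n} (\<lambda>i. {a i<..<b i}) \<subseteq> PiE {..<n} (\<lambda>_. UNIV)"
          by (intro PiE_mono) simp
        ultimately show "X \<in> Pow (PiE {..<n} (\<lambda>_. UNIV))" by simp
      qed
      show "sets (density (Rpow n) ?p) = sigma_sets (PiE {..<n} (\<lambda>_. UNIV)) ?G"
        "sets (density (Rpow n) ?q) = sigma_sets (PiE {..<n} (\<lambda>_. UNIV)) ?G"
        by (simp_all add: sets_Rpow_boxes)
      show "emeasure (density (Rpow n) ?p) X = emeasure (density (Rpow n) ?q) X" if X: "X \<in> ?G" for X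
      proof -
        have "X \<in> sets (Rpow n)" unfolding sets_Rpow_boxes using X by (rule sigma_sets.Basic)
        moreover obtain a b where "X = PiE {..<n} (\<lambda>i. {a i<..<b i})" using X by auto
        ultimately show ?thesis using pq by (simp add: emeasure_density)
      qed
      show "range (\<lambda>j::nat. PiE {..<n} (\<lambda>i. {- real j<..<real j})) \<subseteq> ?G"
        by (rule image_subsetI, rule boxI, rule refl)
      show "(\<Union>j::nat. PiE {..<n} (\<lambda>i. {- real j<..<real j})) = PiE {..<n} (\<lambda>_. UNIV)"
      proof (intro equalityI subsetI)
        fix x assume x: "x \<in> PiE {..<n} (\<lambda>_. UNIV :: real set)"
        obtain j :: nat where j: "(\<Sum>i<n. \<bar>x i\<bar>) < real j" using reals_Archimedean2 by blast
        have "x i \<in> {- real j<..<real j}" if "i < n" for i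
        proof -
          have "\<bar>x i\<bar> < real j" using member_le_sum[of i "{..<n}" "\<lambda>i. \<bar>x i\<bar>"] that j by simp
          then show ?thesis by (simp add: abs_less_iff)
        qed
        then have "x \<in> PiE {..<n} (\<lambda>i. {- real j<..<real j})"
          using x unfolding PiE_iff by simp
        then show "x \<in> (\<Union>j::nat. PiE {..<n} (\<lambda>i. {- real j<..<real j}))"
          by blast
      qed (auto simp: PiE_iff)
      fix j :: nat
      have "emeasure (density (Rpow n) ?p) (PiE {..<n} (\<lambda>i. {- real j<..<real j}))
          \<le> emeasure (density (Rpow n) ?p) (space (density (Rpow n) ?p))"
        by (rule emeasure_space)
      also have "\<dots> = (\<integral>\<^sup>+x. ?p x \<partial>Rpow n)"
        by (subst emeasure_density) (auto intro!: nn_integral_cong)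
      also have "\<dots> < \<infinity>"
        using ki by (simp add: real_integrable_def less_top)
      finally show "emeasure (density (Rpow n) ?p) (PiE {..<n} (\<lambda>i. {- real j<..<real j})) \<noteq> \<infinity>"
        by simp
    qed
    interpret sigma_finite_measure "Rpow n" by (rule sigma_finite_Rpow)
    from density_unique[OF _ _ dens] have "AE x in Rpow n. ?p x = ?q x" by simp
    then show ?thesis
    proof eventually_elim
      case (elim x)
      \<comment> \<open>One of the two sides is always the value 0 that \<open>ennreal\<close> gives
        to negative numbers.\<close>
      have "y = 0" if "ennreal y = ennreal (- y)" for y :: real
        using that by (cases "0 \<le> y") (simp_all add: ennreal_neg ennreal_eq_0_iff eq_commute[of 0])
      then show ?case using elim by blast
    qed
  qed
  then have "AE x in Rpow n. \<forall>R. (\<Prod>i<n. indicator {- real R<..<real R} (x i)) * k x = 0"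
    unfolding AE_all_countable ..
  then show ?thesis
  proof eventually_elim
    case (elim x)
    obtain j :: nat where j: "(\<Sum>i<n. \<bar>x i\<bar>) < real j" using reals_Archimedean2 by blast
    have "\<bar>x i\<bar> < real j" if "i < n" for i
      using member_le_sum[of i "{..<n}" "\<lambda>i. \<bar>x i\<bar>"] that j by simp
    then have "(\<Prod>i<n. indicator {- real j<..<real j} (x i)) = (1::real)"
      by (intro prod.neutral) (auto simp: abs_less_iff minus_less_iff)
    then show ?case using elim[rule_format, of j] by simp
  qed
qed

lemma enn2real_divide_fact: "enn2real (x / ennreal (fact n)) = enn2real x / fact n"
proof -
  have "x / ennreal (fact n) = x * ennreal (inverse (fact n))"
    by (simp add: divide_ennreal_def inverse_ennreal)
  then have "enn2real (x / ennreal (fact n)) = enn2real x * inverse (fact n)"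
    by (simp only: enn2real_mult) simp
  then show ?thesis by (simp add: divide_inverse)
qed

lemma integral_conf_length:
  fixes F :: "real list \<Rightarrow> real"
  assumes F: "integrable conf_measure F" and supp: "\<And>w. length w \<noteq> n \<Longrightarrow> F w = 0"
  shows "integrable (Rpow n) (\<lambda>x. F (conf n x))"
    and "(LINT w|conf_measure. F w) = (LINT x|Rpow n. F (conf n x)) / fact n"
proof -
  have Fm [measurable]: "F \<in> borel_measurable conf_measure" using F by simp
  have nn: "(\<integral>\<^sup>+w. ennreal (c * F w) \<partial>conf_measure) = (\<integral>\<^sup>+x. ennreal (c * F (conf n x)) \<partial>Rpow n) / ennreal (fact n)" for c
  proof -
    have "(\<integral>\<^sup>+w. ennreal (c * F w) \<partial>conf_measure) = (\<integral>\<^sup>+w. ennreal (c * F w) * indicator {w. length w = n} w \<partial>conf_measure)"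
      using supp by (intro nn_integral_cong) (auto simp: indicator_def)
    also have "\<dots> = (\<integral>\<^sup>+x. ennreal (c * F (conf n x)) \<partial>Rpow n) / ennreal (fact n)"
      by (rule nn_integral_conf_length) measurable
    finally show ?thesis .
  qed
  have fin: "(\<integral>\<^sup>+x. ennreal (c * F (conf n x)) \<partial>Rpow n) < top"
    if "(\<integral>\<^sup>+w. ennreal (c * F w) \<partial>conf_measure) < top" for c
  proof -
    have "(\<integral>\<^sup>+x. ennreal (c * F (conf n x)) \<partial>Rpow n) * ennreal (inverse (fact n)) < top"
      using that unfolding nn by (simp add: divide_ennreal_def inverse_ennreal)
    then show ?thesis by (auto simp: ennreal_mult_less_top)
  qed
  have "(\<integral>\<^sup>+w. ennreal (1 * F w) \<partial>conf_measure) < top" "(\<integral>\<^sup>+w. ennreal (- 1 * F w) \<partial>conf_measure) < top"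
    using F by (simp_all add: real_integrable_def less_top)
  from fin[OF this(1)] fin[OF this(2)] show int: "integrable (Rpow n) (\<lambda>x. F (conf n x))"
    using measurable_compose[OF measurable_conf Fm, of n] by (simp add: real_integrable_def less_top)
  show "(LINT w|conf_measure. F w) = (LINT x|Rpow n. F (conf n x)) / fact n"
    unfolding real_lebesgue_integral_def[OF F] real_lebesgue_integral_def[OF int]
    using nn[of 1] nn[of "- 1"] by (simp add: enn2real_divide_fact diff_divide_distrib)
qed

section \<open>Symmetrised bumps\<close>

lemma distr_Rpow_permute:
  assumes p: "p permutes {..<n}"
  shows "distr (Rpow n) (Rpow n) (\<lambda>x. \<lambda>i\<in>{..<n}. x (p i)) = Rpow n"
proof (rule lborel_family.PiM_eqI)
  have pn: "p i < n" if "i < n" for i using permutes_in_image[OF p, of i] that by simp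
  have qn: "inv p i < n" if "i < n" for i using permutes_in_image[OF permutes_inv[OF p], of i] that by simp
  have m [measurable]: "(\<lambda>x. \<lambda>i\<in>{..<n}. x (p i)) \<in> Rpow n \<rightarrow>\<^sub>M Rpow n"
    using pn by (intro measurable_restrict) simp
  fix A :: "nat \<Rightarrow> real set" assume A: "\<And>i. i \<in> {..<n} \<Longrightarrow> A i \<in> sets lborel"
  have "(\<lambda>x. \<lambda>i\<in>{..<n}. x (p i)) -` PiE {..<n} A \<inter> space (Rpow n) = PiE {..<n} (\<lambda>i. A (inv p i))" (is "?l = ?r")
  proof (intro equalityI subsetI)
    fix x assume x: "x \<in> ?l"
    then have "x i \<in> A (inv p i)" if "i < n" for i
    proof -
      have "(\<lambda>i\<in>{..<n}. x (p i)) (inv p i) \<in> A (inv p i)" using x qn[OF that] by (auto simp: PiE_iff)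
      then show ?thesis using qn[OF that] permutes_inverses(1)[OF p, of i] by simp
    qed
    then show "x \<in> ?r" using x by (auto simp: space_PiM PiE_iff)
  next
    fix x assume x: "x \<in> ?r"
    then have "x (p i) \<in> A i" if "i < n" for i
    proof -
      have "x (p i) \<in> A (inv p (p i))" using x pn[OF that] by (auto simp: PiE_iff)
      then show ?thesis using permutes_inverses(2)[OF p, of i] by simp
    qed
    then show "x \<in> ?l" using x by (auto simp: space_PiM PiE_iff)
  qed
  then have "emeasure (distr (Rpow n) (Rpow n) (\<lambda>x. \<lambda>i\<in>{..<n}. x (p i))) (PiE {..<n} A)
      = emeasure (Rpow n) (PiE {..<n} (\<lambda>i. A (inv p i)))"
    using A by (subst emeasure_distr) (auto intro!: sets_PiM_I_finite)
  also have "\<dots> = (\<Prod>i<n. emeasure lborel (A (inv p i)))"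
    using A qn by (intro lborel_family.emeasure_PiM) auto
  also have "\<dots> = (\<Prod>i<n. emeasure lborel (A i))"
    by (rule prod.reindex_bij_betw[OF permutes_imp_bij[OF permutes_inv[OF p]], of "\<lambda>i. emeasure lborel (A i)"])
  finally show "emeasure (distr (Rpow n) (Rpow n) (\<lambda>x. \<lambda>i\<in>{..<n}. x (p i))) (PiE {..<n} A)
      = (\<Prod>i<n. emeasure lborel (A i))" .
qed simp_all

text \<open>Test functions must be symmetric, so the product of bumps is summed over all
  permutations of the coordinates. Tested against a symmetric function, each permutation contributes
  the same integral.\<close>

definition sym_bump :: "nat \<Rightarrow> (nat \<Rightarrow> real) \<Rightarrow> (nat \<Rightarrow> real) \<Rightarrow> nat \<Rightarrow> 'k::complex_hilbert \<Rightarrow> real list \<Rightarrow> 'k" where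
  "sym_bump n a b m x w = (if length w = n
     then (\<Sum>p | p permutes {..<n}. \<Prod>i<n. bump (a i) (b i) m (w ! p i)) *\<^sub>R x else 0)"

lemma finite_permutes_less: "finite {p. p permutes {..<n::nat}}"
  by (rule finite_permutations) simp

lemma sym_bump_conf:
  "sym_bump n a b m x (conf n y) = (\<Sum>p | p permutes {..<n}. \<Prod>i<n. bump (a i) (b i) m (y (p i))) *\<^sub>R x"
proof -
  have "(\<Prod>i<n. bump (a i) (b i) m (conf n y ! p i)) = (\<Prod>i<n. bump (a i) (b i) m (y (p i)))"
    if "p permutes {..<n}" for p
  proof (rule prod.cong[OF refl])
    fix i assume "i \<in> {..<n}"
    then have "p i < n" using permutes_in_image[OF that, of i] by simp
    then show "bump (a i) (b i) m (conf n y ! p i) = bump (a i) (b i) m (y (p i))" by (simp add: conf_def)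
  qed
  then show ?thesis by (simp add: sym_bump_def)
qed

text \<open>Rearranging the list by \<open>q\<close> replaces p by \<open>q \<circ> p\<close> in the
  sum, which only relabels the permutations.\<close>

lemma symmetric_sym_bump: "symmetric (sym_bump n a b m x)"
  unfolding symmetric_def
proof (intro allI impI)
  fix v w :: "real list" assume vw: "mset v = mset w"
  note len = mset_eq_length[OF vw]
  show "sym_bump n a b m x v = sym_bump n a b m x w"
  proof (cases "length w = n")
    case True
    from mset_eq_permutation[OF vw] obtain q where q: "q permutes {..<n}" "permute_list q w = v"
      unfolding True .
    have "(\<Prod>i<n. bump (a i) (b i) m (v ! p i)) = (\<Prod>i<n. bump (a i) (b i) m (w ! (q \<circ> p) i))"
      if "p permutes {..<n}" for p
    proof (rule prod.cong[OF refl])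
      fix i assume "i \<in> {..<n}"
      then have "p i < n" using permutes_in_image[OF that, of i] by simp
      then have "v ! p i = w ! q (p i)"
        unfolding q(2)[symmetric] using q(1) True by (intro permute_list_nth) auto
      then show "bump (a i) (b i) m (v ! p i) = bump (a i) (b i) m (w ! (q \<circ> p) i)" by simp
    qed
    then have "(\<Sum>p | p permutes {..<n}. \<Prod>i<n. bump (a i) (b i) m (v ! p i))
        = (\<Sum>p | p permutes {..<n}. \<Prod>i<n. bump (a i) (b i) m (w ! (q \<circ> p) i))"
      by (intro sum.cong) auto
    also have "\<dots> = (\<Sum>p | p permutes {..<n}. \<Prod>i<n. bump (a i) (b i) m (w ! p i))"
      by (rule setum_permutations_compose_left[OF q(1), symmetric])
    finally show ?thesis using True len by (simp add: sym_bump_def)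
  qed (simp add: sym_bump_def len)
qed

lemma bump_support_bound:
  fixes a b :: "nat \<Rightarrow> real"
  obtains R where "n \<le> R" "\<And>i. i < n \<Longrightarrow> {a i<..<b i} \<subseteq> {- real R..real R}"
proof -
  obtain S :: nat where S: "(\<Sum>i<n. \<bar>a i\<bar> + \<bar>b i\<bar>) \<le> real S" using real_arch_simple by blast
  have "{a i<..<b i} \<subseteq> {- real (max n S)..real (max n S)}" if i: "i < n" for i
  proof -
    have "\<bar>a i\<bar> + \<bar>b i\<bar> \<le> real S"
      using member_le_sum[of i "{..<n}" "\<lambda>i. \<bar>a i\<bar> + \<bar>b i\<bar>"] i S by simp
    then show ?thesis by force
  qed
  then show thesis using that[of "max n S"] by simp
qed

lemma sym_bump_support:
  assumes R: "\<And>i. i < n \<Longrightarrow> {a i<..<b i} \<subseteq> {- real R..real R}"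
    and w: "sym_bump n a b m x w \<noteq> 0"
  shows "length w = n \<and> set w \<subseteq> {- real R..real R}"
proof -
  have len: "length w = n" using w by (auto simp: sym_bump_def split: if_splits)
  have "(\<Sum>p | p permutes {..<n}. \<Prod>i<n. bump (a i) (b i) m (w ! p i)) \<noteq> 0"
    using w len by (auto simp: sym_bump_def)
  then obtain p where p: "p permutes {..<n}" "(\<Prod>i<n. bump (a i) (b i) m (w ! p i)) \<noteq> 0"
    by (rule sum.not_neutral_contains_not_neutral) blast
  have nth: "w ! j \<in> {- real R..real R}" if j: "j < n" for j
  proof -
    have "inv p j < n" using permutes_in_image[OF permutes_inv[OF p(1)], of j] j by simp
    moreover have "p (inv p j) = j" by (rule permutes_inverses(1)[OF p(1)])
    moreover have "bump (a (inv p j)) (b (inv p j)) m (w ! p (inv p j)) \<noteq> 0"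
    proof
      assume "bump (a (inv p j)) (b (inv p j)) m (w ! p (inv p j)) = 0"
      then have "(\<Prod>i<n. bump (a i) (b i) m (w ! p i)) = 0"
        using \<open>inv p j < n\<close> by (intro prod_zero bexI[of _ "inv p j"]) simp_all
      with p(2) show False by simp
    qed
    ultimately have "w ! j \<in> {a (inv p j)<..<b (inv p j)}"
      using bump_outside[of "w ! j" "a (inv p j)" "b (inv p j)" m] by fastforce
    then show ?thesis using R[OF \<open>inv p j < n\<close>] by blast
  qed
  have "set w \<subseteq> {- real R..real R}"
  proof
    fix r assume "r \<in> set w"
    then obtain j where "j < n" "w ! j = r" using len unfolding in_set_conv_nth by blast
    then show "r \<in> {- real R..real R}" using nth[of j] by simp
  qed
  then show ?thesis using len by simp
qed

lemma sym_bump_bfun: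
  fixes x :: "'k::{complex_hilbert, second_countable_topology}"
  shows "sym_bump n a b m x \<in> bfun"
proof -
  obtain R where R: "n \<le> R" "\<And>i. i < n \<Longrightarrow> {a i<..<b i} \<subseteq> {- real R..real R}"
    using bump_support_bound[of n a b] by metis
  let ?C = "real (card {p. p permutes {..<n}}) * norm x"
  show ?thesis
  proof (rule bfunI[OF _ symmetric_sym_bump])
    show "norm (sym_bump n a b m x w) \<le> ?C * indicator (conf_box R) w" for w
    proof (cases "sym_bump n a b m x w = 0")
      case False
      have "w \<in> conf_box R"
        using sym_bump_support[OF R(2) False] R(1) by (simp add: conf_box_def)
      moreover have "\<bar>\<Sum>p | p permutes {..<n}. \<Prod>i<n. bump (a i) (b i) m (w ! p i)\<bar> \<le> (\<Sum>p | p permutes {..<n}. 1)"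
        by (rule order_trans[OF sum_abs], intro sum_mono)
           (auto simp: abs_prod abs_of_nonneg bump_bounds intro!: prod_le_1)
      ultimately show ?thesis
        using sym_bump_support[OF R(2) False] by (simp add: sym_bump_def mult_right_mono)
    qed simp
    show "sym_bump n a b m x \<in> borel_measurable conf_measure"
    proof (rule measurable_from_conf)
      fix j
      show "(\<lambda>y. sym_bump n a b m x (conf j y)) \<in> borel_measurable (Rpow j)"
      proof (cases "j = n")
        case True
        have "(\<lambda>y. bump (a i) (b i) m (y (p i))) \<in> borel_measurable (Rpow n)"
          if "i < n" "p permutes {..<n}" for i p
          using permutes_in_image[OF that(2), of i] that(1)
          by (intro measurable_compose[OF _ borel_measurable_continuous_onI[OF continuous_bump]]) simp
        then show ?thesis
          unfolding True sym_bump_conf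
          by (intro borel_measurable_scaleR borel_measurable_sum borel_measurable_prod) auto
      qed (simp add: sym_bump_def)
    qed
  qed
qed

section \<open>Topology of the configuration space\<close>

lemma topspace_conf_topology: "topspace conf_topology = UNIV"
proof -
  have "openin conf_topology UNIV"
    unfolding openin_conf_topology vimage_UNIV Int_UNIV_left by (simp only: openin_topspace simp_thms)
  then have "UNIV \<subseteq> topspace conf_topology" by (rule openin_subset)
  then show ?thesis by (rule top.extremum_uniqueI)
qed

lemma continuous_map_conf: "continuous_map (product_topology (\<lambda>_. euclideanreal) {..<n}) conf_topology (conf n)"
  unfolding continuous_map_def topspace_conf_topology
proof (intro conjI allI impI)
  fix U assume "openin conf_topology U"
  then have "openin (product_topology (\<lambda>_. euclideanreal) {..<n}) (conf n -` U \<inter> topspace (product_topology (\<lambda>_. euclideanreal) {..<n}))"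
    by (simp only: openin_conf_topology)
  moreover have "conf n -` U \<inter> topspace (product_topology (\<lambda>_. euclideanreal) {..<n})
      = {x \<in> topspace (product_topology (\<lambda>_. euclideanreal) {..<n}). conf n x \<in> U}" by blast
  ultimately show "openin (product_topology (\<lambda>_. euclideanreal) {..<n}) {x \<in> topspace (product_topology (\<lambda>_. euclideanreal) {..<n}). conf n x \<in> U}"
    by (simp only:)
qed simp

lemma continuous_map_from_conf:
  fixes f :: "real list \<Rightarrow> 'b::topological_space"
  assumes "\<And>n. continuous_map (product_topology (\<lambda>_. euclideanreal) {..<n}) euclidean (\<lambda>x. f (conf n x))"
  shows "continuous_map conf_topology euclidean f"
  unfolding continuous_map_def topspace_conf_topology
proof (intro conjI allI impI)
  fix U :: "'b set" assume U: "openin euclidean U"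
  show "openin conf_topology {w \<in> UNIV. f w \<in> U}"
    unfolding openin_conf_topology
  proof
    fix n
    have "openin (product_topology (\<lambda>_. euclideanreal) {..<n}) {x \<in> topspace (product_topology (\<lambda>_. euclideanreal) {..<n}). f (conf n x) \<in> U}"
      using assms[of n] U unfolding continuous_map_def by blast
    moreover have "conf n -` {w \<in> UNIV. f w \<in> U} \<inter> topspace (product_topology (\<lambda>_. euclideanreal) {..<n})
      = {x \<in> topspace (product_topology (\<lambda>_. euclideanreal) {..<n}). f (conf n x) \<in> U}" by blast
    ultimately show "openin (product_topology (\<lambda>_. euclideanreal) {..<n}) (conf n -` {w \<in> UNIV. f w \<in> U} \<inter> topspace (product_topology (\<lambda>_. euclideanreal) {..<n}))"
      by (simp only:)
  qed
qed simp

lemma compactin_conf_cube: "compactin conf_topology {w. length w = n \<and> set w \<subseteq> {- R..R}}"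
proof -
  let ?C = "PiE {..<n} (\<lambda>_. {- R..R})"
  have "compactin (product_topology (\<lambda>_. euclideanreal) {..<n}) ?C"
    by (subst compactin_PiE) auto
  from image_compactin[OF this continuous_map_conf] have "compactin conf_topology (conf n ` ?C)" .
  also have "conf n ` ?C = {w. length w = n \<and> set w \<subseteq> {- R..R}}"
  proof (intro equalityI subsetI)
    fix w assume "w \<in> {w. length w = n \<and> set w \<subseteq> {- R..R}}"
    then have w: "length w = n" "set w \<subseteq> {- R..R}" by simp_all
    have eq: "w = conf n (\<lambda>i\<in>{..<n}. w ! i)"
      by (rule nth_equalityI) (simp_all add: conf_def w(1))
    have "w ! i \<in> {- R..R}" if "i < n" for i
      using w nth_mem[of i w] that by blast
    then have "(\<lambda>i\<in>{..<n}. w ! i) \<in> ?C" unfolding PiE_iff extensional_def by simp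
    then show "w \<in> conf n ` ?C" by (subst eq) (rule imageI)
  next
    fix w assume "w \<in> conf n ` ?C"
    then obtain x where x: "x \<in> ?C" "w = conf n x" by blast
    have "x i \<in> {- R..R}" if "i < n" for i
      using PiE_mem[OF x(1), of i] that by simp
    then show "w \<in> {w. length w = n \<and> set w \<subseteq> {- R..R}}"
      by (auto simp: x(2) conf_def)
  qed
  finally show ?thesis .
qed

lemma closedin_conf_cube: "closedin conf_topology {w. length w = n \<and> set w \<subseteq> {- R..R}}"
  unfolding closedin_def topspace_conf_topology openin_conf_topology
proof (intro conjI allI)
  fix m :: nat
  let ?T = "product_topology (\<lambda>_. euclideanreal) {..<m}"
  show "openin ?T (conf m -` (UNIV - {w. length w = n \<and> set w \<subseteq> {- R..R}}) \<inter> topspace ?T)"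
  proof (cases "m = n")
    case True
    have "conf m -` (UNIV - {w. length w = n \<and> set w \<subseteq> {- R..R}}) \<inter> topspace ?T
        = topspace ?T - PiE {..<m} (\<lambda>_. {- R..R})"
    proof -
      have c1: "conf m x \<in> {w. length w = n \<and> set w \<subseteq> {- R..R}} \<longleftrightarrow> (\<forall>i\<in>{..<m}. x i \<in> {- R..R})" for x
        using True by (simp add: conf_def image_subset_iff atLeast0LessThan)
      have c2: "x \<in> PiE {..<m} (\<lambda>_. {- R..R}) \<longleftrightarrow> (\<forall>i\<in>{..<m}. x i \<in> {- R..R})" if "x \<in> topspace ?T" for x
        using that unfolding topspace_product_topology PiE_iff by simp
      show ?thesis
      proof (rule set_eqI)
        fix x
        show "x \<in> conf m -` (UNIV - {w. length w = n \<and> set w \<subseteq> {- R..R}}) \<inter> topspace ?T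
            \<longleftrightarrow> x \<in> topspace ?T - PiE {..<m} (\<lambda>_. {- R..R})"
        proof (cases "x \<in> topspace ?T")
          case True
          then show ?thesis
            by (simp only: c1 c2[OF True] Int_iff Diff_iff vimage_eq UNIV_I simp_thms)
        qed (simp only: Int_iff Diff_iff simp_thms)
      qed
    qed
    moreover have "closedin ?T (PiE {..<m} (\<lambda>_. {- R..R}))"
      by (subst closedin_product_topology) auto
    ultimately show ?thesis by (simp only: openin_diff openin_topspace)
  next
    case False
    then have "conf m -` (UNIV - {w. length w = n \<and> set w \<subseteq> {- R..R}}) \<inter> topspace ?T = topspace ?T" by auto
    then show ?thesis by (simp only: openin_topspace)
  qed
qed simp

text \<open>Continuity is checked in coordinates, where only lists of length \<open>n\<close>
  matter. The support lies in a closed and compact cube of such lists.\<close>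

lemma sym_bump_test:
  fixes x :: "'k::complex_hilbert"
  shows "sym_bump n a b m x \<in> test_functions"
  unfolding test_functions_def
proof (intro CollectI conjI symmetric_sym_bump continuous_map_from_conf)
  fix j :: nat
  let ?T = "product_topology (\<lambda>_. euclideanreal) {..<j}"
  show "continuous_map ?T euclidean (\<lambda>y. sym_bump n a b m x (conf j y))"
  proof (cases "j = n")
    case True
    have "continuous_map ?T euclideanreal (\<lambda>y. bump (a i) (b i) m (y (p i)))" if "i < n" "p permutes {..<n}" for i p
    proof -
      have "p i \<in> {..<j}" using permutes_in_image[OF that(2), of i] that(1) True by simp
      then have "continuous_map ?T euclideanreal (\<lambda>y. y (p i))"
        by (rule continuous_map_product_projection)
      moreover have "continuous_map euclideanreal euclideanreal (bump (a i) (b i) m)"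
        by (simp add: continuous_bump)
      ultimately show ?thesis
        using continuous_map_compose[of ?T euclideanreal "\<lambda>y. y (p i)" euclideanreal "bump (a i) (b i) m"]
        by (simp add: comp_def)
    qed
    then have "continuous_map ?T euclideanreal (\<lambda>y. \<Sum>p | p permutes {..<n}. \<Prod>i<n. bump (a i) (b i) m (y (p i)))"
      by (intro continuous_map_sum continuous_map_prod finite_permutes_less) auto
    moreover have "continuous_map euclideanreal euclidean (\<lambda>r. r *\<^sub>R x)"
      by (simp add: continuous_on_scaleR)
    ultimately show ?thesis
      unfolding True sym_bump_conf
      using continuous_map_compose[of ?T euclideanreal _ euclidean "\<lambda>r. r *\<^sub>R x"]
      by (simp add: comp_def True)
  qed (simp add: sym_bump_def)
next
  obtain R where R: "n \<le> R" "\<And>i. i < n \<Longrightarrow> {a i<..<b i} \<subseteq> {- real R..real R}"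
    using bump_support_bound[of n a b] by metis
  let ?K = "{w. length w = n \<and> set w \<subseteq> {- real R..real R}}"
  have "{w. sym_bump n a b m x w \<noteq> 0} \<subseteq> ?K"
    using sym_bump_support[of n a b R m x, OF R(2)] by blast
  then have "conf_topology closure_of {w. sym_bump n a b m x w \<noteq> 0} \<subseteq> ?K"
    by (rule closure_of_minimal[OF _ closedin_conf_cube])
  then show "compactin conf_topology (conf_topology closure_of {w. sym_bump n a b m x w \<noteq> 0})"
    by (rule closed_compactin[OF compactin_conf_cube _ closedin_closure_of])
qed

text \<open>The fundamental lemma of the calculus of variations for symmetric vector-valued
  functions. For a fixed number of points and a fixed vector \<open>x\<close>, testing with
  \<open>sym_bump n a b m x\<close> reduces it to scalar functions of n real variables.\<close>

theorem conf_AE_zeroI: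
  fixes h :: "real list \<Rightarrow> 'k::{complex_hilbert, second_countable_topology}"
  assumes hm [measurable]: "h \<in> borel_measurable conf_measure" and sym: "symmetric h"
    and int: "\<And>R. integrable conf_measure (\<lambda>w. indicator (conf_box R) w * norm (h w))"
    and zero: "\<And>\<phi>. \<phi> \<in> test_functions \<Longrightarrow> \<phi> \<in> bfun \<Longrightarrow> (LINT w|conf_measure. rin (\<phi> w) (h w)) = 0"
  shows "AE w in conf_measure. h w = 0"
proof -
  have comp: "AE y in Rpow n. rin x (h (conf n y)) = 0" for n x
  proof (rule Rpow_AE_zeroI)
    let ?k = "\<lambda>y. rin x (h (conf n y))"
    show km: "?k \<in> borel_measurable (Rpow n)" by measurable
    have ind: "(\<Prod>i<n. indicator {- real R..real R} (y i)) = (indicator {w. length w = n \<and> set w \<subseteq> {- real R..real R}} (conf n y) :: real)" for R y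
    proof (cases "\<forall>i<n. y i \<in> {- real R..real R}")
      case True
      then have "conf n y \<in> {w. length w = n \<and> set w \<subseteq> {- real R..real R}}" by (auto simp: conf_def)
      moreover have "(\<Prod>i<n. indicator {- real R..real R} (y i)) = (1 :: real)"
        using True by (intro prod.neutral) auto
      ultimately show ?thesis by simp
    next
      case False
      then obtain i where "i < n" "y i \<notin> {- real R..real R}" by blast
      then have "(\<Prod>i<n. indicator {- real R..real R} (y i)) = (0 :: real)"
        by (intro prod_zero bexI[of _ i]) simp_all
      moreover have "conf n y \<notin> {w. length w = n \<and> set w \<subseteq> {- real R..real R}}"
        using \<open>i < n\<close> \<open>y i \<notin> {- real R..real R}\<close> by (auto simp: conf_def image_subset_iff)
      ultimately show ?thesis by simp
    qed
    show intR: "integrable (Rpow n) (\<lambda>y. (\<Prod>i<n. indicator {- real R..real R} (y i)) * ?k y)" for R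
      unfolding ind
    proof (rule integral_conf_length(1)[where F = "\<lambda>w. indicator {w. length w = n \<and> set w \<subseteq> {- real R..real R}} w * rin x (h w)"])
      let ?A = "{w. length w = n \<and> set w \<subseteq> {- real R..real R}}"
      have "Measurable.pred conf_measure (\<lambda>w. length w = n \<and> set w \<subseteq> {- real R..real R})" by measurable
      then have [measurable]: "?A \<in> sets conf_measure" by (simp add: pred_def space_conf_measure)
      show "integrable conf_measure (\<lambda>w. indicator ?A w * rin x (h w))"
      proof (rule Bochner_Integration.integrable_bound)
        show "integrable conf_measure (\<lambda>w. norm x * (indicator (conf_box (max n R)) w * norm (h w)))"
          by (intro integrable_mult_right int)
        have "\<bar>indicator ?A w * rin x (h w)\<bar> \<le> norm x * (indicator (conf_box (max n R)) w * norm (h w))" for w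
        proof (cases "w \<in> ?A")
          case True
          have "{- real R..real R} \<subseteq> {- real (max n R)..real (max n R)}" by auto
          then have "set w \<subseteq> {- real (max n R)..real (max n R)}" using True by (blast intro: order_trans)
          then have "w \<in> conf_box (max n R)" using True by (simp add: conf_box_def)
          then show ?thesis using True rin_Cauchy_Schwarz[of x "h w"] by simp
        qed simp
        then show "AE w in conf_measure. norm (indicator ?A w * rin x (h w)) \<le> norm (norm x * (indicator (conf_box (max n R)) w * norm (h w)))"
          by (intro AE_I2) (auto intro: order_trans[OF _ abs_ge_self])
      qed measurable
    qed simp
    \<comment> \<open>By symmetry of \<open>h\<close> and invariance of Lebesgue measure all
      permuted products of bumps have the same integral. Testing with \<open>?\<phi>\<close> thus
      gives a nonzero multiple of the integral in question.\<close>
    show "(LINT y|Rpow n. (\<Prod>i<n. bump (a i) (b i) m (y i)) * ?k y) = 0" for a b m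
    proof -
      let ?G = "\<lambda>y. (\<Prod>i<n. bump (a i) (b i) m (y i)) * ?k y"
      let ?T = "\<lambda>p y. \<lambda>i\<in>{..<n}. y (p i)"
      let ?\<phi> = "sym_bump n a b m x"
      obtain R where R: "n \<le> R" "\<And>i. i < n \<Longrightarrow> {a i<..<b i} \<subseteq> {- real R..real R}"
        using bump_support_bound[of n a b] by metis
      have Gm: "?G \<in> borel_measurable (Rpow n)"
        by (intro borel_measurable_times km borel_measurable_prod
            measurable_compose[OF _ borel_measurable_continuous_onI[OF continuous_bump]]) simp
      have Gi: "integrable (Rpow n) ?G"
      proof (rule Bochner_Integration.integrable_bound[OF intR[of R] Gm], rule AE_I2)
        fix y
        have "\<bar>\<Prod>i<n. bump (a i) (b i) m (y i)\<bar> \<le> \<bar>\<Prod>i<n. indicator {- real R..real R} (y i)\<bar>"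
          unfolding abs_prod
        proof (intro prod_mono conjI abs_ge_zero)
          fix i assume "i \<in> {..<n}"
          then have "{a i<..<b i} \<subseteq> {- real R..real R}" using R(2) by simp
          then show "\<bar>bump (a i) (b i) m (y i)\<bar> \<le> \<bar>indicator {- real R..real R} (y i)\<bar>"
            using bump_bounds[of "a i" "b i" m "y i"] bump_outside[of "y i" "a i" "b i" m]
            by (cases "y i \<in> {a i<..<b i}") auto
        qed
        then show "norm (?G y) \<le> norm ((\<Prod>i<n. indicator {- real R..real R} (y i)) * ?k y)"
          unfolding real_norm_def abs_mult by (rule mult_right_mono) simp
      qed
      have perm: "integrable (Rpow n) (\<lambda>y. ?G (?T p y))" "(LINT y|Rpow n. ?G (?T p y)) = (LINT y|Rpow n. ?G y)"
        if p: "p permutes {..<n}" for p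
      proof -
        have T: "?T p \<in> Rpow n \<rightarrow>\<^sub>M Rpow n"
          using permutes_in_image[OF p] by (intro measurable_restrict) simp
        show "integrable (Rpow n) (\<lambda>y. ?G (?T p y))"
          using integrable_distr_eq[OF T Gm] Gi distr_Rpow_permute[OF p] by simp
        show "(LINT y|Rpow n. ?G (?T p y)) = (LINT y|Rpow n. ?G y)"
          using integral_distr[OF T Gm] distr_Rpow_permute[OF p] by simp
      qed
      have eq: "?G (?T p y) = (\<Prod>i<n. bump (a i) (b i) m (y (p i))) * ?k y" if p: "p permutes {..<n}" for p y
      proof -
        have "conf n (?T p y) = permute_list p (conf n y)"
        proof (rule nth_equalityI)
          fix i assume "i < length (conf n (?T p y))"
          then have i: "i < n" by simp
          then have "p i < n" using permutes_in_image[OF p, of i] by simp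
          then show "conf n (?T p y) ! i = permute_list p (conf n y) ! i"
            using i p by (simp add: conf_def permute_list_nth)
        qed simp
        then have "mset (conf n (?T p y)) = mset (conf n y)" using p by simp
        then have "h (conf n (?T p y)) = h (conf n y)" by (rule symmetricD[OF sym])
        then show ?thesis by simp
      qed
      have \<phi>: "?\<phi> \<in> bfun" by (rule sym_bump_bfun)
      obtain C S where C: "0 \<le> C" "\<And>w. norm (?\<phi> w) \<le> C * indicator (conf_box S) w"
        using bfun_bound[OF \<phi>] by metis
      note [measurable] = bfun_measurable[OF \<phi>]
      have int\<phi>: "integrable conf_measure (\<lambda>w. rin (?\<phi> w) (h w))"
      proof (rule Bochner_Integration.integrable_bound)
        show "integrable conf_measure (\<lambda>w. C * (indicator (conf_box S) w * norm (h w)))"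
          by (intro integrable_mult_right int)
        have "\<bar>rin (?\<phi> w) (h w)\<bar> \<le> C * (indicator (conf_box S) w * norm (h w))" for w
          using rin_Cauchy_Schwarz[of "?\<phi> w" "h w"] mult_right_mono[OF C(2)[of w], of "norm (h w)"] by simp
        then show "AE w in conf_measure. norm (rin (?\<phi> w) (h w)) \<le> norm (C * (indicator (conf_box S) w * norm (h w)))"
          by (intro AE_I2) (auto intro: order_trans[OF _ abs_ge_self])
      qed measurable
      have "(LINT y|Rpow n. rin (?\<phi> (conf n y)) (h (conf n y))) / fact n = (LINT w|conf_measure. rin (?\<phi> w) (h w))"
        by (rule integral_conf_length(2)[OF int\<phi>, symmetric]) (simp add: sym_bump_def rin.zero_left)
      then have "(LINT y|Rpow n. rin (?\<phi> (conf n y)) (h (conf n y))) = 0"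
        using zero[OF sym_bump_test \<phi>] by simp
      moreover have "rin (?\<phi> (conf n y)) (h (conf n y)) = (\<Sum>p | p permutes {..<n}. ?G (?T p y))" for y
        unfolding sym_bump_conf rin_scaleR_left sum_distrib_right
        by (intro sum.cong refl) (simp only: eq mem_Collect_eq)
      ultimately have "(LINT y|Rpow n. (\<Sum>p | p permutes {..<n}. ?G (?T p y))) = 0" by (simp only:)
      moreover have "(LINT y|Rpow n. (\<Sum>p | p permutes {..<n}. ?G (?T p y))) = (\<Sum>p | p permutes {..<n}. (LINT y|Rpow n. ?G (?T p y)))"
        using perm(1) by (intro Bochner_Integration.integral_sum) simp
      moreover have "\<dots> = (\<Sum>p | p permutes {..<n}. (LINT y|Rpow n. ?G y))"
        using perm(2) by (intro sum.cong refl) simp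
      moreover have "card {p. p permutes {..<n}} \<noteq> 0"
        unfolding card_0_eq[OF finite_permutes_less] using permutes_id[of "{..<n}"] by blast
      ultimately show ?thesis by simp
    qed
  qed
  \<comment> \<open>The exceptional null set depends on the vector \<open>x\<close>. Countably many
    vectors share one null set, and a dense set of vectors suffices to detect a nonzero
    value.\<close>
  obtain D :: "'k set" where D: "countable D" "\<And>X. open X \<Longrightarrow> X \<noteq> {} \<Longrightarrow> \<exists>d\<in>D. d \<in> X"
    by (rule countable_dense_setE) blast
  have "AE y in Rpow n. h (conf n y) = 0" for n
  proof -
    have "AE y in Rpow n. \<forall>x\<in>D. rin x (h (conf n y)) = 0"
      using D(1) comp by (simp add: AE_ball_countable)
    then show ?thesis
    proof eventually_elim
      case (elim y)
      show ?case
      proof (rule ccontr)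
        let ?h = "h (conf n y)"
        assume h: "?h \<noteq> 0"
        then obtain d where d: "d \<in> D" "d \<in> ball ?h (norm ?h)"
          using D(2)[of "ball ?h (norm ?h)"] by fastforce
        \<comment> \<open>Since \<open>d\<close> is orthogonal to the value of \<open>h\<close> but
          closer to it than its norm, the Cauchy-Schwarz inequality gives a contradiction.\<close>
        have "norm ?h * norm ?h = rin (?h - d) ?h"
          using elim d(1) by (simp add: rin.diff_left rin_self power2_eq_square)
        also have "\<dots> \<le> norm (?h - d) * norm ?h"
          using rin_Cauchy_Schwarz abs_le_D1 by blast
        also have "\<dots> < norm ?h * norm ?h"
          using d(2) h by (intro mult_strict_right_mono) (simp_all add: dist_norm)
        finally show False by simp
      qed
    qed
  qed
  then have "(\<integral>\<^sup>+y. ennreal (norm (h (conf n y))) \<partial>Rpow n) = 0" for n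
    by (subst nn_integral_0_iff_AE) auto
  then have "(\<integral>\<^sup>+w. ennreal (norm (h w)) \<partial>conf_measure) = 0"
    by (subst nn_integral_conf) auto
  then show ?thesis
    by (subst (asm) nn_integral_0_iff_AE) auto
qed

section \<open>Duality\<close>

lemma split3_diff:
  fixes G H :: "real list \<times> real list \<times> real list \<Rightarrow> 'b::ab_group_add"
  shows "split3 (\<lambda>z. G z - H z) w = split3 G w - split3 H w"
  by (simp add: split3_def split_sum_def sum_subtractf)

lemma split3_nonneg:
  fixes H :: "real list \<times> real list \<times> real list \<Rightarrow> real"
  assumes "\<And>z. 0 \<le> H z"
  shows "0 \<le> split3 H w" and "ennreal (split3 H w) = split3 (\<lambda>z. ennreal (H z)) w"
  using assms by (simp_all add: split3_def split_sum_def sum_nonneg sum_ennreal)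

text \<open>The integrations over \<open>a\<close> and \<open>v\<close> change places by a chain of
  transpositions of neighbouring integrals.\<close>

lemma nn_integral_conf4_exchange:
  fixes G :: "real list \<times> real list \<times> real list \<times> real list \<Rightarrow> ennreal"
  assumes [measurable]: "G \<in> borel_measurable (conf_measure \<Otimes>\<^sub>M conf_measure \<Otimes>\<^sub>M conf_measure \<Otimes>\<^sub>M conf_measure)"
  shows "(\<integral>\<^sup>+a. (\<integral>\<^sup>+b. (\<integral>\<^sup>+c. (\<integral>\<^sup>+v. G (a, b, c, v) \<partial>conf_measure) \<partial>conf_measure) \<partial>conf_measure) \<partial>conf_measure)
    = (\<integral>\<^sup>+v. (\<integral>\<^sup>+b. (\<integral>\<^sup>+c. (\<integral>\<^sup>+a. G (a, b, c, v) \<partial>conf_measure) \<partial>conf_measure) \<partial>conf_measure) \<partial>conf_measure)"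
proof -
  have "(\<integral>\<^sup>+a. (\<integral>\<^sup>+b. (\<integral>\<^sup>+c. (\<integral>\<^sup>+v. G (a, b, c, v) \<partial>conf_measure) \<partial>conf_measure) \<partial>conf_measure) \<partial>conf_measure)
      = (\<integral>\<^sup>+a. (\<integral>\<^sup>+b. (\<integral>\<^sup>+v. (\<integral>\<^sup>+c. G (a, b, c, v) \<partial>conf_measure) \<partial>conf_measure) \<partial>conf_measure) \<partial>conf_measure)"
    by (intro nn_integral_cong conf_conf.Fubini') measurable
  also have "\<dots> = (\<integral>\<^sup>+a. (\<integral>\<^sup>+v. (\<integral>\<^sup>+b. (\<integral>\<^sup>+c. G (a, b, c, v) \<partial>conf_measure) \<partial>conf_measure) \<partial>conf_measure) \<partial>conf_measure)"
    by (intro nn_integral_cong conf_conf.Fubini') measurable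
  also have "\<dots> = (\<integral>\<^sup>+v. (\<integral>\<^sup>+a. (\<integral>\<^sup>+b. (\<integral>\<^sup>+c. G (a, b, c, v) \<partial>conf_measure) \<partial>conf_measure) \<partial>conf_measure) \<partial>conf_measure)"
    by (intro conf_conf.Fubini') measurable
  also have "\<dots> = (\<integral>\<^sup>+v. (\<integral>\<^sup>+b. (\<integral>\<^sup>+a. (\<integral>\<^sup>+c. G (a, b, c, v) \<partial>conf_measure) \<partial>conf_measure) \<partial>conf_measure) \<partial>conf_measure)"
    by (intro nn_integral_cong conf_conf.Fubini') measurable
  also have "\<dots> = (\<integral>\<^sup>+v. (\<integral>\<^sup>+b. (\<integral>\<^sup>+c. (\<integral>\<^sup>+a. G (a, b, c, v) \<partial>conf_measure) \<partial>conf_measure) \<partial>conf_measure) \<partial>conf_measure)"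
    by (intro nn_integral_cong conf_conf.Fubini') measurable
  finally show ?thesis .
qed

text \<open>The three remaining arguments are the parts of a configuration; \<open>v\<close> plays
  the role of the points that the kernel operator integrates out.\<close>

definition conf4_int :: "(real list \<times> real list \<times> real list \<times> real list \<Rightarrow> real) \<Rightarrow> real list \<times> real list \<times> real list \<Rightarrow> real" where
  "conf4_int \<Phi> z = (LINT v|conf_measure. \<Phi> (fst z, fst (snd z), snd (snd z), v))"

text \<open>A bound by boxes in all four variables, which makes every order of integration
  absolutely convergent.\<close>

definition conf4_bounded :: "(real list \<times> real list \<times> real list \<times> real list \<Rightarrow> real) \<Rightarrow> bool" where
  "conf4_bounded \<Phi> \<longleftrightarrow> \<Phi> \<in> borel_measurable (conf_measure \<Otimes>\<^sub>M conf_measure \<Otimes>\<^sub>M conf_measure \<Otimes>\<^sub>M conf_measure) \<and>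
    (\<exists>D R. 0 \<le> D \<and> (\<forall>a b c v. \<bar>\<Phi> (a, b, c, v)\<bar> \<le> D * (indicator (conf_box R) a * indicator (conf_box R) b
      * indicator (conf_box R) c * indicator (conf_box R) v)))"

lemma conf4_bounded_le:
  assumes \<Phi>: "conf4_bounded \<Phi>"
    and \<Psi>: "\<Psi> \<in> borel_measurable (conf_measure \<Otimes>\<^sub>M conf_measure \<Otimes>\<^sub>M conf_measure \<Otimes>\<^sub>M conf_measure)"
    and le: "\<And>z. \<bar>\<Psi> z\<bar> \<le> \<bar>\<Phi> z\<bar>"
  shows "conf4_bounded \<Psi>"
proof -
  obtain D R where D: "0 \<le> D" "\<And>a b c v. \<bar>\<Phi> (a, b, c, v)\<bar> \<le> D * (indicator (conf_box R) a * indicator (conf_box R) b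
      * indicator (conf_box R) c * indicator (conf_box R) v)"
    using \<Phi> unfolding conf4_bounded_def by blast
  show ?thesis
    unfolding conf4_bounded_def
    by (intro conjI \<Psi> exI[of _ D] exI[of _ R] D(1) allI order_trans[OF le D(2)])
qed

lemma conf4_integrable:
  assumes "conf4_bounded \<Phi>"
  shows "integrable conf_measure (\<lambda>v. \<Phi> (a, b, c, v))"
proof -
  obtain D R where D: "0 \<le> D" "\<And>a b c v. \<bar>\<Phi> (a, b, c, v)\<bar> \<le> D * (indicator (conf_box R) a * indicator (conf_box R) b
      * indicator (conf_box R) c * indicator (conf_box R) v)"
    using assms unfolding conf4_bounded_def by blast
  have [measurable]: "\<Phi> \<in> borel_measurable (conf_measure \<Otimes>\<^sub>M conf_measure \<Otimes>\<^sub>M conf_measure \<Otimes>\<^sub>M conf_measure)"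
    using assms by (simp add: conf4_bounded_def)
  show ?thesis
  proof (rule integrable_conf_box[where C = D and R = R])
    show "norm (\<Phi> (a, b, c, v)) \<le> D * indicator (conf_box R) v" for v
    proof -
      have "indicator (conf_box R) a * indicator (conf_box R) b * indicator (conf_box R) c * indicator (conf_box R) v
          \<le> (indicator (conf_box R) v :: real)"
        by (simp add: indicator_def)
      from mult_left_mono[OF this D(1)] D(2)[of a b c v] show ?thesis by simp
    qed
  qed measurable
qed

lemma conf4_int_nonneg:
  assumes \<Phi>: "conf4_bounded \<Phi>" and pos: "\<And>z. 0 \<le> \<Phi> z"
  shows "integrable conf_measure (split3 (conf4_int \<Phi>))"
    and "(LINT w|conf_measure. split3 (conf4_int \<Phi>) w)
      = enn2real (\<integral>\<^sup>+a. (\<integral>\<^sup>+b. (\<integral>\<^sup>+c. (\<integral>\<^sup>+v. ennreal (\<Phi> (a, b, c, v)) \<partial>conf_measure) \<partial>conf_measure) \<partial>conf_measure) \<partial>conf_measure)"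
proof -
  obtain D R where D: "0 \<le> D" "\<And>a b c v. \<bar>\<Phi> (a, b, c, v)\<bar> \<le> D * (indicator (conf_box R) a * indicator (conf_box R) b
      * indicator (conf_box R) c * indicator (conf_box R) v)"
    using \<Phi> unfolding conf4_bounded_def by blast
  have m [measurable]: "\<Phi> \<in> borel_measurable (conf_measure \<Otimes>\<^sub>M conf_measure \<Otimes>\<^sub>M conf_measure \<Otimes>\<^sub>M conf_measure)"
    using \<Phi> by (simp add: conf4_bounded_def)
  have J [measurable]: "conf4_int \<Phi> \<in> borel_measurable (conf_measure \<Otimes>\<^sub>M conf_measure \<Otimes>\<^sub>M conf_measure)"
    unfolding conf4_int_def[abs_def] by (rule conf.borel_measurable_lebesgue_integral) measurable
  have J0: "0 \<le> conf4_int \<Phi> z" for z unfolding conf4_int_def by (rule integral_nonneg_AE) (simp add: pos)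
  let ?N = "\<integral>\<^sup>+a. (\<integral>\<^sup>+b. (\<integral>\<^sup>+c. (\<integral>\<^sup>+v. ennreal (\<Phi> (a, b, c, v)) \<partial>conf_measure) \<partial>conf_measure) \<partial>conf_measure) \<partial>conf_measure"
  have "(\<integral>\<^sup>+w. ennreal (split3 (conf4_int \<Phi>) w) \<partial>conf_measure) = (\<integral>\<^sup>+w. split3 (\<lambda>z. ennreal (conf4_int \<Phi> z)) w \<partial>conf_measure)"
    by (simp only: split3_nonneg(2)[OF J0])
  also have "\<dots> = (\<integral>\<^sup>+a. (\<integral>\<^sup>+b. (\<integral>\<^sup>+c. ennreal (conf4_int \<Phi> (a, b, c)) \<partial>conf_measure) \<partial>conf_measure) \<partial>conf_measure)"
    by (rule nn_integral_split3) measurable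
  also have "\<dots> = ?N"
    unfolding conf4_int_def fst_conv snd_conv
    by (intro nn_integral_cong nn_integral_eq_integral[symmetric] conf4_integrable[OF \<Phi>] AE_I2 pos)
  finally have nn: "(\<integral>\<^sup>+w. ennreal (split3 (conf4_int \<Phi>) w) \<partial>conf_measure) = ?N" .
  let ?i = "indicator (conf_box R) :: real list \<Rightarrow> ennreal" and ?\<mu> = "emeasure conf_measure (conf_box R)"
  have "?N \<le> (\<integral>\<^sup>+a. (\<integral>\<^sup>+b. (\<integral>\<^sup>+c. (\<integral>\<^sup>+v. ennreal D * ?i a * ?i b * ?i c * ?i v \<partial>conf_measure) \<partial>conf_measure) \<partial>conf_measure) \<partial>conf_measure)"
  proof (intro nn_integral_mono)
    fix a b c v
    have "\<Phi> (a, b, c, v) \<le> D * (indicator (conf_box R) a * indicator (conf_box R) b * indicator (conf_box R) c * indicator (conf_box R) v)"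
      using D(2)[of a b c v] by simp
    then show "ennreal (\<Phi> (a, b, c, v)) \<le> ennreal D * ?i a * ?i b * ?i c * ?i v"
      using pos[of "(a, b, c, v)"] by (auto simp: indicator_def ennreal_leI split: if_splits)
  qed
  also have "\<dots> = (\<integral>\<^sup>+a. (\<integral>\<^sup>+b. (\<integral>\<^sup>+c. ennreal D * ?i a * ?i b * ?i c * ?\<mu> \<partial>conf_measure) \<partial>conf_measure) \<partial>conf_measure)"
    by (simp add: nn_integral_cmult_indicator)
  also have "\<dots> = (\<integral>\<^sup>+a. (\<integral>\<^sup>+b. ennreal D * ?i a * ?i b * ?\<mu> * ?\<mu> \<partial>conf_measure) \<partial>conf_measure)"
    by (intro nn_integral_cong, subst mult.right_neutral[symmetric]) 
       (simp add: nn_integral_multc nn_integral_cmult_indicator)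
  also have "\<dots> = (\<integral>\<^sup>+a. ennreal D * ?i a * ?\<mu> * ?\<mu> * ?\<mu> \<partial>conf_measure)"
    by (intro nn_integral_cong) (simp add: nn_integral_multc nn_integral_cmult_indicator)
  also have "\<dots> = ennreal D * ?\<mu> * ?\<mu> * ?\<mu> * ?\<mu>"
    by (simp add: nn_integral_multc nn_integral_cmult_indicator)
  also have "\<dots> < top"
    using emeasure_conf_box[of R] by (simp add: ennreal_mult_less_top)
  finally have fin: "?N < top" .
  have sm: "split3 (conf4_int \<Phi>) \<in> borel_measurable conf_measure" by (rule borel_measurable_split3[OF J])
  show int: "integrable conf_measure (split3 (conf4_int \<Phi>))"
    by (rule integrableI_nonneg[OF sm]) (use nn fin split3_nonneg(1)[OF J0] in \<open>auto simp: less_top\<close>)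
  show "(LINT w|conf_measure. split3 (conf4_int \<Phi>) w) = enn2real ?N"
    unfolding nn[symmetric] by (rule integral_eq_nn_integral[OF sm]) (simp add: split3_nonneg(1)[OF J0])
qed

text \<open>By the sum-integral formula each side is an integral over four independent
  configurations, in which \<open>a\<close> and \<open>v\<close> play symmetric roles. The formula
  is available for nonnegative functions, so positive and negative parts are treated
  separately.\<close>

lemma integral_split3_exchange:
  assumes \<Phi>: "conf4_bounded \<Phi>"
  shows "(LINT w|conf_measure. split3 (conf4_int \<Phi>) w)
    = (LINT w|conf_measure. split3 (conf4_int (\<lambda>(a, b, c, v). \<Phi> (v, b, c, a))) w)"
proof -
  let ?x = "\<lambda>\<Phi>. \<lambda>(a, b, c, v). \<Phi> (v, b, c, a) :: real"
  let ?p = "\<lambda>z. max 0 (\<Phi> z)" and ?m = "\<lambda>z. max 0 (- \<Phi> z)"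
  have m [measurable]: "\<Phi> \<in> borel_measurable (conf_measure \<Otimes>\<^sub>M conf_measure \<Otimes>\<^sub>M conf_measure \<Otimes>\<^sub>M conf_measure)"
    using \<Phi> by (simp add: conf4_bounded_def)
  have bp: "conf4_bounded ?p"
  proof (rule conf4_bounded_le[OF \<Phi>])
    show "?p \<in> borel_measurable (conf_measure \<Otimes>\<^sub>M conf_measure \<Otimes>\<^sub>M conf_measure \<Otimes>\<^sub>M conf_measure)" by measurable
    show "\<bar>?p z\<bar> \<le> \<bar>\<Phi> z\<bar>" for z by (simp add: max_def)
  qed
  have bm: "conf4_bounded ?m"
  proof (rule conf4_bounded_le[OF \<Phi>])
    show "?m \<in> borel_measurable (conf_measure \<Otimes>\<^sub>M conf_measure \<Otimes>\<^sub>M conf_measure \<Otimes>\<^sub>M conf_measure)" by measurable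
    show "\<bar>?m z\<bar> \<le> \<bar>\<Phi> z\<bar>" for z by (simp add: max_def)
  qed
  have bx: "conf4_bounded (?x \<Psi>)" if b: "conf4_bounded \<Psi>" for \<Psi>
  proof -
    obtain D R where D: "0 \<le> D" "\<And>a b c v. \<bar>\<Psi> (a, b, c, v)\<bar> \<le> D * (indicator (conf_box R) a * indicator (conf_box R) b
        * indicator (conf_box R) c * indicator (conf_box R) v)"
      using b unfolding conf4_bounded_def by blast
    have [measurable]: "\<Psi> \<in> borel_measurable (conf_measure \<Otimes>\<^sub>M conf_measure \<Otimes>\<^sub>M conf_measure \<Otimes>\<^sub>M conf_measure)"
      using b by (simp add: conf4_bounded_def)
    have "\<bar>?x \<Psi> (a, b, c, v)\<bar> \<le> D * (indicator (conf_box R) a * indicator (conf_box R) b * indicator (conf_box R) c * indicator (conf_box R) v)" for a b c v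
      using D(2)[of v b c a] by (simp add: mult_ac)
    moreover have "?x \<Psi> \<in> borel_measurable (conf_measure \<Otimes>\<^sub>M conf_measure \<Otimes>\<^sub>M conf_measure \<Otimes>\<^sub>M conf_measure)"
      by measurable
    ultimately show ?thesis unfolding conf4_bounded_def using D(1) by blast
  qed
  have nonneg: "(LINT w|conf_measure. split3 (conf4_int \<Psi>) w) = (LINT w|conf_measure. split3 (conf4_int (?x \<Psi>)) w)"
    if b: "conf4_bounded \<Psi>" and pos: "\<And>z. 0 \<le> \<Psi> z" for \<Psi>
  proof -
    have [measurable]: "\<Psi> \<in> borel_measurable (conf_measure \<Otimes>\<^sub>M conf_measure \<Otimes>\<^sub>M conf_measure \<Otimes>\<^sub>M conf_measure)"
      using b by (simp add: conf4_bounded_def)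
    have posx: "0 \<le> ?x \<Psi> z" for z using pos by (simp add: case_prod_beta)
    show ?thesis
      unfolding conf4_int_nonneg(2)[OF b pos] conf4_int_nonneg(2)[OF bx[OF b] posx] case_prod_conv
      using nn_integral_conf4_exchange[of "\<lambda>z. ennreal (\<Psi> z)"] by simp
  qed
  have diff: "(LINT w|conf_measure. split3 (conf4_int \<Psi>) w)
      = (LINT w|conf_measure. split3 (conf4_int \<Psi>1) w) - (LINT w|conf_measure. split3 (conf4_int \<Psi>2) w)"
    if b: "conf4_bounded \<Psi>1" "conf4_bounded \<Psi>2" and pos: "\<And>z. 0 \<le> \<Psi>1 z" "\<And>z. 0 \<le> \<Psi>2 z"
      and eq: "\<And>z. \<Psi> z = \<Psi>1 z - \<Psi>2 z" for \<Psi> \<Psi>1 \<Psi>2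
  proof -
    have "conf4_int \<Psi> = (\<lambda>z. conf4_int \<Psi>1 z - conf4_int \<Psi>2 z)"
      unfolding conf4_int_def[abs_def] eq
      by (intro ext Bochner_Integration.integral_diff conf4_integrable b)
    then have "split3 (conf4_int \<Psi>) w = split3 (conf4_int \<Psi>1) w - split3 (conf4_int \<Psi>2) w" for w
      by (simp only: split3_diff)
    then show ?thesis
      by (simp add: Bochner_Integration.integral_diff conf4_int_nonneg(1) b pos)
  qed
  have "(LINT w|conf_measure. split3 (conf4_int \<Phi>) w)
      = (LINT w|conf_measure. split3 (conf4_int ?p) w) - (LINT w|conf_measure. split3 (conf4_int ?m) w)"
    by (rule diff[OF bp bm]) (auto simp: max_def)
  also have "\<dots> = (LINT w|conf_measure. split3 (conf4_int (?x ?p)) w) - (LINT w|conf_measure. split3 (conf4_int (?x ?m)) w)"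
    by (intro arg_cong2[where f = "(-)"] nonneg bp bm) auto
  also have "\<dots> = (LINT w|conf_measure. split3 (conf4_int (?x \<Phi>)) w)"
    by (rule diff[OF bx[OF bp] bx[OF bm], symmetric]) (auto simp: max_def case_prod_beta)
  finally show ?thesis .
qed

section \<open>Time reflection and the adjoint kernel operator\<close>

lemma map_uminus_uminus [simp]: "map uminus (map uminus w) = (w :: real list)"
  by (simp add: comp_def)

lemma bfun_reflect:
  assumes "g \<in> bfun"
  shows "(\<lambda>v. g (map uminus v)) \<in> bfun"
proof -
  obtain C R where C: "0 \<le> C" "\<And>w. norm (g w) \<le> C * indicator (conf_box R) w"
    using bfun_bound[OF assms] by metis
  note [measurable] = bfun_measurable[OF assms]
  show ?thesis
  proof (rule bfunI)
    show "symmetric (\<lambda>v. g (map uminus v))"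
      unfolding symmetric_def by (intro allI impI symmetricD[OF bfun_symmetric[OF assms]]) simp
    have "map uminus v \<in> conf_box R \<longleftrightarrow> v \<in> conf_box R" for v :: "real list"
      unfolding conf_box_def by (auto simp: image_subset_iff subset_iff)
    then show "norm (g (map uminus v)) \<le> C * indicator (conf_box R) v" for v
      using C(2)[of "map uminus v"] by (simp add: indicator_def)
  qed measurable
qed

lemma integral_conf_reflect:
  fixes F :: "real list \<Rightarrow> 'b::{banach, second_countable_topology}"
  assumes "F \<in> borel_measurable conf_measure"
  shows "(LINT v|conf_measure. F (map uminus v)) = (LINT v|conf_measure. F v)"
  using integral_distr[OF measurable_map_uminus_conf assms] by (simp add: distr_uminus_conf)

context evolution_kernel
begin

text \<open>\<open>A1\<close> and \<open>Am\<close> change places because the adjoint turns created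
  points into annihilated ones. The reflection of all times restores the time order that the adjoint
  reverses.\<close>

definition rop :: "real \<Rightarrow> real \<Rightarrow> (real list \<Rightarrow> 'k) \<Rightarrow> real list \<Rightarrow> 'k" where
  "rop s t g w = kernel_op (marked_kernel (radj Am) (radj A0) (radj A1) (radj B) (- t) (- s) [])
    (\<lambda>v. g (map uminus v)) (map uminus w)"

lemma radj_mker:
  "marked_kernel (radj Am) (radj A0) (radj A1) (radj B) (- t) (- s) [] (map uminus a) (map uminus b) (map uminus v)
    = radj (mker s t [] v b a)"
proof -
  have "radj (mker s t [] v b a)
      = tprod (radj B) (- t) (- s) (map (\<lambda>(r, X). (- r, radj X)) (map (\<lambda>r. (r, A1)) v @ map (\<lambda>r. (r, A0)) b @ map (\<lambda>r. (r, Am)) a))"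
    unfolding marked_kernel_def append_Nil by (rule radj_tprod)
  also have "\<dots> = marked_kernel (radj Am) (radj A0) (radj A1) (radj B) (- t) (- s) [] (map uminus a) (map uminus b) (map uminus v)"
    unfolding marked_kernel_def append_Nil by (rule tprod_perm) (simp add: comp_def ac_simps)
  finally show ?thesis ..
qed

text \<open>Both sides are integrals of the same function of four configurations, with the created
  and the annihilated points exchanged.\<close>

theorem mop_dual:
  assumes st: "s \<le> t" and f: "f \<in> bfun" and g: "g \<in> bfun"
  shows "(LINT w|conf_measure. rin (mop s t [] f w) (g w)) = (LINT w|conf_measure. rin (f w) (rop s t g w))"
proof -
  interpret dual: evolution_kernel "radj Am" "radj A0" "radj A1" "radj B" .
  \<comment> \<open>Here \<open>a\<close> is created, \<open>v\<close> is annihilated,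
    \<open>b\<close> is acted on by \<open>A0\<close> and kept, and \<open>c\<close> is untouched.
    Hence \<open>f\<close> sees \<open>b\<close>, \<open>c\<close>, \<open>v\<close>, and
    \<open>g\<close> sees \<open>a\<close>, \<open>b\<close>, \<open>c\<close>.\<close>
  let ?\<Phi> = "\<lambda>(a, b, c, v). rin (blinfun_apply (mker s t [] a b v) (f ((b @ c) @ v))) (g (a @ b @ c))"
  obtain C1 R1 where C1: "0 \<le> C1" "\<And>w. norm (f w) \<le> C1 * indicator (conf_box R1) w"
    using bfun_bound[OF f] by metis
  obtain C2 R2 where C2: "0 \<le> C2" "\<And>w. norm (g w) \<le> C2 * indicator (conf_box R2) w"
    using bfun_bound[OF g] by metis
  note [measurable] = bfun_measurable[OF f] bfun_measurable[OF g]
  have K: "1 \<le> mbound []" by (rule mbound)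
  have "conf4_bounded ?\<Phi>"
    unfolding conf4_bounded_def
  proof (intro conjI)
    show "?\<Phi> \<in> borel_measurable (conf_measure \<Otimes>\<^sub>M conf_measure \<Otimes>\<^sub>M conf_measure \<Otimes>\<^sub>M conf_measure)"
      by measurable
    let ?R = "max R1 R2" and ?D = "exp ((t - s) * norm B) * mbound [] ^ (R2 + R2 + R1) * C1 * C2"
    have "\<bar>?\<Phi> (a, b, c, v)\<bar> \<le> ?D * (indicator (conf_box ?R) a * indicator (conf_box ?R) b * indicator (conf_box ?R) c * indicator (conf_box ?R) v)"
      for a b c v
    proof -
      let ?x = "blinfun_apply (mker s t [] a b v) (f ((b @ c) @ v))"
      have 1: "\<bar>?\<Phi> (a, b, c, v)\<bar> \<le> norm ?x * norm (g (a @ b @ c))"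
        using rin_Cauchy_Schwarz by simp
      have 2: "norm ?x \<le> exp ((t - s) * norm B) * mbound [] ^ (length a + length b + R1) * C1 * indicator (conf_box R1) v"
        using norm_mker_apply[OF st C1(2)[of "(b @ c) @ v"] C1(1), of "[]" a b] by simp
      show ?thesis
      proof (cases "a @ b @ c \<in> conf_box R2 \<and> v \<in> conf_box R1")
        case True
        then have abc: "a \<in> conf_box R2" "b \<in> conf_box R2" "c \<in> conf_box R2" "v \<in> conf_box R1"
          using conf_box_appendD by blast+
        have R: "x \<in> conf_box ?R" if "x \<in> conf_box R1 \<or> x \<in> conf_box R2" for x
          using that conf_box_mono[of R1 ?R] conf_box_mono[of R2 ?R] by auto
        have "norm ?x \<le> exp ((t - s) * norm B) * mbound [] ^ (length a + length b + R1) * C1"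
          using 2 abc by simp
        also have "\<dots> \<le> exp ((t - s) * norm B) * mbound [] ^ (R2 + R2 + R1) * C1"
          using abc K C1(1) by (intro mult_right_mono mult_left_mono power_increasing) (auto simp: conf_box_def)
        finally have "norm ?x * norm (g (a @ b @ c)) \<le> ?D"
          using C2(1) C2(2)[of "a @ b @ c"] True C1(1) K by (intro mult_mono) auto
        with 1 show ?thesis using abc R by simp
      next
        case False
        then have 0: "norm ?x * norm (g (a @ b @ c)) = 0"
          using 2 C2(2)[of "a @ b @ c"] by auto
        have "\<bar>?\<Phi> (a, b, c, v)\<bar> \<le> 0" using 1 unfolding 0 .
        also have "0 \<le> ?D * (indicator (conf_box ?R) a * indicator (conf_box ?R) b * indicator (conf_box ?R) c * indicator (conf_box ?R) v)"
          using K C1(1) C2(1) by simp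
        finally show ?thesis .
      qed
    qed
    moreover have "0 \<le> ?D" using K C1(1) C2(1) by simp
    ultimately show "\<exists>D R. 0 \<le> D \<and> (\<forall>a b c v. \<bar>?\<Phi> (a, b, c, v)\<bar> \<le> D * (indicator (conf_box R) a * indicator (conf_box R) b
      * indicator (conf_box R) c * indicator (conf_box R) v))" by blast
  qed
  from integral_split3_exchange[OF this]
  have ex: "(LINT w|conf_measure. split3 (conf4_int ?\<Phi>) w)
    = (LINT w|conf_measure. split3 (conf4_int (\<lambda>(a, b, c, v). ?\<Phi> (v, b, c, a))) w)" .
  \<comment> \<open>By symmetry the configuration may be replaced by the concatenation of its parts,
    as the form of \<open>?\<Phi>\<close> requires.\<close>
  have parts: "h w = h (nths w \<alpha> @ nths w \<beta> @ nths w ({..<length w} - \<alpha> - \<beta>))"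
      "h (nths w ({..<length w} - \<alpha>) @ v) = h ((nths w \<beta> @ nths w ({..<length w} - \<alpha> - \<beta>)) @ v)"
    if h: "symmetric h" and ab: "\<alpha> \<subseteq> {..<length w}" "\<beta> \<subseteq> {..<length w}" "\<alpha> \<inter> \<beta> = {}" for h :: "real list \<Rightarrow> 'k" and w v \<alpha> \<beta>
  proof -
    have b: "\<beta> \<subseteq> {..<length w} - \<alpha>" using ab by auto
    note mset_nths_Diff[OF ab(1), of w] mset_nths_Diff[OF b, of w]
    moreover have "nths w {..<length w} = w" by (rule nths_all) auto
    ultimately show "h w = h (nths w \<alpha> @ nths w \<beta> @ nths w ({..<length w} - \<alpha> - \<beta>))"
      "h (nths w ({..<length w} - \<alpha>) @ v) = h ((nths w \<beta> @ nths w ({..<length w} - \<alpha> - \<beta>)) @ v)"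
      by (intro symmetricD[OF h]; simp)+
  qed
  have L: "rin (mop s t [] f w) (g w) = split3 (conf4_int ?\<Phi>) w" for w
  proof -
    have "rin (mop s t [] f w) (g w) = split_sum (length w) (\<lambda>\<alpha> \<beta>. rin (LINT v|conf_measure.
        blinfun_apply (mker s t [] (nths w \<alpha>) (nths w \<beta>) v) (f (nths w ({..<length w} - \<alpha>) @ v))) (g w))"
      unfolding kernel_op_eq_split_sum split_sum_def by (simp add: rin.sum_left)
    also have "\<dots> = split3 (conf4_int ?\<Phi>) w"
      unfolding split3_def conf4_int_def fst_conv snd_conv case_prod_conv
    proof (rule split_sum_cong)
      fix \<alpha> \<beta> assume ab: "\<alpha> \<subseteq> {..<length w}" "\<beta> \<subseteq> {..<length w}" "\<alpha> \<inter> \<beta> = {}"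
      show "rin (LINT v|conf_measure. blinfun_apply (mker s t [] (nths w \<alpha>) (nths w \<beta>) v) (f (nths w ({..<length w} - \<alpha>) @ v))) (g w)
        = (LINT v|conf_measure. rin (blinfun_apply (mker s t [] (nths w \<alpha>) (nths w \<beta>) v)
            (f ((nths w \<beta> @ nths w ({..<length w} - \<alpha> - \<beta>)) @ v))) (g (nths w \<alpha> @ nths w \<beta> @ nths w ({..<length w} - \<alpha> - \<beta>))))"
        unfolding parts(2)[OF bfun_symmetric[OF f] ab, symmetric] parts(1)[OF bfun_symmetric[OF g] ab, symmetric]
        by (rule integral_bounded_linear[OF rin.bounded_linear_left integrable_mker_bfun[OF st f], symmetric])
    qed
    finally show ?thesis .
  qed
  have "rin (f w) (rop s t g w) = split3 (conf4_int (\<lambda>(a, b, c, v). ?\<Phi> (v, b, c, a))) w" for w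
  proof -
    let ?k = "marked_kernel (radj Am) (radj A0) (radj A1) (radj B) (- t) (- s) []"
    let ?g = "\<lambda>v. g (map uminus v)"
    let ?n = "\<lambda>I. nths w I"
    have g': "?g \<in> bfun" by (rule bfun_reflect[OF g])
    have st': "- t \<le> - s" using st by simp
    have "rin (f w) (rop s t g w) = split_sum (length w) (\<lambda>\<alpha> \<beta>. rin (f w) (LINT v|conf_measure.
        blinfun_apply (?k (map uminus (?n \<alpha>)) (map uminus (?n \<beta>)) v) (?g (map uminus (?n ({..<length w} - \<alpha>)) @ v))))"
      unfolding rop_def kernel_op_eq_split_sum split_sum_def by (simp add: rin.sum_right nths_map)
    also have "\<dots> = split3 (conf4_int (\<lambda>(a, b, c, v). ?\<Phi> (v, b, c, a))) w"
      unfolding split3_def conf4_int_def fst_conv snd_conv case_prod_conv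
    proof (rule split_sum_cong)
      fix \<alpha> \<beta> assume ab: "\<alpha> \<subseteq> {..<length w}" "\<beta> \<subseteq> {..<length w}" "\<alpha> \<inter> \<beta> = {}"
      let ?a = "?n \<alpha>" and ?b = "?n \<beta>" and ?c = "?n ({..<length w} - \<alpha>)" and ?d = "?n ({..<length w} - \<alpha> - \<beta>)"
      let ?F = "\<lambda>v. rin (f w) (blinfun_apply (?k (map uminus ?a) (map uminus ?b) v) (?g (map uminus ?c @ v)))"
      note [measurable] = bfun_measurable[OF g']
      have "rin (f w) (LINT v|conf_measure. blinfun_apply (?k (map uminus ?a) (map uminus ?b) v) (?g (map uminus ?c @ v)))
          = (LINT v|conf_measure. ?F v)"
        by (rule integral_bounded_linear[OF rin.bounded_linear_right dual.integrable_mker_bfun[OF st' g'], symmetric])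
      also have "\<dots> = (LINT v|conf_measure. ?F (map uminus v))"
        by (rule integral_conf_reflect[symmetric]) measurable
      also have "\<dots> = (LINT v|conf_measure. rin (blinfun_apply (mker s t [] v ?b ?a) (f ((?b @ ?d) @ ?a))) (g (v @ ?b @ ?d)))"
      proof (rule Bochner_Integration.integral_cong[OF refl])
        fix v
        have "f w = f ((?b @ ?d) @ ?a)"
          unfolding parts(1)[OF bfun_symmetric[OF f] ab] by (rule symmetricD[OF bfun_symmetric[OF f]]) simp
        moreover have "g (?c @ v) = g (v @ ?b @ ?d)"
          unfolding parts(2)[OF bfun_symmetric[OF g] ab] by (rule symmetricD[OF bfun_symmetric[OF g]]) simp
        ultimately show "?F (map uminus v) = rin (blinfun_apply (mker s t [] v ?b ?a) (f ((?b @ ?d) @ ?a))) (g (v @ ?b @ ?d))"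
          by (simp only: radj_mker rin_radj map_append map_uminus_uminus)
      qed
      finally show "rin (f w) (LINT v|conf_measure. blinfun_apply (?k (map uminus ?a) (map uminus ?b) v) (?g (map uminus ?c @ v)))
          = (LINT v|conf_measure. rin (blinfun_apply (mker s t [] v ?b ?a) (f ((?b @ ?d) @ ?a))) (g (v @ ?b @ ?d)))" .
    qed
    finally show ?thesis .
  qed
  with L ex show ?thesis by (simp only:)
qed

end

section \<open>The Fock space\<close>

lemma cinner_scaleC_left: "cinner (scaleC c x) y = cnj c * cinner x (y :: 'k::complex_hilbert)"
  by (metis cinner_commute cinner_scaleC_right complex_cnj_cnj complex_cnj_mult)

lemma norm_scaleC: "norm (scaleC c x) = cmod c * norm (x :: 'k::complex_hilbert)"
proof -
  have "complex_of_real ((norm (scaleC c x))\<^sup>2) = cnj c * c * complex_of_real ((norm x)\<^sup>2)"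
    unfolding cinner_self[symmetric] cinner_scaleC_left cinner_scaleC_right by simp
  also have "\<dots> = complex_of_real ((cmod c * norm x)\<^sup>2)"
    by (simp add: power_mult_distrib complex_norm_square mult.commute del: of_real_power)
  finally have "(norm (scaleC c x))\<^sup>2 = (cmod c * norm x)\<^sup>2" by (simp only: of_real_eq_iff)
  then show ?thesis by (simp add: power2_eq_iff_nonneg)
qed

lemma bounded_linear_scaleC: "bounded_linear (scaleC c :: 'k::complex_hilbert \<Rightarrow> 'k)"
proof (rule bounded_linear_intro[where K = "cmod c"])
  show "scaleC c (x + y) = scaleC c x + scaleC c y" for x y :: 'k by (rule scaleC_add_right)
  show "scaleC c (r *\<^sub>R x) = r *\<^sub>R scaleC c x" for r and x :: 'k
    by (simp add: scaleR_scaleC scaleC_scaleC mult.commute)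
  show "norm (scaleC c x) \<le> norm x * cmod c" for x :: 'k by (simp add: norm_scaleC)
qed

text \<open>With this identity measurability and bounds for the complex scalar product follow from
  those for \<open>rin\<close>.\<close>

lemma Im_cinner: "Im (cinner x y) = rin x (scaleC (- \<i>) y)"
  by (simp add: rin_def cinner_scaleC_right)

lemma borel_measurable_cinner:
  fixes f g :: "'a \<Rightarrow> 'k::{complex_hilbert, second_countable_topology}"
  assumes [measurable]: "f \<in> borel_measurable M" "g \<in> borel_measurable M"
  shows "(\<lambda>w. cinner (f w) (g w)) \<in> borel_measurable M"
proof -
  have [measurable]: "(\<lambda>w. scaleC (- \<i>) (g w)) \<in> borel_measurable M"
    by (rule measurable_compose[OF assms(2) borel_measurable_continuous_onI])
       (rule linear_continuous_on[OF bounded_linear_scaleC])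
  have "(\<lambda>w. rin (f w) (g w)) \<in> borel_measurable M" "(\<lambda>w. rin (f w) (scaleC (- \<i>) (g w))) \<in> borel_measurable M"
    by measurable
  then show ?thesis
    unfolding borel_measurable_complex_iff Im_cinner rin_def by (intro conjI)
qed

lemma norm_cinner_le: "cmod (cinner x y) \<le> (norm x)\<^sup>2 + (norm y)\<^sup>2"
proof -
  have "cmod (cinner x y) \<le> \<bar>Re (cinner x y)\<bar> + \<bar>Im (cinner x y)\<bar>" by (rule cmod_le)
  also have "\<dots> \<le> norm x * norm y + norm x * norm (scaleC (- \<i>) y)"
    unfolding Im_cinner rin_def[symmetric] by (intro add_mono rin_Cauchy_Schwarz)
  also have "\<dots> \<le> (norm x)\<^sup>2 + (norm y)\<^sup>2"
    using zero_le_power2[of "norm x - norm y"] by (simp add: norm_scaleC power2_diff)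
  finally show ?thesis .
qed

lemma Fock_measurable: "f \<in> Fock \<Longrightarrow> f \<in> borel_measurable conf_measure"
  by (simp add: Gamma_space_def)

lemma Fock_symmetric: "f \<in> Fock \<Longrightarrow> symmetric f"
  by (simp add: Gamma_space_def)

lemma Fock_iff:
  fixes f :: "real list \<Rightarrow> 'k::{complex_hilbert, second_countable_topology}"
  shows "f \<in> Fock \<longleftrightarrow> f \<in> borel_measurable conf_measure \<and> symmetric f \<and> integrable conf_measure (\<lambda>w. (norm (f w))\<^sup>2)"
proof -
  have "Gamma_norm2 0 f < \<infinity> \<longleftrightarrow> integrable conf_measure (\<lambda>w. (norm (f w))\<^sup>2)"
    if [measurable]: "f \<in> borel_measurable conf_measure"
    unfolding Gamma_norm2_eq_wnorm2 wnorm2_0 by (subst integrable_iff_bounded) simp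
  then show ?thesis by (auto simp: Gamma_space_def)
qed

lemma Fock_integrable:
  fixes f :: "real list \<Rightarrow> 'k::{complex_hilbert, second_countable_topology}"
  shows "f \<in> Fock \<Longrightarrow> integrable conf_measure (\<lambda>w. (norm (f w))\<^sup>2)"
  using Fock_iff by blast

lemma bfun_Fock:
  fixes f :: "real list \<Rightarrow> 'k::{complex_hilbert, second_countable_topology}"
  shows "f \<in> bfun \<Longrightarrow> f \<in> Fock"
  unfolding Fock_iff by (intro conjI bfun_measurable bfun_symmetric bfun_norm2_finite)

lemma Fock_diff:
  fixes f g :: "real list \<Rightarrow> 'k::{complex_hilbert, second_countable_topology}"
  assumes f: "f \<in> Fock" and g: "g \<in> Fock"
  shows "(\<lambda>w. f w - g w) \<in> Fock"
  unfolding Fock_iff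
proof (intro conjI)
  note [measurable] = Fock_measurable[OF f] Fock_measurable[OF g]
  show "(\<lambda>w. f w - g w) \<in> borel_measurable conf_measure" by measurable
  show "symmetric (\<lambda>w. f w - g w)"
    unfolding symmetric_def
  proof (intro allI impI)
    fix v w :: "real list" assume "mset v = mset w"
    then show "f v - g v = f w - g w"
      using symmetricD[OF Fock_symmetric[OF f]] symmetricD[OF Fock_symmetric[OF g]] by metis
  qed
  show "integrable conf_measure (\<lambda>w. (norm (f w - g w))\<^sup>2)"
  proof (rule Bochner_Integration.integrable_bound)
    show "integrable conf_measure (\<lambda>w. 2 * (norm (f w))\<^sup>2 + 2 * (norm (g w))\<^sup>2)"
      by (intro Bochner_Integration.integrable_add integrable_mult_right Fock_integrable f g)
    have "(norm (x - y))\<^sup>2 \<le> 2 * (norm x)\<^sup>2 + 2 * (norm y)\<^sup>2" for x y :: 'k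
    proof -
      have "(norm (x - y))\<^sup>2 \<le> (norm x + norm y)\<^sup>2" by (intro power_mono norm_triangle_ineq4) simp
      also have "\<dots> \<le> 2 * (norm x)\<^sup>2 + 2 * (norm y)\<^sup>2"
        using zero_le_power2[of "norm x - norm y"] by (simp add: power2_sum power2_diff)
      finally show ?thesis .
    qed
    then show "AE w in conf_measure. norm ((norm (f w - g w))\<^sup>2) \<le> norm (2 * (norm (f w))\<^sup>2 + 2 * (norm (g w))\<^sup>2)"
      by (intro AE_I2) simp
  qed measurable
qed

section \<open>The real scalar product of the Fock space\<close>

definition rinner :: "(real list \<Rightarrow> 'k::complex_hilbert) \<Rightarrow> (real list \<Rightarrow> 'k) \<Rightarrow> real" where
  "rinner f g = (LINT w|conf_measure. rin (f w) (g w))"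

lemma integrable_cinner:
  fixes f g :: "real list \<Rightarrow> 'k::{complex_hilbert, second_countable_topology}"
  assumes f: "f \<in> Fock" and g: "g \<in> Fock"
  shows "integrable conf_measure (\<lambda>w. cinner (f w) (g w))"
proof (rule Bochner_Integration.integrable_bound)
  show "integrable conf_measure (\<lambda>w. (norm (f w))\<^sup>2 + (norm (g w))\<^sup>2)"
    by (intro Bochner_Integration.integrable_add Fock_integrable f g)
  show "AE w in conf_measure. norm (cinner (f w) (g w)) \<le> norm ((norm (f w))\<^sup>2 + (norm (g w))\<^sup>2)"
    by (intro AE_I2) (simp add: norm_cinner_le)
qed (rule borel_measurable_cinner[OF Fock_measurable[OF f] Fock_measurable[OF g]])

lemma integrable_rin:
  fixes f g :: "real list \<Rightarrow> 'k::{complex_hilbert, second_countable_topology}"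
  assumes "f \<in> Fock" "g \<in> Fock"
  shows "integrable conf_measure (\<lambda>w. rin (f w) (g w))"
  unfolding rin_def by (rule integrable_bounded_linear[OF bounded_linear_Re integrable_cinner[OF assms]])

lemma Re_Fock_inner:
  fixes f g :: "real list \<Rightarrow> 'k::{complex_hilbert, second_countable_topology}"
  assumes "f \<in> Fock" "g \<in> Fock"
  shows "Re (Fock_inner f g) = rinner f g"
  unfolding Fock_inner_def rinner_def rin_def
  by (rule integral_bounded_linear[OF bounded_linear_Re integrable_cinner[OF assms], symmetric])

lemma rinner_commute: "rinner f g = rinner g f"
  unfolding rinner_def by (simp only: rin_commute)

lemma rinner_diff_right:
  fixes f g h :: "real list \<Rightarrow> 'k::{complex_hilbert, second_countable_topology}"
  assumes "f \<in> Fock" "g \<in> Fock" "h \<in> Fock"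
  shows "rinner f (\<lambda>w. g w - h w) = rinner f g - rinner f h"
  unfolding rinner_def rin.diff_right
  by (rule Bochner_Integration.integral_diff) (intro integrable_rin assms)+

lemma rinner_self_nonneg: "0 \<le> rinner f f"
  unfolding rinner_def rin_self by (rule integral_nonneg_AE) simp

lemma wnorm2_0_rinner:
  fixes f :: "real list \<Rightarrow> 'k::{complex_hilbert, second_countable_topology}"
  assumes "f \<in> Fock"
  shows "wnorm2 0 f = ennreal (rinner f f)"
  unfolding wnorm2_0 rinner_def rin_self
  by (rule nn_integral_eq_integral[OF Fock_integrable[OF assms]]) simp

lemma rinner_diff_self:
  fixes f g :: "real list \<Rightarrow> 'k::{complex_hilbert, second_countable_topology}"
  assumes f: "f \<in> Fock" and g: "g \<in> Fock"
  shows "rinner (\<lambda>w. f w - g w) (\<lambda>w. f w - g w) = rinner f f - 2 * rinner f g + rinner g g"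
proof -
  note d = Fock_diff[OF f g]
  have "rinner (\<lambda>w. f w - g w) (\<lambda>w. f w - g w) = rinner f (\<lambda>w. f w - g w) - rinner g (\<lambda>w. f w - g w)"
    unfolding rinner_diff_right[OF d f g] by (simp only: rinner_commute[of "\<lambda>w. f w - g w"])
  also have "\<dots> = rinner f f - rinner f g - (rinner g f - rinner g g)"
    by (simp only: rinner_diff_right[OF f f g] rinner_diff_right[OF g f g])
  finally show ?thesis by (simp add: rinner_commute[of g f])
qed

section \<open>A unitary operator and its adjoint\<close>

locale unitary_pair =
  fixes V W :: "(real list \<Rightarrow> 'k::{complex_hilbert, second_countable_topology}) \<Rightarrow> real list \<Rightarrow> 'k"
  assumes unitary: "unitary_on_Fock V" and adjoint: "adjoint_on_Fock V W"
begin

lemma V_Fock: "f \<in> Fock \<Longrightarrow> V f \<in> Fock"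
  using unitary unfolding unitary_on_Fock_def by blast

lemma W_Fock: "f \<in> Fock \<Longrightarrow> W f \<in> Fock"
  using adjoint unfolding adjoint_on_Fock_def by blast

lemma V_isometry:
  assumes "f \<in> Fock" "g \<in> Fock"
  shows "rinner (V f) (V g) = rinner f g"
proof -
  have "Fock_inner (V f) (V g) = Fock_inner f g"
    using unitary assms unfolding unitary_on_Fock_def by blast
  then show ?thesis
    using Re_Fock_inner[OF V_Fock[OF assms(1)] V_Fock[OF assms(2)]] Re_Fock_inner[OF assms] by simp
qed

lemma V_W:
  assumes "f \<in> Fock" "g \<in> Fock"
  shows "rinner (V f) g = rinner f (W g)"
proof -
  have "Fock_inner (V f) g = Fock_inner f (W g)"
    using adjoint assms unfolding adjoint_on_Fock_def by blast
  then show ?thesis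
    using Re_Fock_inner[OF V_Fock[OF assms(1)] assms(2)] Re_Fock_inner[OF assms(1) W_Fock[OF assms(2)]] by simp
qed

text \<open>Expanding \<open>0 \<le> \<parallel>V d - e\<parallel>\<^sup>2\<close>.\<close>

lemma rinner_le:
  assumes d: "d \<in> Fock" and e: "e \<in> Fock" and eq: "rinner d d = rinner (V d) e"
  shows "rinner d d \<le> rinner e e"
proof -
  have "0 \<le> rinner (V d) (V d) - 2 * rinner (V d) e + rinner e e"
    using rinner_self_nonneg[of "\<lambda>w. V d w - e w"] unfolding rinner_diff_self[OF V_Fock[OF d] e] .
  then show ?thesis using V_isometry[OF d d] eq by simp
qed

lemma W_contraction: "g \<in> Fock \<Longrightarrow> rinner (W g) (W g) \<le> rinner g g"
  by (rule rinner_le) (simp_all add: W_Fock V_W)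

text \<open>\<open>adjoint_on_Fock\<close> does not state linearity of \<open>W\<close>. In the
  scalar product with \<open>W f - W g\<close> the operator is moved to the other factor, where
  \<open>rinner_le\<close> applies.\<close>

lemma W_diff:
  assumes "f \<in> Fock" "g \<in> Fock"
  shows "rinner (\<lambda>w. W f w - W g w) (\<lambda>w. W f w - W g w) \<le> rinner (\<lambda>w. f w - g w) (\<lambda>w. f w - g w)"
proof (rule rinner_le)
  let ?d = "\<lambda>w. W f w - W g w"
  show d: "?d \<in> Fock" by (intro Fock_diff W_Fock assms)
  show "(\<lambda>w. f w - g w) \<in> Fock" by (intro Fock_diff assms)
  have "rinner ?d ?d = rinner ?d (W f) - rinner ?d (W g)"
    by (rule rinner_diff_right[OF d W_Fock[OF assms(1)] W_Fock[OF assms(2)]])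
  also have "\<dots> = rinner (V ?d) f - rinner (V ?d) g"
    by (simp only: V_W[OF d assms(1)] V_W[OF d assms(2)])
  also have "\<dots> = rinner (V ?d) (\<lambda>w. f w - g w)"
    by (rule rinner_diff_right[OF V_Fock[OF d] assms, symmetric])
  finally show "rinner ?d ?d = rinner (V ?d) (\<lambda>w. f w - g w)" .
qed

text \<open>Expanding the square of the difference leaves scalar products only, and these are
  preserved.\<close>

lemma V_diff:
  assumes "f \<in> Fock" "g \<in> Fock"
  shows "rinner (\<lambda>w. V f w - V g w) (\<lambda>w. V f w - V g w) \<le> rinner (\<lambda>w. f w - g w) (\<lambda>w. f w - g w)"
  by (simp add: rinner_diff_self V_Fock V_isometry assms)

end

lemma Fock_box_integrable:
  fixes h :: "real list \<Rightarrow> 'k::{complex_hilbert, second_countable_topology}"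
  assumes "h \<in> Fock"
  shows "integrable conf_measure (\<lambda>w. indicator (conf_box R) w * norm (h w))"
proof (rule Bochner_Integration.integrable_bound)
  note [measurable] = Fock_measurable[OF assms]
  show "integrable conf_measure (\<lambda>w. indicator (conf_box R) w + (norm (h w))\<^sup>2 :: real)"
    using emeasure_conf_box[of R]
    by (intro Bochner_Integration.integrable_add integrable_real_indicator Fock_integrable assms) auto
  have "x \<le> 1 + x\<^sup>2" if "0 \<le> x" for x :: real
    using zero_le_power2[of "x - 1"] that by (simp add: power2_diff)
  then show "AE w in conf_measure. norm (indicator (conf_box R) w * norm (h w)) \<le> norm (indicator (conf_box R) w + (norm (h w))\<^sup>2 :: real)"
    by (intro AE_I2) (auto simp: indicator_def)
  show "(\<lambda>w. indicator (conf_box R) w * norm (h w)) \<in> borel_measurable conf_measure" by measurable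
qed

text \<open>The weak identification of an element of the Fock space with an explicit function.
  Square integrability of \<open>h'\<close> is not known beforehand; boundedness for each number of
  points makes all tests meaningful.\<close>

lemma Fock_AE_eqI:
  fixes h h' :: "real list \<Rightarrow> 'k::{complex_hilbert, second_countable_topology}"
  assumes h: "h \<in> Fock" and [measurable]: "h' \<in> borel_measurable conf_measure" and sym: "symmetric h'"
    and bdd: "\<And>n. \<exists>D. \<forall>w. length w \<le> n \<longrightarrow> norm (h' w) \<le> D"
    and eq: "\<And>\<phi>. \<phi> \<in> test_functions \<Longrightarrow> \<phi> \<in> bfun \<Longrightarrow> rinner \<phi> h = (LINT w|conf_measure. rin (\<phi> w) (h' w))"
  shows "AE w in conf_measure. h w = h' w"
proof -
  note [measurable] = Fock_measurable[OF h]
  have box': "integrable conf_measure (\<lambda>w. indicator (conf_box R) w * norm (h' w))" for R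
  proof -
    obtain D where D: "\<And>w. length w \<le> R \<Longrightarrow> norm (h' w) \<le> D" using bdd by blast
    show ?thesis
    proof (rule integrable_conf_box[where C = D and R = R])
      show "norm (indicator (conf_box R) w * norm (h' w)) \<le> D * indicator (conf_box R) w" for w
        using D[of w] by (auto simp: indicator_def conf_box_def)
    qed measurable
  qed
  have box: "integrable conf_measure (\<lambda>w. indicator (conf_box R) w * norm (h w - h' w))" for R
  proof (rule Bochner_Integration.integrable_bound)
    show "integrable conf_measure (\<lambda>w. indicator (conf_box R) w * norm (h w) + indicator (conf_box R) w * norm (h' w))"
      by (intro Bochner_Integration.integrable_add Fock_box_integrable h box')
    show "AE w in conf_measure. norm (indicator (conf_box R) w * norm (h w - h' w))
        \<le> norm (indicator (conf_box R) w * norm (h w) + indicator (conf_box R) w * norm (h' w))"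
      by (intro AE_I2) (auto simp: indicator_def norm_triangle_ineq4)
  qed measurable
  have "AE w in conf_measure. h w - h' w = 0"
  proof (rule conf_AE_zeroI[OF _ _ box])
    show "symmetric (\<lambda>w. h w - h' w)"
      unfolding symmetric_def
    proof (intro allI impI)
      fix v w :: "real list" assume vw: "mset v = mset w"
      show "h v - h' v = h w - h' w"
        using symmetricD[OF Fock_symmetric[OF h] vw] symmetricD[OF sym vw] by simp
    qed
    fix \<phi> :: "real list \<Rightarrow> 'k" assume \<phi>: "\<phi> \<in> test_functions" "\<phi> \<in> bfun"
    note [measurable] = bfun_measurable[OF \<phi>(2)]
    obtain C R where C: "0 \<le> C" "\<And>w. norm (\<phi> w) \<le> C * indicator (conf_box R) w"
      using bfun_bound[OF \<phi>(2)] by metis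
    have i': "integrable conf_measure (\<lambda>w. rin (\<phi> w) (h' w))"
    proof (rule Bochner_Integration.integrable_bound)
      show "integrable conf_measure (\<lambda>w. C * (indicator (conf_box R) w * norm (h' w)))"
        by (intro integrable_mult_right box')
      have "\<bar>rin (\<phi> w) (h' w)\<bar> \<le> C * (indicator (conf_box R) w * norm (h' w))" for w
        using rin_Cauchy_Schwarz[of "\<phi> w" "h' w"] mult_right_mono[OF C(2)[of w], of "norm (h' w)"] by simp
      then show "AE w in conf_measure. norm (rin (\<phi> w) (h' w)) \<le> norm (C * (indicator (conf_box R) w * norm (h' w)))"
        by (intro AE_I2) (auto intro: order_trans[OF _ abs_ge_self])
    qed measurable
    show "(LINT w|conf_measure. rin (\<phi> w) (h w - h' w)) = 0"
      unfolding rin.diff_right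
      using Bochner_Integration.integral_diff[OF integrable_rin[OF bfun_Fock[OF \<phi>(2)] h] i'] eq[OF \<phi>]
      by (simp add: rinner_def)
  qed measurable
  then show ?thesis by eventually_elim simp
qed

section \<open>Identification with kernel operators\<close>

lemma rinner_cong_AE:
  fixes f f' g :: "real list \<Rightarrow> 'k::{complex_hilbert, second_countable_topology}"
  assumes "AE w in conf_measure. f w = f' w"
    "f \<in> borel_measurable conf_measure" "f' \<in> borel_measurable conf_measure" "g \<in> borel_measurable conf_measure"
  shows "rinner f g = rinner f' g"
  unfolding rinner_def using assms by (intro integral_cong_AE) (auto elim!: eventually_mono)

lemma wnorm2_reflect:
  fixes f :: "real list \<Rightarrow> 'k::{complex_hilbert, second_countable_topology}"
  assumes [measurable]: "f \<in> borel_measurable conf_measure"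
  shows "wnorm2 k (\<lambda>w. f (map uminus w)) = wnorm2 k f"
proof -
  let ?F = "\<lambda>w. ennreal ((1 + real (length w)) ^ k * (norm (f w))\<^sup>2)"
  have "wnorm2 k f = (\<integral>\<^sup>+w. ?F w \<partial>distr conf_measure conf_measure (map uminus))"
    unfolding distr_uminus_conf wnorm2_def ..
  also have "\<dots> = (\<integral>\<^sup>+w. ?F (map uminus w) \<partial>conf_measure)"
    by (rule nn_integral_distr) measurable
  finally show ?thesis by (simp add: wnorm2_def)
qed

locale kernel_unitary_pair = evolution_kernel A1 A0 Am B + unitary_pair V W
  for A1 A0 Am B :: "'k::{complex_hilbert, second_countable_topology} \<Rightarrow>\<^sub>L 'k"
    and V W :: "(real list \<Rightarrow> 'k) \<Rightarrow> real list \<Rightarrow> 'k" +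
  fixes s t :: real
  assumes st: "s < t"
    and V_test: "g \<in> test_functions \<Longrightarrow> AE w in conf_measure. V g w = mop s t [] g w"
begin

sublocale dual: evolution_kernel "radj Am" "radj A0" "radj A1" "radj B" .

lemma st': "s \<le> t" "- t \<le> - s" using st by simp_all

lemma rop_eq: "rop s t g w = dual.mop (- t) (- s) [] (\<lambda>v. g (map uminus v)) (map uminus w)"
  unfolding rop_def ..

lemma borel_measurable_rop:
  assumes [measurable]: "g \<in> borel_measurable conf_measure"
  shows "rop s t g \<in> borel_measurable conf_measure"
proof -
  have "(\<lambda>v. g (map uminus v)) \<in> borel_measurable conf_measure" by measurable
  from measurable_compose[OF measurable_map_uminus_conf dual.borel_measurable_mop[OF this]]
  show ?thesis unfolding rop_eq[abs_def] .
qed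

lemma symmetric_rop:
  assumes "g \<in> bfun"
  shows "symmetric (rop s t g)"
  unfolding symmetric_def rop_eq
  by (intro allI impI symmetricD[OF dual.symmetric_mop[OF bfun_symmetric[OF bfun_reflect[OF assms]]]]) simp

lemma mop_bfun_bounded:
  assumes "g \<in> bfun"
  shows "\<exists>D. \<forall>w. length w \<le> n \<longrightarrow> norm (mop s t [] g w) \<le> D"
proof -
  obtain C R where C: "0 \<le> C" "\<And>w. norm (g w) \<le> C * indicator (conf_box R) w"
    using bfun_bound[OF assms] by metis
  show ?thesis
    using mop_bounded[OF st'(1) C(1), of R n "[]"] bfun_measurable[OF assms] C(2) by blast
qed

lemma rop_bfun_bounded:
  assumes "g \<in> bfun"
  shows "\<exists>D. \<forall>w. length w \<le> n \<longrightarrow> norm (rop s t g w) \<le> D"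
proof -
  note g' = bfun_reflect[OF assms]
  obtain C R where C: "0 \<le> C" "\<And>w. norm (g (map uminus w)) \<le> C * indicator (conf_box R) w"
    using bfun_bound[OF g'] by metis
  obtain D where "\<forall>g w. g \<in> borel_measurable conf_measure \<longrightarrow> (\<forall>v. norm (g v) \<le> C * indicator (conf_box R) v)
    \<longrightarrow> length w \<le> n \<longrightarrow> norm (dual.mop (- t) (- s) [] g w) \<le> D"
    using dual.mop_bounded[OF st'(2) C(1), of R n "[]"] by blast
  then have "length w \<le> n \<longrightarrow> norm (rop s t g w) \<le> D" for w
    unfolding rop_eq using bfun_measurable[OF g'] C(2) by simp
  then show ?thesis by blast
qed

text \<open>Tested against a test function, \<open>W\<close> becomes \<open>V\<close> on this test
  function, where \<open>V_test\<close> gives the kernel formula; \<open>mop_dual\<close> moves the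
  kernel back.\<close>

lemma W_eq_rop:
  assumes g: "g \<in> bfun"
  shows "AE w in conf_measure. W g w = rop s t g w"
proof (rule Fock_AE_eqI[OF W_Fock[OF bfun_Fock[OF g]] borel_measurable_rop[OF bfun_measurable[OF g]] symmetric_rop[OF g] rop_bfun_bounded[OF g]])
  fix \<phi> :: "real list \<Rightarrow> 'k" assume \<phi>: "\<phi> \<in> test_functions" "\<phi> \<in> bfun"
  have "rinner \<phi> (W g) = rinner (V \<phi>) g"
    by (rule V_W[OF bfun_Fock[OF \<phi>(2)] bfun_Fock[OF g], symmetric])
  also have "\<dots> = rinner (mop s t [] \<phi>) g"
    by (intro rinner_cong_AE V_test \<phi> Fock_measurable V_Fock bfun_Fock borel_measurable_mop bfun_measurable g)
  also have "\<dots> = (LINT w|conf_measure. rin (\<phi> w) (rop s t g w))"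
    unfolding rinner_def by (rule mop_dual[OF st'(1) \<phi>(2) g])
  finally show "rinner \<phi> (W g) = (LINT w|conf_measure. rin (\<phi> w) (rop s t g w))" .
qed

text \<open>The converse passage. Tested against a test function, \<open>V f\<close> becomes
  \<open>W\<close> on this test function, which is known by the preceding lemma. This extends the
  kernel formula from test functions to all of \<open>bfun\<close>.\<close>

lemma V_eq_mop:
  assumes f: "f \<in> bfun"
  shows "AE w in conf_measure. V f w = mop s t [] f w"
proof (rule Fock_AE_eqI[OF V_Fock[OF bfun_Fock[OF f]] borel_measurable_mop[OF bfun_measurable[OF f]] symmetric_mop[OF bfun_symmetric[OF f]] mop_bfun_bounded[OF f]])
  fix \<phi> :: "real list \<Rightarrow> 'k" assume \<phi>: "\<phi> \<in> test_functions" "\<phi> \<in> bfun"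
  have "rinner \<phi> (V f) = rinner f (W \<phi>)"
    unfolding rinner_commute[of \<phi>] by (rule V_W[OF bfun_Fock[OF f] bfun_Fock[OF \<phi>(2)]])
  also have "\<dots> = rinner (W \<phi>) f" by (rule rinner_commute)
  also have "\<dots> = rinner (rop s t \<phi>) f"
    by (intro rinner_cong_AE W_eq_rop \<phi> Fock_measurable W_Fock bfun_Fock borel_measurable_rop bfun_measurable f)
  also have "\<dots> = (LINT w|conf_measure. rin (f w) (rop s t \<phi> w))"
    unfolding rinner_commute[of _ f] by (simp only: rinner_def)
  also have "\<dots> = (LINT w|conf_measure. rin (mop s t [] f w) (\<phi> w))"
    by (rule mop_dual[OF st'(1) f \<phi>(2), symmetric])
  also have "\<dots> = (LINT w|conf_measure. rin (\<phi> w) (mop s t [] f w))"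
    by (simp only: rin_commute)
  finally show "rinner \<phi> (V f) = (LINT w|conf_measure. rin (\<phi> w) (mop s t [] f w))" .
qed

lemma mop_contraction:
  assumes f: "f \<in> bfun"
  shows "wnorm2 0 (mop s t [] f) \<le> wnorm2 0 f"
proof -
  note F = bfun_Fock[OF f]
  have "wnorm2 0 (mop s t [] f) = wnorm2 0 (V f)"
    by (rule wnorm2_cong_AE[OF V_eq_mop[OF f], symmetric])
  also have "\<dots> = wnorm2 0 f"
    by (simp only: wnorm2_0_rinner[OF F] wnorm2_0_rinner[OF V_Fock[OF F]] V_isometry[OF F F])
  finally show ?thesis by simp
qed

lemma wnorm2_rop:
  assumes "g \<in> bfun"
  shows "wnorm2 k (rop s t g) = wnorm2 k (dual.mop (- t) (- s) [] (\<lambda>v. g (map uminus v)))"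
  unfolding rop_eq[abs_def]
  by (intro wnorm2_reflect dual.borel_measurable_mop bfun_measurable bfun_reflect assms)

text \<open>Up to reflection, which preserves norms, this operator is \<open>W\<close>, and the
  adjoint of an isometry is a contraction.\<close>

lemma dual_mop_contraction:
  assumes g: "g \<in> bfun"
  shows "wnorm2 0 (dual.mop (- t) (- s) [] g) \<le> wnorm2 0 g"
proof -
  let ?g = "\<lambda>v. g (map uminus v)"
  have g': "?g \<in> bfun" by (rule bfun_reflect[OF g])
  note G = bfun_Fock[OF g']
  have "wnorm2 0 (dual.mop (- t) (- s) [] g) = wnorm2 0 (rop s t ?g)"
    unfolding wnorm2_rop[OF g'] by simp
  also have "\<dots> = wnorm2 0 (W ?g)"
    by (rule wnorm2_cong_AE[OF W_eq_rop[OF g'], symmetric])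
  also have "\<dots> \<le> wnorm2 0 ?g"
    unfolding wnorm2_0_rinner[OF G] wnorm2_0_rinner[OF W_Fock[OF G]] by (rule ennreal_leI[OF W_contraction[OF G]])
  also have "\<dots> = wnorm2 0 g"
    by (rule wnorm2_reflect[OF bfun_measurable[OF g]])
  finally show ?thesis .
qed

end

text \<open>Truncation and Fatou's lemma.\<close>

lemma wnorm2_bound_extend:
  fixes T :: "(real list \<Rightarrow> 'k::{complex_hilbert, second_countable_topology}) \<Rightarrow> real list \<Rightarrow> 'k"
  assumes T_Fock: "\<And>g. g \<in> Fock \<Longrightarrow> T g \<in> Fock"
    and T_diff: "\<And>f g. f \<in> Fock \<Longrightarrow> g \<in> Fock \<Longrightarrow>
      rinner (\<lambda>w. T f w - T g w) (\<lambda>w. T f w - T g w) \<le> rinner (\<lambda>w. f w - g w) (\<lambda>w. f w - g w)"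
    and T_bfun: "\<And>g. g \<in> bfun \<Longrightarrow> wnorm2 k (T g) \<le> c * wnorm2 k g"
    and g: "g \<in> Fock"
  shows "wnorm2 k (T g) \<le> c * wnorm2 k g"
proof -
  note gm [measurable] = Fock_measurable[OF g]
  define G where "G n w = (if w \<in> conf_box n \<and> norm (g w) \<le> real n then g w else 0)" for n w
  have [measurable]: "Measurable.pred conf_measure (\<lambda>w. w \<in> conf_box n)" for n
    using sets_conf_box[of n] by (simp add: pred_def space_conf_measure)
  have G: "G n \<in> bfun" for n
  proof (rule bfunI)
    show "G n \<in> borel_measurable conf_measure" unfolding G_def[abs_def] by measurable
    show "symmetric (G n)"
      unfolding symmetric_def
    proof (intro allI impI)
      fix v w :: "real list" assume vw: "mset v = mset w"
      have "v \<in> conf_box n \<longleftrightarrow> w \<in> conf_box n"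
        using mset_eq_setD[OF vw] mset_eq_length[OF vw] by (simp add: conf_box_def)
      then show "G n v = G n w"
        using symmetricD[OF Fock_symmetric[OF g] vw] by (simp add: G_def)
    qed
    show "norm (G n w) \<le> real n * indicator (conf_box n) w" for w
      by (simp add: G_def indicator_def)
  qed
  note GF = bfun_Fock[OF G]
  have G_le: "wnorm2 k (G n) \<le> wnorm2 k g" for n
    unfolding wnorm2_def by (intro nn_integral_mono ennreal_leI mult_left_mono) (auto simp: G_def)
  have lim: "(\<lambda>n. G n w) \<longlonglongrightarrow> g w" for w
  proof -
    obtain R where R: "w \<in> conf_box R" using mem_conf_box_ex by blast
    obtain m :: nat where m: "norm (g w) \<le> real m" using real_arch_simple by blast
    have "G n w = g w" if "max R m \<le> n" for n
      using that R m conf_box_mono[of R n] by (auto simp: G_def)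
    then have "\<forall>\<^sub>F n in sequentially. G n w = g w"
      unfolding eventually_sequentially by blast
    then show ?thesis by (rule tendsto_eventually)
  qed
  let ?u = "\<lambda>n w. (norm (T (G n) w - T g w))\<^sup>2"
  have "(\<lambda>n. LINT w|conf_measure. (norm (G n w - g w))\<^sup>2) \<longlonglongrightarrow> (LINT w|conf_measure. (0::real))"
  proof (rule integral_dominated_convergence)
    show "integrable conf_measure (\<lambda>w. (norm (g w))\<^sup>2)" by (rule Fock_integrable[OF g])
    show "(\<lambda>w. (norm (G n w - g w))\<^sup>2) \<in> borel_measurable conf_measure" for n
      using bfun_measurable[OF G[of n]] by measurable
    show "AE w in conf_measure. (\<lambda>n. (norm (G n w - g w))\<^sup>2) \<longlonglongrightarrow> 0"
    proof (rule AE_I2)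
      fix w
      have "(\<lambda>n. (norm (G n w - g w))\<^sup>2) \<longlonglongrightarrow> (norm (g w - g w))\<^sup>2"
        by (intro tendsto_intros lim)
      then show "(\<lambda>n. (norm (G n w - g w))\<^sup>2) \<longlonglongrightarrow> 0" by simp
    qed
    show "AE w in conf_measure. norm ((norm (G n w - g w))\<^sup>2) \<le> (norm (g w))\<^sup>2" for n
      by (intro AE_I2) (simp add: G_def)
  qed simp
  then have lim0: "(\<lambda>n. rinner (\<lambda>w. G n w - g w) (\<lambda>w. G n w - g w)) \<longlonglongrightarrow> 0"
    by (simp add: rinner_def rin_self)
  have "(\<lambda>n. LINT w|conf_measure. ?u n w) \<longlonglongrightarrow> 0"
  proof (rule tendsto_sandwich[OF _ _ tendsto_const lim0])
    show "\<forall>\<^sub>F n in sequentially. 0 \<le> (LINT w|conf_measure. ?u n w)"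
      by (intro always_eventually allI integral_nonneg_AE) simp
    show "\<forall>\<^sub>F n in sequentially. (LINT w|conf_measure. ?u n w) \<le> rinner (\<lambda>w. G n w - g w) (\<lambda>w. G n w - g w)"
      using T_diff[OF GF g] by (intro always_eventually allI) (simp add: rinner_def rin_self)
  qed
  then have "(\<lambda>n. LINT w|conf_measure. norm (?u n w)) \<longlonglongrightarrow> 0" by simp
  moreover have "integrable conf_measure (?u n)" for n
    by (intro Fock_integrable[OF Fock_diff] T_Fock GF g)
  \<comment> \<open>Mean square convergence gives convergence almost everywhere only along a
    subsequence, which is enough for Fatou's lemma.\<close>
  ultimately obtain r :: "nat \<Rightarrow> nat" where "AE w in conf_measure. (\<lambda>n. ?u (r n) w) \<longlonglongrightarrow> 0"
    using tendsto_L1_AE_subseq[of conf_measure ?u] by blast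
  then have conv: "AE w in conf_measure. (\<lambda>n. T (G (r n)) w) \<longlonglongrightarrow> T g w"
  proof eventually_elim
    case (elim w)
    have "(\<lambda>n. sqrt (?u (r n) w)) \<longlonglongrightarrow> sqrt 0" by (intro tendsto_real_sqrt elim)
    then have "(\<lambda>n. norm (T (G (r n)) w - T g w)) \<longlonglongrightarrow> 0" by simp
    then show ?case
      using tendsto_norm_zero_iff[of "\<lambda>n. T (G (r n)) w - T g w" sequentially] LIM_zero_iff[of "\<lambda>n. T (G (r n)) w" "T g w" sequentially] by simp
  qed
  let ?F = "\<lambda>n w. ennreal ((1 + real (length w)) ^ k * (norm (T (G (r n)) w))\<^sup>2)"
  have "wnorm2 k (T g) = (\<integral>\<^sup>+w. liminf (\<lambda>n. ?F n w) \<partial>conf_measure)"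
    unfolding wnorm2_def
  proof (rule nn_integral_cong_AE, use conv in eventually_elim)
    case (elim w)
    have "(\<lambda>n. ?F n w) \<longlonglongrightarrow> ennreal ((1 + real (length w)) ^ k * (norm (T g w))\<^sup>2)"
      by (intro tendsto_ennrealI tendsto_mult tendsto_const tendsto_power tendsto_norm elim)
    from lim_imp_Liminf[OF _ this] show ?case by simp
  qed
  also have "\<dots> \<le> liminf (\<lambda>n. \<integral>\<^sup>+w. ?F n w \<partial>conf_measure)"
    by (rule nn_integral_liminf) (intro borel_measurable_weight Fock_measurable T_Fock GF)
  also have "\<dots> = liminf (\<lambda>n. wnorm2 k (T (G (r n))))"
    by (simp only: wnorm2_def)
  also have "\<dots> \<le> liminf (\<lambda>n. c * wnorm2 k g)"
    by (intro Liminf_mono always_eventually allI order_trans[OF T_bfun[OF G] mult_left_mono[OF G_le]]) simp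
  also have "\<dots> = c * wnorm2 k g"
    by (simp add: Liminf_const)
  finally show ?thesis .
qed

section \<open>The bound for the evolution\<close>

lemma Gamma_space_Fock: "g \<in> Gamma_space k \<Longrightarrow> g \<in> Fock"
  using wnorm2_mono[of 0 k g] by (auto simp: Gamma_space_def Gamma_norm2_eq_wnorm2)

theorem theorem4p6p1:
  fixes A1 A0 Am B :: "'k::{complex_hilbert, second_countable_topology} \<Rightarrow>\<^sub>L 'k"
    and U :: "real \<Rightarrow> real \<Rightarrow> (real list \<Rightarrow> 'k) \<Rightarrow> (real list \<Rightarrow> 'k)"
  assumes "A1 \<in> bounded_ops" "A0 \<in> bounded_ops" "Am \<in> bounded_ops" "B \<in> bounded_ops"
    and "unitarity_conditions A1 A0 Am B"
    and "unitary_evolution A1 A0 Am B U"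
  shows "\<forall>k::nat. \<exists>P::real poly. degree P \<le> k \<and>
    (\<forall>g\<in>Gamma_space k. \<forall>s t::real.
       Gamma_norm2 k (U t s g) \<le> ennreal (poly P \<bar>t - s\<bar>) * Gamma_norm2 k g)"
proof
  fix k :: nat
  have U: "\<And>s t. s < t \<Longrightarrow> unitary_on_Fock (U t s)"
    "\<And>s t g. s < t \<Longrightarrow> g \<in> test_functions \<Longrightarrow> AE w in conf_measure. U t s g w = kernel_op (kernel A1 A0 Am B s t) g w"
    "\<And>s g. g \<in> Fock \<Longrightarrow> AE w in conf_measure. U s s g w = g w"
    "\<And>s t. t < s \<Longrightarrow> adjoint_on_Fock (U s t) (U t s)"
    using assms(6) unfolding unitary_evolution_def by blast+
  have pair: "kernel_unitary_pair A1 A0 Am B (U t s) (U s t) s t" if "s < t" for s t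
    using that U(1)[OF that] U(2)[OF that] U(4)[of s t]
    by unfold_locales (simp_all add: marked_kernel_Nil)
  interpret fwd: contraction_kernel A1 A0 Am B
  proof
    fix s t :: real and g :: "real list \<Rightarrow> 'k" assume "s < t" "g \<in> bfun"
    then interpret kernel_unitary_pair A1 A0 Am B "U t s" "U s t" s t by (intro pair)
    show "(\<integral>\<^sup>+w. sqn (mop s t [] g w) \<partial>conf_measure) \<le> (\<integral>\<^sup>+w. sqn (g w) \<partial>conf_measure)"
      using mop_contraction[OF \<open>g \<in> bfun\<close>] by (simp only: wnorm2_0)
  qed
  interpret bwd: contraction_kernel "radj Am" "radj A0" "radj A1" "radj B"
  proof
    fix s t :: real and g :: "real list \<Rightarrow> 'k" assume "s < t" "g \<in> bfun"
    \<comment> \<open>The times are reflected in advance, so that the dual kernel of this pair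
      belongs to the interval from \<open>s\<close> to \<open>t\<close>.\<close>
    then interpret kernel_unitary_pair A1 A0 Am B "U (- s) (- t)" "U (- t) (- s)" "- t" "- s" by (intro pair) simp
    show "(\<integral>\<^sup>+w. sqn (kernel_op (marked_kernel (radj Am) (radj A0) (radj A1) (radj B) s t []) g w) \<partial>conf_measure)
        \<le> (\<integral>\<^sup>+w. sqn (g w) \<partial>conf_measure)"
      using dual_mop_contraction[OF \<open>g \<in> bfun\<close>] by (simp only: wnorm2_0 minus_minus)
  qed
  obtain C where C: "0 \<le> C" "\<And>s t g. s < t \<Longrightarrow> g \<in> bfun \<Longrightarrow>
      wnorm2 k (fwd.mop s t [] g) \<le> ennreal (C * (1 + (t - s)) ^ k) * wnorm2 k g"
  proof -
    \<comment> \<open>Without marks at the start, \<open>K\<close> only has to dominate the two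
      operators that the induction inserts.\<close>
    let ?K = "max (norm A1) (norm (A0 + id_blinfun))"
    obtain C where "0 \<le> C" "\<forall>s t ms g. s < t \<longrightarrow> length ms = 0 \<longrightarrow> distinct (map fst ms) \<longrightarrow>
      (\<forall>z\<in>set ms. s < fst z \<and> fst z < t \<and> norm (snd z) \<le> ?K) \<longrightarrow> g \<in> bfun \<longrightarrow>
      wnorm2 k (fwd.mop s t ms g) \<le> ennreal (C * (1 + (t - s)) ^ k) * wnorm2 k g"
      using fwd.mop_wnorm2_bound[of ?K 0 k] by auto
    then show thesis by (intro that[of C]) simp_all
  qed
  obtain C' where C': "0 \<le> C'" "\<And>s t g. s < t \<Longrightarrow> g \<in> bfun \<Longrightarrow>
      wnorm2 k (bwd.mop s t [] g) \<le> ennreal (C' * (1 + (t - s)) ^ k) * wnorm2 k g"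
  proof -
    let ?K = "max (norm (radj Am)) (norm (radj A0 + id_blinfun))"
    obtain C where "0 \<le> C" "\<forall>s t ms g. s < t \<longrightarrow> length ms = 0 \<longrightarrow> distinct (map fst ms) \<longrightarrow>
      (\<forall>z\<in>set ms. s < fst z \<and> fst z < t \<and> norm (snd z) \<le> ?K) \<longrightarrow> g \<in> bfun \<longrightarrow>
      wnorm2 k (bwd.mop s t ms g) \<le> ennreal (C * (1 + (t - s)) ^ k) * wnorm2 k g"
      using bwd.mop_wnorm2_bound[of ?K 0 k] by auto
    then show thesis by (intro that[of C]) simp_all
  qed
  \<comment> \<open>One polynomial for all orders of the times: \<open>C\<close> is needed for
    \<open>s < t\<close>, \<open>C'\<close> for \<open>t < s\<close>, and 1 for
    \<open>s = t\<close>.\<close>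
  define P where "P = Polynomial.smult (1 + C + C') ([:1, 1:] ^ k)"
  have poly: "poly P x = (1 + C + C') * (1 + x) ^ k" for x by (simp add: P_def)
  have "degree ([:1, 1::real:] ^ k) \<le> degree [:1, 1::real:] * k" by (rule degree_power_le)
  then have deg: "degree P \<le> k" unfolding P_def by (intro order_trans[OF degree_smult_le]) simp
  \<comment> \<open>The estimate is proved on the whole Fock space, where both sides may be
    infinite. So no finiteness has to be carried through the approximation.\<close>
  have "wnorm2 k (U t s g) \<le> ennreal (poly P \<bar>t - s\<bar>) * wnorm2 k g" if g: "g \<in> Fock" for g and s t :: real
  proof (cases s t rule: linorder_cases)
    case less
    interpret kernel_unitary_pair A1 A0 Am B "U t s" "U s t" s t by (rule pair[OF less])
    show ?thesis
    proof (rule wnorm2_bound_extend[OF V_Fock V_diff _ g])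
      fix f :: "real list \<Rightarrow> 'k" assume f: "f \<in> bfun"
      have "wnorm2 k (U t s f) = wnorm2 k (fwd.mop s t [] f)" by (rule wnorm2_cong_AE[OF V_eq_mop[OF f]])
      also have "\<dots> \<le> ennreal (C * (1 + (t - s)) ^ k) * wnorm2 k f" by (rule C(2)[OF less f])
      also have "\<dots> \<le> ennreal (poly P \<bar>t - s\<bar>) * wnorm2 k f"
        unfolding poly using less C(1) C'(1) by (intro mult_right_mono ennreal_leI) auto
      finally show "wnorm2 k (U t s f) \<le> ennreal (poly P \<bar>t - s\<bar>) * wnorm2 k f" .
    qed
  next
    case equal
    have "wnorm2 k (U t s g) = wnorm2 k g" unfolding equal by (rule wnorm2_cong_AE[OF U(3)[OF g]])
    also have "\<dots> = ennreal 1 * wnorm2 k g" by simp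
    also have "\<dots> \<le> ennreal (poly P \<bar>t - s\<bar>) * wnorm2 k g"
      unfolding poly equal using C(1) C'(1) by (intro mult_right_mono ennreal_leI) auto
    finally show ?thesis .
  next
    case greater
    interpret kernel_unitary_pair A1 A0 Am B "U s t" "U t s" t s by (rule pair[OF greater])
    show ?thesis
    proof (rule wnorm2_bound_extend[OF W_Fock W_diff _ g])
      fix f :: "real list \<Rightarrow> 'k" assume f: "f \<in> bfun"
      let ?f = "\<lambda>v. f (map uminus v)"
      have "wnorm2 k (U t s f) = wnorm2 k (fwd.rop t s f)" by (rule wnorm2_cong_AE[OF W_eq_rop[OF f]])
      also have "\<dots> = wnorm2 k (bwd.mop (- s) (- t) [] ?f)" by (rule wnorm2_rop[OF f])
      also have "\<dots> \<le> ennreal (C' * (1 + (- t - - s)) ^ k) * wnorm2 k ?f"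
        using greater by (intro C'(2) bfun_reflect f) simp
      also have "wnorm2 k ?f = wnorm2 k f" by (rule wnorm2_reflect[OF bfun_measurable[OF f]])
      also have "ennreal (C' * (1 + (- t - - s)) ^ k) * wnorm2 k f \<le> ennreal (poly P \<bar>t - s\<bar>) * wnorm2 k f"
        unfolding poly using greater C(1) C'(1) by (intro mult_right_mono ennreal_leI) auto
      finally show "wnorm2 k (U t s f) \<le> ennreal (poly P \<bar>t - s\<bar>) * wnorm2 k f" .
    qed
  qed
  then have "\<forall>g\<in>Gamma_space k. \<forall>s t::real. Gamma_norm2 k (U t s g) \<le> ennreal (poly P \<bar>t - s\<bar>) * Gamma_norm2 k g"
    unfolding Gamma_norm2_eq_wnorm2 using Gamma_space_Fock by blast
  with deg show "\<exists>P::real poly. degree P \<le> k \<and>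
    (\<forall>g\<in>Gamma_space k. \<forall>s t::real. Gamma_norm2 k (U t s g) \<le> ennreal (poly P \<bar>t - s\<bar>) * Gamma_norm2 k g)"
    by blast
qed

end
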